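(* There is a $2.294$-approximation algorithm running in $O(n^4)$ time for the capacitated $k$-median problem with non-uniform and hard capacities in the special case where the distance function takes only two possible values on client-facility pairs.
   Context: Capacitated $k$-median with non-uniform hard capacities: given a set of facilities $F$ with capacities $u_i\in\mathbb{N}^+$ for $i\in F$, a set of clients $C$, a metric distance $d:C\times F\to\mathbb{R}_{\geq0}$ and an integer $k$, find $F'\subseteq F$ with $|F'|=k$ (each facility opened at most once) and an assignment $\sigma:C\to F'$ with $|\sigma^{-1}(i)|\leq u_i$ for all $i\in F'$, minimizing $\sum_{j\in C}d(j,\sigma(j))$. Here $n$ denotes the input size parameter (number of clients), and the special case assumes $d(j,i)\in\{a,b\}$ for all $j\in C$, $i\in F$, for some $a,b\in\mathbb{R}_{\geq0}$.
   Formalization: In the O(n^4) bound, n is the maximum of the numbers of clients and facilities; with n the number of clients alone the claim fails, since with k = 1 and arbitrarily many facilities every capacity may have to be read to find a feasible solution. *)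

theory Defs
  imports Complex_Main "HOL-Library.FuncSet" "HOL-Library.Landau_Symbols"
begin

section \<open>Capacitated k-median with non-uniform hard capacities\<close>

record ('c, 'f) ckm =
  clients :: "'c set"
  facilities :: "'f set"
  capacity :: "'f \<Rightarrow> nat"
  distance :: "'c \<Rightarrow> 'f \<Rightarrow> real"
  num_open :: nat

definition pseudometric_on :: "'a set \<Rightarrow> ('a \<Rightarrow> 'a \<Rightarrow> real) \<Rightarrow> bool" where
  "pseudometric_on X D \<longleftrightarrow>
     (\<forall>x\<in>X. D x x = 0) \<and>
     (\<forall>x\<in>X. \<forall>y\<in>X. 0 \<le> D x y \<and> D x y = D y x) \<and>
     (\<forall>x\<in>X. \<forall>y\<in>X. \<forall>z\<in>X. D x z \<le> D x y + D y z)"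

text \<open>
  A distance given only on client-facility pairs is metric if it is the restriction of a metric on
  all clients and facilities. Distance 0 between a client and a facility (co-location) is allowed,
  hence pseudometrics.
\<close>

definition metric_distance :: "'c set \<Rightarrow> 'f set \<Rightarrow> ('c \<Rightarrow> 'f \<Rightarrow> real) \<Rightarrow> bool" where
  "metric_distance C F d \<longleftrightarrow>
     (\<exists>D. pseudometric_on (C <+> F) D \<and> (\<forall>j\<in>C. \<forall>i\<in>F. D (Inl j) (Inr i) = d j i))"

definition ckm_instance :: "('c, 'f) ckm \<Rightarrow> bool" where
  "ckm_instance I \<longleftrightarrow>
     finite (clients I) \<and> finite (facilities I) \<and>
     (\<forall>i\<in>facilities I. 0 < capacity I i) \<and>
     metric_distance (clients I) (facilities I) (distance I)"

definition two_valued :: "('c, 'f) ckm \<Rightarrow> bool" where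
  "two_valued I \<longleftrightarrow>
     (\<exists>a\<ge>0. \<exists>b\<ge>0. \<forall>j\<in>clients I. \<forall>i\<in>facilities I. distance I j i \<in> {a, b})"

type_synonym ('c, 'f) solution = "'f set \<times> ('c \<Rightarrow> 'f)"

fun feasible :: "('c, 'f) ckm \<Rightarrow> ('c, 'f) solution \<Rightarrow> bool" where
  "feasible I (F', \<sigma>) \<longleftrightarrow>
     F' \<subseteq> facilities I \<and> card F' = num_open I \<and>
     \<sigma> \<in> clients I \<rightarrow> F' \<and>
     (\<forall>i\<in>F'. card {j \<in> clients I. \<sigma> j = i} \<le> capacity I i)"

fun cost :: "('c, 'f) ckm \<Rightarrow> ('c, 'f) solution \<Rightarrow> real" where
  "cost I (F', \<sigma>) = (\<Sum>j\<in>clients I. distance I j (\<sigma> j))"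

text \<open>Only meaningful if the instance has a feasible solution (infimum of a nonempty set).\<close>

definition opt :: "('c, 'f) ckm \<Rightarrow> real" where
  "opt I = (INF S \<in> {S. feasible I S}. cost I S)"


section \<open>Machine model: a real RAM with unit cost\<close>

text \<open>
  Programs are finite syntactic objects over named, indirectly addressable arrays of natural numbers
  and of reals; scalars are cells with index 0. Arithmetic is deliberately kept to what every
  unit-cost (real) RAM offers: addition, subtraction and comparison. In particular there is no
  rounding of reals, there are no real constants (which could carry advice), and there is no
  multiplication (which could create numbers of exponential length in polynomially many steps).
\<close>

datatype nexp =
    NConst nat
  | NCell string nexp
  | NPlus nexp nexp
  | NMinus nexp nexp

datatype rexp =
    RCell string nexp
  | RPlus rexp rexp
  | RMinus rexp rexp

datatype bexp =
    NLess nexp nexp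
  | RLess rexp rexp
  | Not bexp
  | And bexp bexp

datatype com =
    Skip
  | NAssign string nexp nexp
  | RAssign string nexp rexp
  | Seq com com
  | If bexp com com
  | While bexp com

record state =
  nats :: "string \<Rightarrow> nat \<Rightarrow> nat"
  reals :: "string \<Rightarrow> nat \<Rightarrow> real"

fun nval :: "nexp \<Rightarrow> state \<Rightarrow> nat" where
  "nval (NConst n) s = n"
| "nval (NCell x e) s = nats s x (nval e s)"
| "nval (NPlus e1 e2) s = nval e1 s + nval e2 s"
| "nval (NMinus e1 e2) s = nval e1 s - nval e2 s"

fun rval :: "rexp \<Rightarrow> state \<Rightarrow> real" where
  "rval (RCell x e) s = reals s x (nval e s)"
| "rval (RPlus e1 e2) s = rval e1 s + rval e2 s"
| "rval (RMinus e1 e2) s = rval e1 s - rval e2 s"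

fun bval :: "bexp \<Rightarrow> state \<Rightarrow> bool" where
  "bval (NLess e1 e2) s \<longleftrightarrow> nval e1 s < nval e2 s"
| "bval (RLess e1 e2) s \<longleftrightarrow> rval e1 s < rval e2 s"
| "bval (Not b) s \<longleftrightarrow> \<not> bval b s"
| "bval (And b1 b2) s \<longleftrightarrow> bval b1 s \<and> bval b2 s"

fun nupdate :: "string \<Rightarrow> nat \<Rightarrow> nat \<Rightarrow> state \<Rightarrow> state" where
  "nupdate x p v s = s\<lparr>nats := (nats s)(x := (nats s x)(p := v))\<rparr>"

fun rupdate :: "string \<Rightarrow> nat \<Rightarrow> real \<Rightarrow> state \<Rightarrow> state" where
  "rupdate x p v s = s\<lparr>reals := (reals s)(x := (reals s x)(p := v))\<rparr>"

text \<open>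
  \<open>exec c s t s'\<close>: started in \<open>s\<close>, the program \<open>c\<close> halts in \<open>s'\<close> after \<open>t\<close> steps. Every assignment and
  every test is one step. Expressions have constant size in a fixed program, so charging for each
  operation inside them would only change the step count by a constant factor.
\<close>

inductive exec :: "com \<Rightarrow> state \<Rightarrow> nat \<Rightarrow> state \<Rightarrow> bool" where
  Skip: "exec Skip s 1 s"
| NAssign: "exec (NAssign x e1 e2) s 1 (nupdate x (nval e1 s) (nval e2 s) s)"
| RAssign: "exec (RAssign x e1 e2) s 1 (rupdate x (nval e1 s) (rval e2 s) s)"
| Seq: "exec c1 s t1 s' \<Longrightarrow> exec c2 s' t2 s'' \<Longrightarrow> exec (Seq c1 c2) s (t1 + t2) s''"
| IfTrue: "bval b s \<Longrightarrow> exec c1 s t s' \<Longrightarrow> exec (If b c1 c2) s (1 + t) s'"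
| IfFalse: "\<not> bval b s \<Longrightarrow> exec c2 s t s' \<Longrightarrow> exec (If b c1 c2) s (1 + t) s'"
| WhileFalse: "\<not> bval b s \<Longrightarrow> exec (While b c) s 1 s"
| WhileTrue: "bval b s \<Longrightarrow> exec c s t1 s' \<Longrightarrow> exec (While b c) s' t2 s'' \<Longrightarrow>
    exec (While b c) s (1 + t1 + t2) s''"

inductive_cases exec_SkipE: "exec Skip s t s'"
inductive_cases exec_NAssignE: "exec (NAssign x e1 e2) s t s'"
inductive_cases exec_RAssignE: "exec (RAssign x e1 e2) s t s'"
inductive_cases exec_SeqE: "exec (Seq c1 c2) s t s'"
inductive_cases exec_IfE: "exec (If b c1 c2) s t s'"
inductive_cases exec_WhileE: "exec (While b c) s t s'"

lemma exec_deterministic: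
  "exec c s t s' \<Longrightarrow> exec c s u s'' \<Longrightarrow> t = u \<and> s' = s''"
proof (induction arbitrary: u s'' rule: exec.induct)
  case (Skip s)
  then show ?case by (rule exec_SkipE) simp
next
  case (NAssign x e1 e2 s)
  then show ?case by (rule exec_NAssignE) simp
next
  case (RAssign x e1 e2 s)
  then show ?case by (rule exec_RAssignE) simp
next
  case (Seq c1 s t1 s1 c2 t2 s2)
  from Seq.prems obtain u1 r u2 where "u = u1 + u2" "exec c1 s u1 r" "exec c2 r u2 s''"
    by (rule exec_SeqE)
  with Seq.IH(1)[of u1 r] Seq.IH(2)[of u2 s''] show ?case by simp
next
  case (IfTrue b s c1 t s1 c2)
  from IfTrue.prems IfTrue.hyps obtain u1 where "u = 1 + u1" "exec c1 s u1 s''"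
    by (cases rule: exec.cases) simp_all
  with IfTrue.IH[of u1 s''] show ?case by simp
next
  case (IfFalse b s c2 t s1 c1)
  from IfFalse.prems IfFalse.hyps obtain u1 where "u = 1 + u1" "exec c2 s u1 s''"
    by (cases rule: exec.cases) simp_all
  with IfFalse.IH[of u1 s''] show ?case by simp
next
  case (WhileFalse b s c)
  from WhileFalse.prems WhileFalse.hyps show ?case
    by (cases rule: exec.cases) simp_all
next
  case (WhileTrue b s c t1 s1 t2 s2)
  from WhileTrue.prems WhileTrue.hyps obtain u1 r u2
    where "u = 1 + u1 + u2" "exec c s u1 r" "exec (While b c) r u2 s''"
    by (cases rule: exec.cases) simp_all
  with WhileTrue.IH(1)[of u1 r] WhileTrue.IH(2)[of u2 s''] show ?case by simp
qed


section \<open>Approximation algorithms\<close>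

text \<open>
  The input to a program has clients \<open>0, \<dots>, n - 1\<close> and facilities \<open>0, \<dots>, m - 1\<close>. The distance
  matrix is stored row by row; all cells that carry no input are 0.
\<close>

definition indexed :: "(nat, nat) ckm \<Rightarrow> bool" where
  "indexed I \<longleftrightarrow>
     clients I = {..<card (clients I)} \<and> facilities I = {..<card (facilities I)}"

definition encode :: "(nat, nat) ckm \<Rightarrow> state" where
  "encode I =
     (let n = card (clients I); m = card (facilities I) in
      \<lparr>nats = (\<lambda>_ _. 0)
         (''n'' := (\<lambda>_. 0)(0 := n),
          ''m'' := (\<lambda>_. 0)(0 := m),
          ''k'' := (\<lambda>_. 0)(0 := num_open I),
          ''u'' := (\<lambda>i. if i < m then capacity I i else 0)),
       reals = (\<lambda>_ _. 0)
         (''d'' := (\<lambda>p. if p < n * m then distance I (p div m) (p mod m) else 0))\<rparr>)"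

definition decode :: "(nat, nat) ckm \<Rightarrow> state \<Rightarrow> (nat, nat) solution" where
  "decode I s = ({i \<in> facilities I. nats s ''open'' i \<noteq> 0}, nats s ''assign'')"

definition approximation_algorithm ::
    "com \<Rightarrow> ((nat, nat) ckm \<Rightarrow> bool) \<Rightarrow> real \<Rightarrow> bool" where
  "approximation_algorithm c P \<alpha> \<longleftrightarrow>
     (\<forall>I. ckm_instance I \<and> indexed I \<and> P I \<longrightarrow>
        (\<exists>t s. exec c (encode I) t s \<and>
           ((\<exists>S. feasible I S) \<longrightarrow>
              feasible I (decode I s) \<and> cost I (decode I s) \<le> \<alpha> * opt I)))"

text \<open>
  The size parameter of an instance is its number of clients, as long as there are at most as many
  facilities. A larger number of facilities has to be accounted for, because without reading all
  capacities it is impossible to find even a feasible solution.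
\<close>

definition input_size :: "('c, 'f) ckm \<Rightarrow> nat" where
  "input_size I = max (card (clients I)) (card (facilities I))"

definition runs_in_time ::
    "com \<Rightarrow> ((nat, nat) ckm \<Rightarrow> bool) \<Rightarrow> (nat \<Rightarrow> nat) \<Rightarrow> bool" where
  "runs_in_time c P T \<longleftrightarrow>
     (\<forall>I. ckm_instance I \<and> indexed I \<and> P I \<longrightarrow>
        (\<exists>t s. exec c (encode I) t s \<and> t \<le> T (input_size I)))"

end

theory Submission
  imports Defs
begin

text \<open>
  Let \<open>\<alpha>\<close> be the smallest distance, \<open>\<beta>\<close> the other one, and call a client and a facility adjacent if
  their distance is \<open>\<alpha>\<close>. Minimising the cost means maximising the number of clients that are served
  by an adjacent facility, subject to the \<open>k\<close> open facilities having total capacity at least \<open>n\<close>.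
  Two candidates are computed, and the better one is completed to an assignment.

  If \<open>\<beta> \<le> 3\<alpha>\<close>, a greedy choice is good enough. Let \<open>l\<^sub>0 \<ge> l\<^sub>1 \<ge> \<dots>\<close> be the loads of an optimal solution
  and \<open>s = k div 4\<close>. The greedy procedure first takes the \<open>s\<close> facilities of largest capacity; then
  pick \<open>q\<close> maximises the number of newly covered clients among the facilities whose capacity is at
  least a threshold between \<open>l\<^sub>q\<close> and \<open>l\<^bsub>q-s\<^esub>\<close>. The lower bound keeps the total capacity at least \<open>n\<close>;
  the upper bound means that the facility of rank \<open>q - s\<close> was available, so that half of the load of
  the first \<open>k - s\<close> ranks is covered. The other ranks carry at most \<open>n / 4\<close> clients. A threshold can be
  constant on \<open>s + 1\<close> consecutive picks, hence three thresholds suffice: two are guessed among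
  \<open>0, \<dots>, n\<close>, the third one is the smallest that ensures the capacity. If the optimum covers \<open>f\<close>
  clients, this covers at least \<open>(4f - n) / 8\<close>, which yields the ratio 2.25. Each of the \<open>(n + 1)\<^sup>2\<close>
  guesses takes quadratic time.

  If \<open>\<beta> > 3\<alpha>\<close>, the triangle inequality makes the adjacency relation a disjoint union of bicliques.
  Assigning clients greedily to the facilities in order of decreasing capacity gives each facility a
  fixed number of clients, and choosing \<open>k\<close> facilities is an exactly solvable knapsack problem.
\<close>

section \<open>Greedy covering\<close>

locale coverage =
  fixes n m :: nat and u :: "nat \<Rightarrow> nat" and adj :: "nat \<Rightarrow> nat \<Rightarrow> bool"
begin

text \<open>\<open>att j = Suc i\<close> means that client \<open>j\<close> is covered by facility \<open>i\<close>, and \<open>att j = 0\<close> that it is uncovered.\<close>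

definition free :: "(nat \<Rightarrow> nat) \<Rightarrow> nat \<Rightarrow> nat set" where
  "free att i = {j. j < n \<and> adj j i \<and> att j = 0}"

definition load :: "(nat \<Rightarrow> nat) \<Rightarrow> nat \<Rightarrow> nat" where
  "load att i = card {j. j < n \<and> att j = Suc i}"

definition covered :: "(nat \<Rightarrow> nat) \<Rightarrow> nat" where
  "covered att = card {j. j < n \<and> att j \<noteq> 0}"

definition gain :: "(nat \<Rightarrow> nat) \<Rightarrow> nat \<Rightarrow> nat" where
  "gain att i = min (u i) (card (free att i))"

definition largest :: "nat set \<Rightarrow> nat \<Rightarrow> bool" where
  "largest A i \<longleftrightarrow> (\<forall>i'<m. i' \<notin> A \<longrightarrow> u i' \<le> u i)"

text \<open>The three clauses are the guessed thresholds \<open>t1\<close> and \<open>t2\<close> and the final threshold, which is the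
  smallest capacity that still leads to total capacity \<open>n\<close>.\<close>

definition eligible :: "nat \<Rightarrow> nat \<Rightarrow> nat \<Rightarrow> nat \<Rightarrow> nat set \<Rightarrow> nat \<Rightarrow> bool" where
  "eligible k s t1 t2 A i \<longleftrightarrow>
     (if card A < 2 * s + 1 then t1 \<le> u i
      else if card A < 3 * s + 2 then t2 \<le> u i
      else n \<le> sum u A + (k - card A) * u i)"

text \<open>The alternative \<open>largest A i\<close> guarantees a choice even when no unpicked
  facility is eligible. After the first \<open>s\<close> picks it is subject to the same comparison
  of \<open>gain\<close> with the eligible facilities.\<close>

definition admissible :: "nat \<Rightarrow> nat \<Rightarrow> nat \<Rightarrow> nat \<Rightarrow> nat set \<Rightarrow> (nat \<Rightarrow> nat) \<Rightarrow> nat \<Rightarrow> bool" where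
  "admissible k s t1 t2 A att i \<longleftrightarrow>
     i < m \<and> i \<notin> A \<and>
     (largest A i \<or> s \<le> card A \<and> eligible k s t1 t2 A i) \<and>
     (s \<le> card A \<longrightarrow> (\<forall>i'<m. i' \<notin> A \<longrightarrow> eligible k s t1 t2 A i' \<longrightarrow> gain att i' \<le> gain att i))"

text \<open>The last argument is the number of clients that the facility \<open>c\<close> picked last has yet to cover.\<close>

inductive greedy :: "nat \<Rightarrow> nat \<Rightarrow> nat \<Rightarrow> nat \<Rightarrow> nat set \<Rightarrow> (nat \<Rightarrow> nat) \<Rightarrow> nat \<Rightarrow> nat \<Rightarrow> bool"
  for k s t1 t2 where
  start: "(\<And>j. j < n \<Longrightarrow> att j = 0) \<Longrightarrow> greedy k s t1 t2 {} att c 0"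
| pick: "greedy k s t1 t2 A att c 0 \<Longrightarrow> card A < k \<Longrightarrow> admissible k s t1 t2 A att i \<Longrightarrow>
    greedy k s t1 t2 (insert i A) att i (gain att i)"
| cover: "greedy k s t1 t2 A att c r \<Longrightarrow> 0 < r \<Longrightarrow> j \<in> free att c \<Longrightarrow>
    greedy k s t1 t2 A (att(j := Suc c)) c (r - 1)"

section \<open>Invariants of the greedy process\<close>

lemma finite_free [simp]: "finite (free att i)"
  by (simp add: free_def)

lemma covered_upd: "j < n \<Longrightarrow> att j = 0 \<Longrightarrow> covered (att(j := Suc c)) = Suc (covered att)"
proof -
  assume a: "j < n" "att j = 0"
  have "{j'. j' < n \<and> (att(j := Suc c)) j' \<noteq> 0} = insert j {j'. j' < n \<and> att j' \<noteq> 0}"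
    using a by auto
  then show ?thesis using a by (simp add: covered_def)
qed

lemma load_upd: "j < n \<Longrightarrow> att j = 0 \<Longrightarrow>
  load (att(j := Suc c)) i = (if i = c then Suc (load att i) else load att i)"
proof -
  assume a: "j < n" "att j = 0"
  have "{j'. j' < n \<and> (att(j := Suc c)) j' = Suc i} =
    (if i = c then insert j {j'. j' < n \<and> att j' = Suc i} else {j'. j' < n \<and> att j' = Suc i})"
    using a by auto
  then show ?thesis using a by (simp add: load_def)
qed

lemma free_upd: "free (att(j := Suc c)) i = free att i - {j}"
  by (auto simp: free_def)

text \<open>The last clause makes \<open>cover\<close> applicable whenever \<open>r\<close> is
  positive. A fresh pick satisfies it because every covering facility lies in \<open>A\<close>, so a
  facility outside \<open>A\<close> has load zero.\<close>

lemma greedy_basic: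
  assumes "greedy k s t1 t2 A att c r"
  shows "A \<subseteq> {..<m} \<and> card A \<le> k \<and>
    (\<forall>j<n. att j \<noteq> 0 \<longrightarrow> att j - 1 \<in> A \<and> adj j (att j - 1)) \<and>
    (\<forall>i. load att i \<le> u i) \<and>
    (0 < r \<longrightarrow> c \<in> A \<and> load att c + r \<le> u c \<and> r \<le> card (free att c))"
  using assms
proof induction
  case (start att c)
  then have "{j. j < n \<and> att j = Suc i} = {}" for i by force
  then have "load att i = 0" for i by (simp add: load_def)
  then show ?case using start by simp
next
  case (pick A att c i)
  have fin: "finite A" using pick.IH finite_subset by blast
  have i: "i \<notin> A" "i < m" using pick by (auto simp: admissible_def)
  have "{j. j < n \<and> att j = Suc i} = {}" using pick.IH i by force
  then have "load att i = 0" by (simp add: load_def)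
  then show ?case using pick i fin by (auto simp: gain_def)
next
  case (cover A att c r j)
  have j: "j < n" "att j = 0" "adj j c" using cover by (auto simp: free_def)
  define att' where "att' = att(j := Suc c)"
  have "card (free att' c) = card (free att c) - 1" using cover by (simp add: att'_def free_upd)
  moreover have "load att' i = (if i = c then Suc (load att i) else load att i)" for i
    using j by (simp add: att'_def load_upd)
  moreover have "\<forall>j<n. att' j \<noteq> 0 \<longrightarrow> att' j - 1 \<in> A \<and> adj j (att' j - 1)"
    using cover j by (simp add: att'_def)
  ultimately have "A \<subseteq> {..<m} \<and> card A \<le> k \<and>
    (\<forall>j<n. att' j \<noteq> 0 \<longrightarrow> att' j - 1 \<in> A \<and> adj j (att' j - 1)) \<and>
    (\<forall>i. load att' i \<le> u i) \<and>
    (0 < r - 1 \<longrightarrow> c \<in> A \<and> load att' c + (r - 1) \<le> u c \<and> r - 1 \<le> card (free att' c))"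
    using cover.IH cover.hyps(2) by auto
  then show ?case unfolding att'_def .
qed

lemmas greedy_subset = greedy_basic[THEN conjunct1]
  and greedy_card = greedy_basic[THEN conjunct2, THEN conjunct1]

lemma greedy_finite: "greedy k s t1 t2 A att c r \<Longrightarrow> finite A"
  by (meson finite_lessThan finite_subset greedy_subset)

end

text \<open>\<open>f\<close> lists the open facilities of a solution by decreasing load
  \<open>l\<close>, and \<open>D r\<close> stands for the adjacent clients served at rank
  \<open>r\<close>. The guesses are taken to be right: with the loads of ranks \<open>s\<close> and
  \<open>2 * s + 1\<close> as thresholds, pick \<open>q\<close> of either phase has a threshold
  between the loads of ranks \<open>q\<close> and \<open>q - s\<close>.\<close>

locale ranked_solution = coverage +
  fixes k s t1 t2 :: nat and f :: "nat \<Rightarrow> nat" and l :: "nat \<Rightarrow> nat" and D :: "nat \<Rightarrow> nat set"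
  assumes f_inj: "inj_on f {..<k}" and f_range: "\<And>r. r < k \<Longrightarrow> f r < m"
    and l_le: "\<And>r. r < k \<Longrightarrow> l r \<le> u (f r)"
    and l_mono: "\<And>r r'. r \<le> r' \<Longrightarrow> r' < k \<Longrightarrow> l r' \<le> l r"
    and l_sum: "(\<Sum>r<k. l r) = n"
    and D_adj: "\<And>r j. r < k \<Longrightarrow> j \<in> D r \<Longrightarrow> j < n \<and> adj j (f r)"
    and D_card: "\<And>r. r < k \<Longrightarrow> card (D r) \<le> l r"
    and D_disj: "\<And>r r'. r < k \<Longrightarrow> r' < k \<Longrightarrow> r \<noteq> r' \<Longrightarrow> D r \<inter> D r' = {}"
    and s_ge: "k \<le> 4 * s + 3" and s_le: "4 * s \<le> k"
    and t1: "s < k \<Longrightarrow> t1 = l s" and t2: "2 * s + 1 < k \<Longrightarrow> t2 = l (2 * s + 1)"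
begin

text \<open>The final threshold is at most the load of rank \<open>3 * s + 2\<close>, so the loads of the later ranks are
  replaced by this one when lower bounds on the capacities are added up.\<close>

definition lh :: "nat \<Rightarrow> nat" where
  "lh r = l (min r (3 * s + 2))"

lemma lh_mono: "r \<le> r' \<Longrightarrow> r' < k \<Longrightarrow> lh r' \<le> lh r"
  unfolding lh_def by (rule l_mono) auto

lemma sum_lh_le: "q < k \<Longrightarrow> (\<Sum>r=q..<k. lh r) \<le> (k - q) * lh q"
  using sum_bounded_above[of "{q..<k}" lh "lh q"] lh_mono by auto

lemma exists_unpicked:
  assumes "finite A" "card A \<le> q" "q < k"
  obtains r where "r \<le> q" "f r \<notin> A"
proof -
  have "\<not> f ` {..q} \<subseteq> A"
  proof
    assume "f ` {..q} \<subseteq> A"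
    then have "card (f ` {..q}) \<le> card A" using assms card_mono by blast
    moreover have "card (f ` {..q}) = Suc q"
      using inj_on_subset[OF f_inj, of "{..q}"] assms by (simp add: card_image subset_iff)
    ultimately show False using assms by simp
  qed
  then show ?thesis using that by auto
qed

lemma sum_u_ge: "n \<le> (\<Sum>r<k. u (f r))"
  using l_sum l_le sum_mono[of "{..<k}" l "\<lambda>r. u (f r)"] by simp

text \<open>If every facility outside of \<open>A\<close> were too small to satisfy the bound, then \<open>A\<close> would contain
  the large facilities, and so \<open>A\<close> could be extended by the remaining ones of the given solution.\<close>

lemma largest_bound:
  assumes A: "finite A" "card A < k" and i: "largest A i"
    and J: "\<And>a. a \<in> A \<Longrightarrow> n \<le> sum u A + (k - card A) * u a"
  shows "n \<le> sum u A + (k - card A) * u i"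
proof (rule ccontr)
  assume neg: "\<not> ?thesis"
  let ?O = "f ` {..<k}"
  have O: "finite ?O" "card ?O = k" using f_inj by (auto simp: card_image)
  have small: "u x \<le> u i" if "x \<in> ?O - A" for x
    using i that f_range by (auto simp: largest_def)
  have big: "u i \<le> u a" if "a \<in> A" for a
  proof (rule ccontr)
    assume "\<not> u i \<le> u a"
    then have "(k - card A) * u a \<le> (k - card A) * u i" by simp
    with J[OF that] neg show False by linarith
  qed
  have cO: "card (?O - A) = k - card (?O \<inter> A)" using O by (metis card_Diff_subset_Int finite_Int)
  have cA: "card (A - ?O) = card A - card (?O \<inter> A)"
    using A by (metis card_Diff_subset_Int finite_Int inf_commute)
  have le: "card (?O \<inter> A) \<le> card A" using A by (simp add: card_mono)
  \<comment> \<open>The \<open>card (A - ?O)\<close> facilities by which \<open>?O - A\<close>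
    exceeds the open slots are paid for by the members of \<open>A - ?O\<close>, each of capacity at
    least \<open>u i\<close> by \<open>big\<close>.\<close>
  have eq: "card (?O - A) = (k - card A) + card (A - ?O)" using cO cA le A by simp
  have "n \<le> sum u ?O" using sum_u_ge f_inj by (simp add: sum.reindex)
  also have "\<dots> = sum u (?O \<inter> A) + sum u (?O - A)" using O by (simp add: sum.Int_Diff)
  also have "sum u (?O - A) \<le> card (?O - A) * u i"
    using sum_bounded_above[of "?O - A" u "u i"] small by simp
  also have "card (?O - A) * u i = (k - card A) * u i + card (A - ?O) * u i"
    by (simp add: eq algebra_simps)
  also have "card (A - ?O) * u i \<le> sum u (A - ?O)"
    using sum_bounded_below[of "A - ?O" "u i" u] big by simp
  also have "sum u (?O \<inter> A) + ((k - card A) * u i + sum u (A - ?O)) = sum u A + (k - card A) * u i"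
    using A(1) sum.Int_Diff[of A u ?O] by (simp add: Int_commute)
  finally show False using neg by simp
qed

text \<open>Two invariants support each other. A pick of capacity at least \<open>lh ?q\<close>
  preserves the first clause term by term; a pick permitted only by \<open>largest\<close> relies on
  \<open>largest_bound\<close>, whose premise is the second clause.\<close>

lemma greedy_capacity:
  assumes "greedy k s t1 t2 A att c r"
  shows "n \<le> sum u A + (\<Sum>q=card A..<k. lh q) \<and>
    (\<forall>a\<in>A. n \<le> sum u A + (k - card A) * u a)"
  using assms
proof induction
  case (start att c)
  have "n \<le> (\<Sum>r<k. lh r)"
    unfolding l_sum[symmetric] lh_def by (rule sum_mono) (auto intro: l_mono)
  then show ?case by (simp add: atLeast0LessThan)
next
  case (pick A att c i)
  let ?q = "card A"
  have fin: "finite A" using pick.hyps(1) by (rule greedy_finite)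
  have i: "i < m" "i \<notin> A" using pick.hyps by (auto simp: admissible_def)
  have sum_q: "(\<Sum>r=?q..<k. lh r) = lh ?q + (\<Sum>r=Suc ?q..<k. lh r)"
    using pick.hyps by (simp add: sum.atLeast_Suc_lessThan)
  have J: "n \<le> sum u A + (k - ?q) * u i"
    and C: "n \<le> sum u A + u i + (\<Sum>r=Suc ?q..<k. lh r)"
  proof -
    show J: "n \<le> sum u A + (k - ?q) * u i"
    proof (cases "largest A i")
      case True
      then show ?thesis using largest_bound fin pick by blast
    next
      case False
      then have e: "s \<le> ?q" "eligible k s t1 t2 A i" using pick.hyps by (auto simp: admissible_def)
      have "lh ?q \<le> u i \<or> ?thesis"
      proof -
        have "lh ?q \<le> l s" if "?q < 3 * s + 2"
          unfolding lh_def using e that pick.hyps by (intro l_mono) auto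
        moreover have "lh ?q \<le> l (2 * s + 1)" if "?q < 3 * s + 2" "2 * s + 1 \<le> ?q"
          unfolding lh_def using e that pick.hyps by (intro l_mono) auto
        moreover have "t1 = l s" using e pick.hyps t1 by simp
        moreover have "t2 = l (2 * s + 1)" if "2 * s + 1 \<le> ?q" using that pick.hyps t2 by simp
        ultimately show ?thesis using e(2) by (auto simp: eligible_def split: if_splits)
      qed
      moreover have ?thesis if "lh ?q \<le> u i"
      proof -
        have "(k - ?q) * lh ?q \<le> (k - ?q) * u i" using that by simp
        then show ?thesis using pick.IH sum_lh_le[OF pick.hyps(2)] by linarith
      qed
      ultimately show ?thesis by blast
    qed
    show "n \<le> sum u A + u i + (\<Sum>r=Suc ?q..<k. lh r)"
    proof (cases "lh ?q \<le> u i")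
      case True
      then show ?thesis using pick.IH sum_q by linarith
    next
      case False
      \<comment> \<open>Before the last phase every pick has capacity at least \<open>lh ?q\<close>.
        So a smaller pick falls where \<open>lh\<close> is constant and exceeds \<open>u i\<close>,
        while \<open>J\<close> reaches \<open>n\<close> even with \<open>u i\<close> in place of all
        later terms.\<close>
      have "3 * s + 2 \<le> ?q"
      proof (rule ccontr)
        assume q: "\<not> 3 * s + 2 \<le> ?q"
        have "lh ?q \<le> u i" if l: "largest A i"
        proof -
          obtain r where r: "r \<le> ?q" "f r \<notin> A"
            using exists_unpicked[OF fin le_refl pick.hyps(2)] by blast
          have "lh ?q \<le> l r" unfolding lh_def using r q pick.hyps by (intro l_mono) auto
          also have "\<dots> \<le> u (f r)" using l_le r pick.hyps by simp
          also have "\<dots> \<le> u i" using l r f_range pick.hyps by (simp add: largest_def)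
          finally show ?thesis .
        qed
        moreover have "lh ?q \<le> u i" if e: "s \<le> ?q" "eligible k s t1 t2 A i"
        proof -
          have "lh ?q \<le> l s" 
            unfolding lh_def using e q pick.hyps by (intro l_mono) auto
          moreover have "lh ?q \<le> l (2 * s + 1)" if "2 * s + 1 \<le> ?q"
            unfolding lh_def using e that q pick.hyps by (intro l_mono) auto
          moreover have "t1 = l s" using e pick.hyps t1 by simp
          moreover have "t2 = l (2 * s + 1)" if "2 * s + 1 \<le> ?q" using that pick.hyps t2 by simp
          ultimately show ?thesis using e(2) q by (auto simp: eligible_def split: if_splits)
        qed
        ultimately show False using False pick.hyps(3) by (auto simp: admissible_def)
      qed
      then have "lh r = lh ?q" if "r \<in> {Suc ?q..<k}" for r using that by (simp add: lh_def)
      then have "(\<Sum>r=Suc ?q..<k. lh r) = (k - Suc ?q) * lh ?q" by simp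
      moreover have "(k - Suc ?q) * u i \<le> (k - Suc ?q) * lh ?q" using False by simp
      moreover have "(k - ?q) * u i = u i + (k - Suc ?q) * u i"
        using pick.hyps by (metis Suc_diff_Suc mult_Suc)
      ultimately show ?thesis using J by linarith
    qed
  qed
  \<comment> \<open>If \<open>a\<close> is no smaller than the new pick, \<open>J\<close> suffices.
    A smaller \<open>a\<close> is an earlier pick, and replacing one \<open>u a\<close> by
    \<open>u i\<close> only improves its own bound.\<close>
  have "n \<le> sum u A + u i + (k - Suc ?q) * u a" if "a \<in> insert i A" for a
  proof (cases "u i \<le> u a")
    case True
    then have "(k - Suc ?q) * u i \<le> (k - Suc ?q) * u a" by simp
    moreover have "(k - ?q) * u i = u i + (k - Suc ?q) * u i"
      using pick.hyps by (metis Suc_diff_Suc mult_Suc)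
    ultimately show ?thesis using J by linarith
  next
    case False
    then have "n \<le> sum u A + (k - ?q) * u a" using that pick.IH by auto
    moreover have "(k - ?q) * u a = u a + (k - Suc ?q) * u a"
      using pick.hyps by (metis Suc_diff_Suc mult_Suc)
    ultimately show ?thesis using False by linarith
  qed
  then show ?case using C fin i by (simp add: add.commute[of "u i"])
next
  case (cover A att c r j)
  then show ?case by simp
qed

section \<open>Charging the picks to ranks of the given solution\<close>

definition residual :: "(nat \<Rightarrow> nat) \<Rightarrow> nat \<Rightarrow> nat" where
  "residual att r = card {j \<in> D r. att j = 0}"

lemma finite_D: "r < k \<Longrightarrow> finite (D r)"
  using D_adj by (meson bounded_nat_set_is_finite)

lemma residual_le_gain:
  assumes "r < k"
  shows "residual att r \<le> gain att (f r)"
proof -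
  have "residual att r \<le> card (free att (f r))"
    unfolding residual_def using assms D_adj by (intro card_mono) (auto simp: free_def)
  moreover have "residual att r \<le> card (D r)"
    unfolding residual_def using assms finite_D by (intro card_mono) auto
  ultimately show ?thesis using assms D_card[of r] l_le[of r] by (simp add: gain_def)
qed

text \<open>The sets \<open>D r\<close> are disjoint, so a newly covered client leaves at most one
  of the residual sets.\<close>

lemma sum_residual_upd:
  assumes "R \<subseteq> {..<k}"
  shows "(\<Sum>r\<in>R. residual att r) \<le> Suc (\<Sum>r\<in>R. residual (att(j := Suc c)) r)"
proof -
  have fin: "finite R" using assms finite_subset by blast
  have *: "residual att r \<le> residual (att(j := Suc c)) r + (if j \<in> D r then 1 else 0)" if "r \<in> R" for r
  proof -
    have eq: "{j' \<in> D r. (att(j := Suc c)) j' = 0} = {j' \<in> D r. att j' = 0} - {j}" by auto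
    have "r < k" using that assms by auto
    then have "finite {j' \<in> D r. att j' = 0}" using finite_D by simp
    then show ?thesis unfolding residual_def eq
      using card_Diff_singleton_if[of "{j' \<in> D r. att j' = 0}" j] by auto
  qed
  have "(\<Sum>r\<in>R. if j \<in> D r then 1 else 0 :: nat) = card {r \<in> R. j \<in> D r}"
    using fin by (simp add: sum.If_cases Int_def)
  also have "\<dots> \<le> 1"
  proof -
    have "x = y" if "x \<in> R" "j \<in> D x" "y \<in> R" "j \<in> D y" for x y
      using D_disj[of x y] assms that by blast
    then show ?thesis using card_le_Suc0_iff_eq[of "{r \<in> R. j \<in> D r}"] fin by simp
  qed
  finally have "(\<Sum>r\<in>R. if j \<in> D r then 1 else 0 :: nat) \<le> 1" .
  moreover have "(\<Sum>r\<in>R. residual att r) \<le>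
      (\<Sum>r\<in>R. residual (att(j := Suc c)) r + (if j \<in> D r then 1 else 0))"
    using * by (rule sum_mono)
  ultimately show ?thesis by (simp add: sum.distrib)
qed

text \<open>\<open>R\<close> consists of the facilities of the given solution to which no pick has been charged yet.\<close>

lemma greedy_potential:
  assumes "greedy k s t1 t2 A att c g"
  shows "\<exists>R\<subseteq>{..<k - s}. (\<forall>r\<in>R. f r \<notin> A) \<and> card R \<le> k - card A \<and>
    (\<Sum>r<k - s. card (D r)) \<le> 2 * covered att + g + (\<Sum>r\<in>R. residual att r)"
  using assms
proof induction
  case (start att c)
  have "residual att r = card (D r)" if "r < k - s" for r
  proof -
    have "{j \<in> D r. att j = 0} = D r" using that D_adj[of r] start by auto
    then show ?thesis by (simp add: residual_def)
  qed
  then show ?case by (intro exI[of _ "{..<k - s}"]) auto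
next
  case (pick A att c i)
  let ?q = "card A"
  have fin: "finite A" using pick.hyps(1) by (rule greedy_finite)
  have i: "i < m" "i \<notin> A" using pick.hyps by (auto simp: admissible_def)
  have cap: "n \<le> sum u A + (\<Sum>q=card A..<k. lh q)" using greedy_capacity[OF pick.hyps(1)] by blast
  obtain R where R: "R \<subseteq> {..<k - s}" "\<forall>r\<in>R. f r \<notin> A"
      "card R \<le> k - ?q"
      "(\<Sum>r<k - s. card (D r)) \<le> 2 * covered att + 0 + (\<Sum>r\<in>R. residual att r)"
    using pick.IH by blast
  have finR: "finite R" using R finite_subset by blast
  have cR: "card R \<le> k - s" using R(1) card_mono[of "{..<k - s}" R] by simp
  \<comment> \<open>\<open>r\<close> is the rank charged for this pick. Its departure from
    \<open>R\<close> loses \<open>residual att r\<close>, which the pending amount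
    \<open>gain att i\<close> created by the pick makes up for.\<close>
  have remove: ?case if r: "r \<in> R" and g: "residual att r \<le> gain att i" and "\<forall>r'\<in>R - {r}. f r' \<noteq> i" for r
  proof -
    have "(\<Sum>r\<in>R. residual att r) = residual att r + (\<Sum>r\<in>R - {r}. residual att r)"
      using finR r by (rule sum.remove)
    then show ?thesis using R that fin i finR cR pick.hyps
      by (intro exI[of _ "R - {r}"]) (auto simp: card_Diff_singleton)
  qed
  show ?case
  proof (cases "\<exists>r\<in>R. f r = i")
    case True
    then obtain r where r: "r \<in> R" "f r = i" by blast
    moreover have "r < k" using r R by auto
    moreover have "inj_on f R" using R(1) by (intro inj_on_subset[OF f_inj]) auto
    then have "\<forall>r'\<in>R - {r}. f r' \<noteq> i" using r by (auto simp: inj_on_def)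
    ultimately show ?thesis using remove residual_le_gain by blast
  next
    case False
    show ?thesis
    proof (cases "card R \<le> k - Suc ?q")
      \<comment> \<open>No charge is due. This is always so while \<open>Suc ?q \<le> s\<close>,
        since \<open>R\<close> has at most \<open>k - s\<close> elements.\<close>
      case True
      then show ?thesis using R False fin i pick.hyps by (intro exI[of _ R]) auto
    next
      case nle: False
      then have q: "s \<le> ?q" "card R = k - ?q" using R(3) cR pick.hyps by (auto split: if_splits)
      \<comment> \<open>The interval has \<open>k - ?q - 1\<close> elements and \<open>R\<close> has
        \<open>k - ?q\<close>, so \<open>R\<close> contains a rank of at most \<open>?q - s\<close>;
        its facility turns out to be eligible.\<close>
      have "\<not> R \<subseteq> {?q - s<..<k - s}"
      proof
        assume "R \<subseteq> {?q - s<..<k - s}"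
        then have "card R \<le> card {?q - s<..<k - s}" by (intro card_mono) auto
        then show False using q pick.hyps by simp
      qed
      then obtain r where r: "r \<in> R" "r \<notin> {?q - s<..<k - s}" by blast
      then have r: "r \<in> R" "r \<le> ?q - s" using R(1) by auto
      have rk: "r < k" using r pick.hyps by simp
      have "eligible k s t1 t2 A (f r)"
      proof -
        have le: "l x \<le> u (f r)" if "r \<le> x" "x < k" for x
          using l_mono[OF that] l_le[OF rk] by simp
        have "t1 \<le> u (f r)" if "?q < 2 * s + 1"
          using t1 le[of s] q r that pick.hyps by simp
        moreover have "t2 \<le> u (f r)" if "?q < 3 * s + 2" "2 * s + 1 \<le> ?q"
          using t2 le[of "2 * s + 1"] q r that pick.hyps by simp
        moreover have "n \<le> sum u A + (k - card A) * u (f r)" if "3 * s + 2 \<le> ?q"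
        proof -
          \<comment> \<open>Here \<open>s_ge\<close> enters: \<open>?q < k \<le> 4 * s + 3\<close>
            bounds the rank \<open>r \<le> ?q - s\<close> by \<open>3 * s + 2\<close>, where
            \<open>lh\<close> becomes constant.\<close>
          have "lh ?q \<le> u (f r)"
            unfolding lh_def using r that pick.hyps s_ge by (intro le) auto
          then have "(k - ?q) * lh ?q \<le> (k - ?q) * u (f r)" by simp
          then show ?thesis using cap sum_lh_le[OF pick.hyps(2)] by linarith
        qed
        ultimately show ?thesis by (auto simp: eligible_def)
      qed
      then have "gain att (f r) \<le> gain att i"
        using pick.hyps(3) q r R f_range[OF rk] by (auto simp: admissible_def)
      then have "residual att r \<le> gain att i" using residual_le_gain[OF rk] order_trans by blast
      then show ?thesis using remove r False by blast
    qed
  qed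
next
  case (cover A att c g j)
  have j: "j < n" "att j = 0" using cover by (auto simp: free_def)
  obtain R where R: "R \<subseteq> {..<k - s}" "\<forall>r\<in>R. f r \<notin> A"
      "card R \<le> k - card A"
      "(\<Sum>r<k - s. card (D r)) \<le> 2 * covered att + g + (\<Sum>r\<in>R. residual att r)"
    using cover.IH by blast
  have "R \<subseteq> {..<k}" using R(1) by auto
  \<comment> \<open>A covered client adds two to \<open>2 * covered\<close>: one replaces the unit
    taken from \<open>g\<close>, the other the client that may leave a residual set.\<close>
  from sum_residual_upd[OF this, of att j c]
  have "(\<Sum>r<k - s. card (D r)) \<le> 2 * covered (att(j := Suc c)) + (g - 1) +
      (\<Sum>r\<in>R. residual (att(j := Suc c)) r)"
    using R(4) cover.hyps(2) covered_upd[of j att c, OF j] by linarith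
  then show ?case using R by blast
qed

text \<open>After \<open>k\<close> picks \<open>R\<close> is empty, so the first
  \<open>k - s\<close> ranks have at most \<open>2 * covered att\<close> adjacent clients. The last
  \<open>s\<close> ranks carry at most a quarter of all clients, because at least
  \<open>3 * s\<close> ranks with loads no smaller precede them.\<close>

theorem greedy_covers:
  assumes "greedy k s t1 t2 A att c 0" "card A = k"
  shows "n \<le> sum u A" "4 * (\<Sum>r<k. card (D r)) \<le> 8 * covered att + n"
proof -
  show "n \<le> sum u A" using greedy_capacity[OF assms(1)] assms(2) by simp
  obtain R where R: "R \<subseteq> {..<k - s}" "card R \<le> k - card A"
     "(\<Sum>r<k - s. card (D r)) \<le> 2 * covered att + 0 + (\<Sum>r\<in>R. residual att r)"
    using greedy_potential[OF assms(1)] by blast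
  have "finite R" using R finite_subset by blast
  moreover have "card R = 0" using R assms s_le by (auto split: if_splits)
  ultimately have "R = {}" by simp
  then have B: "(\<Sum>r<k - s. card (D r)) \<le> 2 * covered att" using R by simp
  have tail: "(\<Sum>r=k-s..<k. card (D r)) \<le> (\<Sum>r=k-s..<k. l r)"
    using D_card by (intro sum_mono) auto
  have "4 * (\<Sum>r=k-s..<k. l r) \<le> n"
  proof (cases "s = 0")
    case False
    let ?x = "l (k - s)"
    have "(\<Sum>r=k-s..<k. l r) \<le> s * ?x"
      using sum_bounded_above[of "{k-s..<k}" l ?x] l_mono s_le by auto
    moreover have "(k - s) * ?x \<le> (\<Sum>r<k - s. l r)"
      using sum_bounded_below[of "{..<k-s}" ?x l] l_mono False s_le by auto
    moreover have "3 * s * ?x \<le> (k - s) * ?x" using s_le by (intro mult_right_mono) auto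
    moreover have "(\<Sum>r<k. l r) = (\<Sum>r<k - s. l r) + (\<Sum>r=k-s..<k. l r)"
      by (metis atLeast0LessThan diff_le_self le0 sum.atLeastLessThan_concat)
    ultimately show ?thesis using l_sum by linarith
  qed simp
  moreover have "(\<Sum>r<k. card (D r)) = (\<Sum>r<k - s. card (D r)) + (\<Sum>r=k-s..<k. card (D r))"
    by (metis atLeast0LessThan diff_le_self le0 sum.atLeastLessThan_concat)
  ultimately show "4 * (\<Sum>r<k. card (D r)) \<le> 8 * covered att + n" using B tail by linarith
qed

end

section \<open>Disjoint bicliques and the knapsack problem\<close>

text \<open>Every path of three edges closes up. Hence facilities with a common neighbour have the
  same neighbours, and a component containing clients can be named by its client set
  \<open>nbrs i\<close>.\<close>

locale bicliques = coverage +
  assumes biclique: "i < m \<Longrightarrow> i' < m \<Longrightarrow> j < n \<Longrightarrow> j' < n \<Longrightarrow> adj j i \<Longrightarrow> adj j i' \<Longrightarrow> adj j' i \<Longrightarrow> adj j' i'"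
begin

definition nbrs :: "nat \<Rightarrow> nat set" where
  "nbrs i = {j. j < n \<and> adj j i}"

lemma nbrs_eq: "i < m \<Longrightarrow> i' < m \<Longrightarrow> j \<in> nbrs i \<Longrightarrow> j \<in> nbrs i' \<Longrightarrow> nbrs i = nbrs i'"
  using biclique by (auto simp: nbrs_def)

definition uncovered :: "(nat \<Rightarrow> nat) \<Rightarrow> nat set \<Rightarrow> nat" where
  "uncovered att N = card {j \<in> N. att j = 0}"

lemma card_free: "card (free att i) = uncovered att (nbrs i)"
  by (simp add: free_def uncovered_def nbrs_def conj_assoc)

definition remaining :: "nat set \<Rightarrow> nat set \<Rightarrow> nat set \<Rightarrow> nat" where
  "remaining S A N = (\<Sum>i | i \<in> S - A \<and> nbrs i = N. u i)"

text \<open>How many clients of the component \<open>N\<close> the facilities of \<open>S\<close> could still cover.\<close>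

definition potential :: "nat set \<Rightarrow> nat set \<Rightarrow> (nat \<Rightarrow> nat) \<Rightarrow> nat \<Rightarrow> nat \<Rightarrow> nat set \<Rightarrow> nat" where
  "potential S A att c g N =
     min (uncovered att N) (remaining S A N + (if c \<in> S \<and> nbrs c = N then g else 0))"

text \<open>While the greedy procedure runs, the given solution \<open>S0\<close> is transformed by exchanging facilities of
  the same component for larger ones, until it consists of the first picks of each component.\<close>

lemma greedy_by_capacity:
  assumes "greedy k s t1 t2 A att c g" "m \<le> s"
    and S0: "S0 \<subseteq> {..<m}" "\<And>j. j < n \<Longrightarrow> \<sigma> j \<in> S0" "\<And>i. i \<in> S0 \<Longrightarrow> card {j. j < n \<and> \<sigma> j = i} \<le> u i"
  shows "\<exists>S\<subseteq>{..<m}. card S = card S0 \<and> sum u S0 \<le> sum u S \<and>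
    (0 < g \<longrightarrow> c \<notin> S \<longrightarrow> remaining S A (nbrs c) = 0) \<and>
    card {j. j < n \<and> adj j (\<sigma> j)} \<le>
      (\<Sum>i\<in>S \<inter> A. load att i) + (\<Sum>N\<in>nbrs ` {..<m}. potential S A att c g N)"
  using assms(1)
proof induction
  case (start att c)
  have fin: "finite S0" using S0 finite_subset by blast
  let ?T = "\<lambda>N. {j. j < n \<and> adj j (\<sigma> j) \<and> nbrs (\<sigma> j) = N}"
  have le: "card (?T N) \<le> potential S0 {} att c 0 N" for N
  proof -
    have "{j \<in> N. att j = 0} = N" if "N = nbrs i" for i using start that by (auto simp: nbrs_def)
    then have "uncovered att N = card N" if "N = nbrs i" for i using that by (simp add: uncovered_def)
    moreover have "?T N \<subseteq> N" by (auto simp: nbrs_def)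
    moreover have "finite N" if "N = nbrs i" for i using that by (simp add: nbrs_def)
    moreover have "?T N = {}" if "\<forall>i. N \<noteq> nbrs i" using that by auto
    ultimately have 1: "card (?T N) \<le> uncovered att N"
      by (metis (no_types, lifting) card.empty card_mono le0)
    have "card (?T N) \<le> card (\<Union>i\<in>{i\<in>S0. nbrs i = N}. {j. j < n \<and> \<sigma> j = i})"
      using S0 fin by (intro card_mono) auto
    also have "\<dots> \<le> (\<Sum>i\<in>{i\<in>S0. nbrs i = N}. card {j. j < n \<and> \<sigma> j = i})"
      using fin by (intro card_UN_le) auto
    also have "\<dots> \<le> remaining S0 {} N"
      unfolding remaining_def using S0 by (auto intro!: sum_mono)
    finally show ?thesis using 1 by (simp add: potential_def)
  qed
  have "card {j. j < n \<and> adj j (\<sigma> j)} \<le> card (\<Union>N\<in>nbrs ` {..<m}. ?T N)"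
    using S0 by (intro card_mono) auto
  also have "\<dots> \<le> (\<Sum>N\<in>nbrs ` {..<m}. card (?T N))" by (intro card_UN_le) auto
  also have "\<dots> \<le> (\<Sum>N\<in>nbrs ` {..<m}. potential S0 {} att c 0 N)" by (intro sum_mono le)
  finally show ?case using S0 by (intro exI[of _ S0]) auto
next
  case (pick A att c i)
  have A: "A \<subseteq> {..<m}" using pick.hyps(1) greedy_subset by blast
  have fin: "finite A" using A finite_subset by blast
  have i: "i < m" "i \<notin> A" using pick.hyps by (auto simp: admissible_def)
  have "card (insert i A) \<le> card {..<m}" using i A by (intro card_mono) auto
  \<comment> \<open>With \<open>m \<le> s\<close> the greedy process never leaves its first phase,
    so \<open>admissible\<close> holds through \<open>largest\<close>: facilities come in order of
    decreasing capacity.\<close>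
  then have "card A < s" using i fin assms(2) by simp
  then have large: "u i' \<le> u i" if "i' < m" "i' \<notin> A" for i'
    using pick.hyps that by (auto simp: admissible_def largest_def)
  have "{j. j < n \<and> att j = Suc i} = {}" using greedy_basic[OF pick.hyps(1)] i by force
  then have load_i: "load att i = 0" by (simp add: load_def)
  obtain S where S: "S \<subseteq> {..<m}" "card S = card S0" "sum u S0 \<le> sum u S"
    and ge: "card {j. j < n \<and> adj j (\<sigma> j)} \<le>
      (\<Sum>i\<in>S \<inter> A. load att i) + (\<Sum>N\<in>nbrs ` {..<m}. potential S A att c 0 N)"
    using pick.IH by blast
  have finS: "finite S" using S finite_subset by blast
  let ?N = "nbrs i"
  \<comment> \<open>If \<open>S\<close> lacks the pick \<open>i\<close> but has an unpicked facility
    of the same component, that facility is exchanged for \<open>i\<close>, which is at least as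
    large. Otherwise \<open>S\<close> stays as it is.\<close>
  obtain S' where S': "S' \<subseteq> {..<m}" "card S' = card S" "sum u S \<le> sum u S'" "S' \<inter> A = S \<inter> A"
      "\<And>N. remaining S A N \<le> remaining S' A N"
      "i \<in> S' \<or> remaining S' A ?N = 0"
  proof (cases "i \<in> S \<or> {i' \<in> S - A. nbrs i' = ?N} = {}")
    case True
    then have "i \<in> S \<or> remaining S A ?N = 0" unfolding remaining_def by (metis (no_types, lifting) sum.empty)
    then show ?thesis using that[of S] S by simp
  next
    case False
    then obtain i' where i': "i' \<in> S" "i' \<notin> A" "nbrs i' = ?N" and iS: "i \<notin> S" by auto
    have ui: "u i' \<le> u i" using large i' S by auto
    let ?S = "insert i (S - {i'})"
    have "remaining S A N \<le> remaining ?S A N" for N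
    proof (cases "N = ?N")
      case True
      have "{x \<in> S - A. nbrs x = N} = insert i' {x \<in> S - A - {i'}. nbrs x = N}" using i' True by auto
      moreover have "{x \<in> ?S - A. nbrs x = N} = insert i {x \<in> S - A - {i'}. nbrs x = N}"
        using i True by auto
      ultimately show ?thesis using ui iS finS by (simp add: remaining_def)
    next
      case False
      then have "{x \<in> S - A. nbrs x = N} = {x \<in> ?S - A. nbrs x = N}" using i' by auto
      then show ?thesis by (simp add: remaining_def)
    qed
    moreover have "card ?S = card S" using card_Suc_Diff1[OF finS i'(1)] iS finS by simp
    moreover have "sum u S \<le> sum u ?S" using i' iS finS ui by (simp add: sum.remove[of S i'])
    moreover have "?S \<subseteq> {..<m}" "?S \<inter> A = S \<inter> A" using S i i' by auto
    ultimately show ?thesis using insertI1[of i "S - {i'}"] by (intro that[of ?S]) (assumption | rule disjI1)+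
  qed
  have finS': "finite S'" using S' finite_subset by blast
  have "(\<Sum>x\<in>S' \<inter> insert i A. load att x) = (\<Sum>x\<in>S \<inter> A. load att x)"
  proof (cases "i \<in> S'")
    case True
    then have "S' \<inter> insert i A = insert i (S' \<inter> A)" by auto
    then show ?thesis using load_i S'(4) i fin by simp
  next
    case False
    then show ?thesis using S'(4) by simp
  qed
  moreover have "potential S A att c 0 N \<le> potential S' (insert i A) att i (gain att i) N" for N
  proof -
    have "potential S A att c 0 N \<le> min (uncovered att N) (remaining S' A N)"
      using S'(5)[of N] by (simp add: potential_def)
    also have "\<dots> \<le> potential S' (insert i A) att i (gain att i) N"
    proof (cases "i \<in> S' \<and> ?N = N")
      case True
      then have "{x \<in> S' - A. nbrs x = N} = insert i {x \<in> S' - insert i A. nbrs x = N}"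
        using i by auto
      then have "remaining S' A N = u i + remaining S' (insert i A) N"
        using finS' by (simp add: remaining_def)
      \<comment> \<open>With \<open>x\<close> uncovered clients,
        \<open>min x (u i + r) = min x (min (u i) x + r)\<close>: the capacity moved from
        \<open>remaining\<close> to the pending amount may be cut down to the gain.\<close>
      then show ?thesis using True by (auto simp: potential_def gain_def card_free)
    next
      case False
      then have "{x \<in> S' - A. nbrs x = N} = {x \<in> S' - insert i A. nbrs x = N}" by auto
      then show ?thesis using False by (simp add: potential_def remaining_def)
    qed
    finally show ?thesis .
  qed
  then have "(\<Sum>N\<in>nbrs ` {..<m}. potential S A att c 0 N) \<le>
      (\<Sum>N\<in>nbrs ` {..<m}. potential S' (insert i A) att i (gain att i) N)"
    by (intro sum_mono)
  moreover have "remaining S' (insert i A) ?N = 0" if "i \<notin> S'"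
  proof -
    have "S' - insert i A = S' - A" using that by auto
    then show ?thesis using S'(6) that by (simp add: remaining_def)
  qed
  ultimately show ?case using S S' ge by (intro exI[of _ S']) auto
next
  case (cover A att c g j)
  have j: "j < n" "att j = 0" "j \<in> nbrs c" using cover by (auto simp: free_def nbrs_def)
  have c: "c \<in> A" "c < m" using greedy_basic[OF cover.hyps(1)] cover.hyps(2) by auto
  obtain S where S: "S \<subseteq> {..<m}" "card S = card S0" "sum u S0 \<le> sum u S"
    "c \<notin> S \<longrightarrow> remaining S A (nbrs c) = 0"
    and ge: "card {j. j < n \<and> adj j (\<sigma> j)} \<le>
      (\<Sum>i\<in>S \<inter> A. load att i) + (\<Sum>N\<in>nbrs ` {..<m}. potential S A att c g N)"
    using cover.IH cover.hyps(2) by blast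
  have finS: "finite S" using S finite_subset by blast
  let ?att = "att(j := Suc c)" and ?e = "if c \<in> S then 1 else 0 :: nat"
  have load: "(\<Sum>i\<in>S \<inter> A. load ?att i) = (\<Sum>i\<in>S \<inter> A. load att i) + ?e"
  proof -
    have "(\<Sum>i\<in>S \<inter> A. load ?att i) = (\<Sum>i\<in>S \<inter> A. load att i + (if i = c then 1 else 0))"
      using j by (intro sum.cong) (auto simp: load_upd)
    then show ?thesis using c finS by (simp add: sum.distrib)
  qed
  have unc: "uncovered ?att N = uncovered att N - (if N = nbrs c then 1 else 0)"
    if N: "N \<in> nbrs ` {..<m}" for N
  proof -
    have "{x \<in> N. ?att x = 0} = {x \<in> N. att x = 0} - {j}" by auto
    moreover have "j \<in> N \<longleftrightarrow> N = nbrs c" using nbrs_eq N j(3) c by auto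
    ultimately show ?thesis using j by (auto simp: uncovered_def)
  qed
  \<comment> \<open>For \<open>c\<close> in \<open>S\<close> the potential of its component drops by
    at most one, which the load of \<open>c\<close> gains. For \<open>c\<close> outside
    \<open>S\<close> that potential is already zero, because nothing of \<open>S\<close> remains in
    the component.\<close>
  have "potential S A att c g N \<le> potential S A ?att c (g - 1) N + (if N = nbrs c then ?e else 0)"
    if N: "N \<in> nbrs ` {..<m}" for N
    using unc[OF N] S(4) cover.hyps(2) by (auto simp: potential_def)
  then have "(\<Sum>N\<in>nbrs ` {..<m}. potential S A att c g N) \<le>
      (\<Sum>N\<in>nbrs ` {..<m}. potential S A ?att c (g - 1) N + (if N = nbrs c then ?e else 0))"
    by (rule sum_mono)
  also have "\<dots> = (\<Sum>N\<in>nbrs ` {..<m}. potential S A ?att c (g - 1) N) + ?e"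
    using c by (simp add: sum.distrib)
  finally have "card {j. j < n \<and> adj j (\<sigma> j)} \<le> (\<Sum>i\<in>S \<inter> A. load ?att i) +
      (\<Sum>N\<in>nbrs ` {..<m}. potential S A ?att c (g - 1) N)"
    using ge load by linarith
  then show ?case using S by blast
qed

end

text \<open>One plus the largest capacity of \<open>q\<close> of the first \<open>i\<close> items with total weight \<open>W\<close>, and 0 if there
  are no such items.\<close>

fun knapsack :: "(nat \<Rightarrow> nat) \<Rightarrow> (nat \<Rightarrow> nat) \<Rightarrow> nat \<Rightarrow> nat \<Rightarrow> nat \<Rightarrow> nat" where
  "knapsack u w 0 q W = (if q = 0 \<and> W = 0 then 1 else 0)"
| "knapsack u w (Suc i) q W = max (knapsack u w i q W)
     (if 0 < q \<and> w i \<le> W \<and> 0 < knapsack u w i (q - 1) (W - w i)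
      then knapsack u w i (q - 1) (W - w i) + u i else 0)"

lemma knapsack_ge: "S \<subseteq> {..<i} \<Longrightarrow> Suc (sum u S) \<le> knapsack u w i (card S) (sum w S)"
proof (induction i arbitrary: S)
  case (Suc i)
  have fin: "finite S" using Suc.prems finite_subset by blast
  show ?case
  proof (cases "i \<in> S")
    case True
    have "Suc (sum u (S - {i})) \<le> knapsack u w i (card (S - {i})) (sum w (S - {i}))"
      using Suc.prems by (intro Suc.IH) (auto simp: less_Suc_eq)
    moreover have "sum u S = u i + sum u (S - {i})" "sum w S = w i + sum w (S - {i})"
      using True fin by (simp_all add: sum.remove)
    moreover have "0 < card S" using True fin card_gt_0_iff by blast
    ultimately show ?thesis using True fin by (simp add: card_Diff_singleton)
  next
    case False
    then have "S \<subseteq> {..<i}" using Suc.prems less_Suc_eq by auto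
    from Suc.IH[OF this] show ?thesis by simp
  qed
qed simp

section \<open>Weakest preconditions with step counts\<close>

notation Seq (infixr ";;" 60)

text \<open>Valid if no loop makes more than \<open>N\<close> iterations.\<close>

fun time_bound :: "nat \<Rightarrow> com \<Rightarrow> nat" where
  "time_bound N Skip = 1"
| "time_bound N (NAssign x e1 e2) = 1"
| "time_bound N (RAssign x e1 e2) = 1"
| "time_bound N (c1 ;; c2) = time_bound N c1 + time_bound N c2"
| "time_bound N (If b c1 c2) = 1 + (time_bound N c1 + time_bound N c2)"
| "time_bound N (While b c) = 1 + N * (1 + time_bound N c)"

fun loop_depth :: "com \<Rightarrow> nat" where
  "loop_depth Skip = 0"
| "loop_depth (NAssign x e1 e2) = 0"
| "loop_depth (RAssign x e1 e2) = 0"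
| "loop_depth (c1 ;; c2) = max (loop_depth c1) (loop_depth c2)"
| "loop_depth (If b c1 c2) = max (loop_depth c1) (loop_depth c2)"
| "loop_depth (While b c) = Suc (loop_depth c)"

text \<open>A coefficient for \<open>N ^ loop_depth c\<close>. A loop contributes one for its final
  test and one for the tests before its iterations.\<close>

fun com_size :: "com \<Rightarrow> nat" where
  "com_size (c1 ;; c2) = com_size c1 + com_size c2"
| "com_size (If b c1 c2) = 1 + (com_size c1 + com_size c2)"
| "com_size (While b c) = 2 + com_size c"
| "com_size _ = 1"

lemma time_bound_le: "1 \<le> N \<Longrightarrow> time_bound N c \<le> com_size c * N ^ loop_depth c"
proof (induction c)
  case (Seq c1 c2)
  have "com_size c1 * N ^ loop_depth c1 \<le> com_size c1 * N ^ loop_depth (c1 ;; c2)"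
    "com_size c2 * N ^ loop_depth c2 \<le> com_size c2 * N ^ loop_depth (c1 ;; c2)"
    using Seq.prems by (auto intro!: power_increasing mult_left_mono)
  with Seq have "time_bound N c1 \<le> com_size c1 * N ^ loop_depth (c1 ;; c2)"
    "time_bound N c2 \<le> com_size c2 * N ^ loop_depth (c1 ;; c2)" by (meson order_trans)+
  then show ?case by (simp add: add_mult_distrib)
next
  case (If b c1 c2)
  have "com_size c1 * N ^ loop_depth c1 \<le> com_size c1 * N ^ loop_depth (If b c1 c2)"
    "com_size c2 * N ^ loop_depth c2 \<le> com_size c2 * N ^ loop_depth (If b c1 c2)"
    "1 \<le> N ^ loop_depth (If b c1 c2)"
    using If.prems by (auto intro!: power_increasing mult_left_mono)
  with If have "time_bound N c1 \<le> com_size c1 * N ^ loop_depth (If b c1 c2)"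
    "time_bound N c2 \<le> com_size c2 * N ^ loop_depth (If b c1 c2)"
    "1 \<le> N ^ loop_depth (If b c1 c2)" by (meson order_trans)+
  then show ?case by (simp add: add_mult_distrib)
next
  case (While b c)
  have "N * (1 + time_bound N c) \<le> N * (N ^ loop_depth c + com_size c * N ^ loop_depth c)"
    using While by (intro mult_left_mono add_mono) auto
  moreover have "1 \<le> N ^ Suc (loop_depth c)" using While.prems by (intro one_le_power)
  then have "1 \<le> N * N ^ loop_depth c" by simp
  ultimately have "1 + N * (1 + time_bound N c) \<le>
      N * N ^ loop_depth c + N * (N ^ loop_depth c + com_size c * N ^ loop_depth c)"
    by (rule add_mono[rotated])
  then show ?case by (simp add: algebra_simps)
qed auto

text \<open>Only arrays of natural numbers are recorded. Reals are assigned in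
  \<open>prepare\<close> alone, whose invariants mention them explicitly.\<close>

fun writes :: "com \<Rightarrow> string set" where
  "writes Skip = {}"
| "writes (NAssign x e1 e2) = {x}"
| "writes (RAssign x e1 e2) = {}"
| "writes (c1 ;; c2) = writes c1 \<union> writes c2"
| "writes (If b c1 c2) = writes c1 \<union> writes c2"
| "writes (While b c) = writes c"

definition same_outside :: "string set \<Rightarrow> state \<Rightarrow> state \<Rightarrow> bool" where
  "same_outside X s s' \<longleftrightarrow> (\<forall>x. x \<notin> X \<longrightarrow> nats s' x = nats s x)"

lemma same_outsideD: "same_outside X s s' \<Longrightarrow> x \<notin> X \<Longrightarrow> nats s' x = nats s x"
  by (simp add: same_outside_def)

declare nupdate.simps [simp del] rupdate.simps [simp del]

lemma select_nupdate [simp]: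
  "nats (nupdate x p v s) = (nats s)(x := (nats s x)(p := v))" "reals (nupdate x p v s) = reals s"
  by (simp_all add: nupdate.simps)

lemma select_rupdate [simp]:
  "nats (rupdate x p v s) = nats s" "reals (rupdate x p v s) = (reals s)(x := (reals s x)(p := v))"
  by (simp_all add: rupdate.simps)

lemma exec_frame: "exec c s t s' \<Longrightarrow> same_outside (writes c) s s'"
  by (induction rule: exec.induct) (auto simp: same_outside_def)

text \<open>The step bound depends on the program text and \<open>N\<close> only, so time needs no
  counting in invariants: it is enough that each loop respects the bound \<open>N\<close>.\<close>

definition wp :: "nat \<Rightarrow> com \<Rightarrow> (state \<Rightarrow> bool) \<Rightarrow> state \<Rightarrow> bool" where
  "wp N c Q s \<longleftrightarrow> (\<exists>t s'. exec c s t s' \<and> t \<le> time_bound N c \<and> Q s')"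

lemma wp_conseq:
  "wp N c Q s \<Longrightarrow> (\<And>s'. Q s' \<Longrightarrow> same_outside (writes c) s s' \<Longrightarrow> Q' s') \<Longrightarrow> wp N c Q' s"
  unfolding wp_def using exec_frame by blast

section \<open>Proof rules for the commands\<close>

lemma wp_Skip: "Q s \<Longrightarrow> wp N Skip Q s"
  unfolding wp_def by (force intro: exec.intros)

lemma wp_NAssign: "Q (nupdate x (nval e1 s) (nval e2 s) s) \<Longrightarrow> wp N (NAssign x e1 e2) Q s"
  unfolding wp_def by (force intro: exec.intros)

lemma wp_RAssign: "Q (rupdate x (nval e1 s) (rval e2 s) s) \<Longrightarrow> wp N (RAssign x e1 e2) Q s"
  unfolding wp_def by (force intro: exec.intros)

lemma wp_Seq: "wp N c1 (wp N c2 Q) s \<Longrightarrow> wp N (c1 ;; c2) Q s"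
  unfolding wp_def by (fastforce intro: exec.intros add_mono)

lemma wp_If:
  assumes "bval b s \<Longrightarrow> wp N c1 Q s" "\<not> bval b s \<Longrightarrow> wp N c2 Q s"
  shows "wp N (If b c1 c2) Q s"
proof (cases "bval b s")
  case True
  then obtain t s' where "exec c1 s t s'" "t \<le> time_bound N c1" "Q s'" using assms wp_def by auto
  then show ?thesis unfolding wp_def using True
    by (intro exI[of _ "1 + t"] exI[of _ s']) (auto intro: exec.IfTrue[simplified])
next
  case False
  then obtain t s' where "exec c2 s t s'" "t \<le> time_bound N c2" "Q s'" using assms wp_def by auto
  then show ?thesis unfolding wp_def using False
    by (intro exI[of _ "1 + t"] exI[of _ s']) (auto intro: exec.IfFalse[simplified])
qed

abbreviation V :: "string \<Rightarrow> nexp" where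
  "V x \<equiv> NCell x (NConst 0)"

abbreviation assign_scalar :: "string \<Rightarrow> nexp \<Rightarrow> com" (infix "::=" 61) where
  "x ::= e \<equiv> NAssign x (NConst 0) e"

definition For :: "string \<Rightarrow> nexp \<Rightarrow> com \<Rightarrow> com" where
  "For x e c = (NAssign x (NConst 0) (NConst 0) ;;
     While (NLess (NCell x (NConst 0)) e)
       (c ;; NAssign x (NConst 0) (NPlus (NCell x (NConst 0)) (NConst 1))))"

lemma writes_For [simp]: "writes (For x e c) = insert x (writes c)"
  by (auto simp: For_def)

lemma loop_depth_For [simp]: "loop_depth (For x e c) = Suc (loop_depth c)"
  by (simp add: For_def)

text \<open>The increment follows the body, so the body has to establish the invariant for the state
  with the new counter. As the body leaves \<open>x\<close> alone, there are
  \<open>b \<le> N\<close> iterations, no more than \<open>time_bound\<close> charges. Frame facts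
  relative to \<open>s0\<close> are supplied to every premise about later states.\<close>

lemma wp_For:
  assumes init: "I 0 (nupdate x 0 0 s0)" and x: "x \<notin> writes c" and b: "b \<le> N"
    and bound: "\<And>i s. I i s \<Longrightarrow> same_outside (insert x (writes c)) s0 s \<Longrightarrow> nval e s = b"
    and step: "\<And>i s. i < b \<Longrightarrow> I i s \<Longrightarrow> nats s x 0 = i \<Longrightarrow>
      same_outside (insert x (writes c)) s0 s \<Longrightarrow>
      wp N c (\<lambda>s'. I (Suc i) (nupdate x 0 (Suc i) s')) s"
    and post: "\<And>s. I b s \<Longrightarrow> same_outside (insert x (writes c)) s0 s \<Longrightarrow> Q s"
  shows "wp N (For x e c) Q s0"
proof -
  let ?W = "insert x (writes c)"
  let ?body = "c ;; NAssign x (NConst 0) (NPlus (NCell x (NConst 0)) (NConst 1))"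
  let ?b = "NLess (NCell x (NConst 0)) e"
  \<comment> \<open>The induction is on the remaining iterations \<open>b - i\<close> and keeps the
    exact bound; it is weakened from \<open>b\<close> to \<open>N\<close> only at the end.\<close>
  have loop: "\<exists>t s'. exec (While ?b ?body) s t s' \<and> t \<le> 1 + (b - i) * (1 + time_bound N ?body) \<and> Q s'"
    if "i \<le> b" "I i s" "nats s x 0 = i" "same_outside ?W s0 s" for i s
    using that
  proof (induction "b - i" arbitrary: i s)
    case 0
    have "\<not> bval ?b s" using 0 bound[of i s] by simp
    from exec.WhileFalse[OF this] have "exec (While ?b ?body) s 1 s" .
    moreover have "i = b" using 0 by simp
    then have "Q s" using post 0 by blast
    ultimately show ?case by (intro exI[of _ 1] exI[of _ s]) (simp del: time_bound.simps)
  next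
    case (Suc d)
    have t: "bval ?b s" using Suc bound[of i s] by simp
    have "i < b" using Suc by simp
    from step[OF this Suc.prems(2-4)] obtain t1 s1 where
      s1: "exec c s t1 s1" "t1 \<le> time_bound N c" "I (Suc i) (nupdate x 0 (Suc i) s1)"
      by (auto simp: wp_def)
    have fr: "same_outside (writes c) s s1" using s1 exec_frame by blast
    have x1: "nats s1 x 0 = i" using fr x Suc.prems by (simp add: same_outside_def)
    let ?s = "nupdate x 0 (Suc i) s1"
    have e: "exec ?body s (t1 + 1) ?s"
      using exec.Seq[OF s1(1) exec.NAssign[of x "NConst 0" "NPlus (NCell x (NConst 0)) (NConst 1)" s1]] x1
      by simp
    have "same_outside ?W s0 ?s" using fr Suc.prems(4) by (simp add: same_outside_def)
    moreover have "d = b - Suc i" "Suc i \<le> b" "nats ?s x 0 = Suc i" using Suc.hyps(2) by auto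
    ultimately obtain t2 s2 where
      s2: "exec (While ?b ?body) ?s t2 s2" "t2 \<le> 1 + (b - Suc i) * (1 + time_bound N ?body)" "Q s2"
      using Suc.hyps(1)[of "Suc i" ?s] s1(3) by blast
    have "1 + (t1 + 1) + t2 \<le> 1 + (b - i) * (1 + time_bound N ?body)"
    proof -
      have "b - i = Suc (b - Suc i)" using \<open>i < b\<close> by simp
      then have "(b - i) * (1 + time_bound N ?body) =
        1 + time_bound N ?body + (b - Suc i) * (1 + time_bound N ?body)" by simp
      moreover have "time_bound N ?body = time_bound N c + 1" by simp
      ultimately show ?thesis using s1(2) s2(2) by linarith
    qed
    then show ?case using exec.WhileTrue[OF t e s2(1)] s2(3) by blast
  qed
  have "same_outside ?W s0 (nupdate x 0 0 s0)" by (simp add: same_outside_def)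
  from loop[OF _ init _ this] obtain t s' where
    s': "exec (While ?b ?body) (nupdate x 0 0 s0) t s'" "t \<le> 1 + b * (1 + time_bound N ?body)" "Q s'"
    by auto
  have "b * (1 + time_bound N ?body) \<le> N * (1 + time_bound N ?body)" using b by (intro mult_right_mono) auto
  moreover have "exec (x ::= NConst 0) s0 1 (nupdate x 0 0 s0)"
    using exec.NAssign[of x "NConst 0" "NConst 0" s0] by simp
  from exec.Seq[OF this s'(1)] have "exec (For x e c) s0 (1 + t) s'" unfolding For_def .
  ultimately show ?thesis unfolding wp_def using s'
    by (intro exI[of _ "1 + t"] exI[of _ s']) (auto simp: For_def)
qed

lemma wp_For_same:
  assumes "I 0 (nupdate x 0 0 s0)" and "x \<notin> writes c" and "b \<le> N"
    and "\<And>s. same_outside (insert x (writes c)) s0 s \<Longrightarrow> nval e s = b"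
    and "\<And>i s. i < b \<Longrightarrow> I i s \<Longrightarrow> nats s x 0 = i \<Longrightarrow>
      same_outside (insert x (writes c)) s0 s \<Longrightarrow>
      wp N c (\<lambda>s'. I (Suc i) (nupdate x 0 (Suc i) s')) s"
    and "\<And>s. I b s \<Longrightarrow> same_outside (insert x (writes c)) s0 s \<Longrightarrow> Q s"
  shows "wp N (For x e c) Q s0"
  using assms by (intro wp_For[where I = I and b = b]) auto

notation NCell (infix "$$" 100) and NPlus (infixl "[+]" 65) and NMinus (infixl "[-]" 65)
  and NLess (infix "[<]" 50) and And (infixr "[&]" 35)

section \<open>The program\<close>

text \<open>The machine cannot multiply, so \<open>''p''\<close> walks through the matrix row by row
  and \<open>''row''\<close> records the offsets \<open>j * m\<close> for later access.\<close>

definition prepare :: com where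
  "prepare =
    (RAssign ''min'' (NConst 0) (RCell ''d'' (NConst 0)) ;;
     ''p'' ::= NConst 0 ;;
     For ''j'' (V ''n'') (For ''i'' (V ''m'')
       (If (RLess (RCell ''d'' (V ''p'')) (RCell ''min'' (NConst 0)))
          (RAssign ''min'' (NConst 0) (RCell ''d'' (V ''p''))) Skip ;;
        ''p'' ::= V ''p'' [+] NConst 1)) ;;
     ''p'' ::= NConst 0 ;;
     For ''j'' (V ''n'')
       (NAssign ''row'' (V ''j'') (V ''p'') ;;
        For ''i'' (V ''m'')
         (If (RLess (RCell ''min'' (NConst 0)) (RCell ''d'' (V ''p'')))
            (NAssign ''adj'' (V ''p'') (NConst 0)) (NAssign ''adj'' (V ''p'') (NConst 1)) ;;
          ''p'' ::= V ''p'' [+] NConst 1)))"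

section \<open>Code of a single greedy run\<close>

definition reset :: com where
  "reset =
    (For ''i'' (V ''m'')
       (NAssign ''cnt'' (V ''i'') (NConst 0) ;; NAssign ''sel'' (V ''i'') (NConst 0)) ;;
     For ''j'' (V ''n'')
       (NAssign ''att'' (V ''j'') (NConst 0) ;;
        For ''i'' (V ''m'')
          (NAssign ''cnt'' (V ''i'') (''cnt'' $$ V ''i'' [+] ''adj'' $$ (''row'' $$ V ''j'' [+] V ''i'')))) ;;
     ''q'' ::= NConst 0 ;; ''U'' ::= NConst 0 ;; ''Y'' ::= NConst 0 ;; ''rem'' ::= NConst 0)"

text \<open>Correcting \<open>''cnt''\<close> after each covered client costs one pass over the
  facilities and makes every gain available in constant time.\<close>

definition cover_step :: com where
  "cover_step =
    (For ''j'' (V ''n'')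
       (If (Not (NConst 0 [<] ''att'' $$ V ''j'') [&]
            NConst 0 [<] ''adj'' $$ (''row'' $$ V ''j'' [+] V ''cur''))
          (''h'' ::= V ''j'') Skip) ;;
     NAssign ''att'' (V ''h'') (V ''cur'' [+] NConst 1) ;;
     ''rem'' ::= V ''rem'' [-] NConst 1 ;;
     ''Y'' ::= V ''Y'' [+] NConst 1 ;;
     For ''i'' (V ''m'')
       (NAssign ''cnt'' (V ''i'') (''cnt'' $$ V ''i'' [-] ''adj'' $$ (''row'' $$ V ''h'' [+] V ''i''))))"

text \<open>The last branch finds the least \<open>T\<close> with
  \<open>U + T * (kk - q) \<ge> n\<close> by repeated addition; since \<open>kk - q\<close> is
  positive, \<open>n\<close> rounds suffice.\<close>

definition threshold :: com where
  "threshold =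
     If (V ''q'' [<] V ''s'' [+] V ''s'' [+] NConst 1) (''T'' ::= V ''t1'')
      (If (V ''q'' [<] V ''s'' [+] V ''s'' [+] V ''s'' [+] NConst 2) (''T'' ::= V ''t2'')
        (''T'' ::= NConst 0 ;; ''acc'' ::= V ''U'' ;;
         For ''v'' (V ''n'')
           (If (V ''acc'' [<] V ''n'')
              (''acc'' ::= V ''acc'' [+] (V ''kk'' [-] V ''q'') ;; ''T'' ::= V ''T'' [+] NConst 1) Skip)))"

text \<open>\<open>''key''\<close> is a capacity plus one, so that 0 means that nothing has been
  found yet.\<close>

definition find_largest :: com where
  "find_largest =
    (''key'' ::= NConst 0 ;;
     For ''i'' (V ''m'')
       (If (Not (NConst 0 [<] ''sel'' $$ V ''i'') [&] V ''key'' [<] ''u'' $$ V ''i'' [+] NConst 1)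
          (''h'' ::= V ''i'' ;; ''key'' ::= ''u'' $$ V ''i'' [+] NConst 1) Skip))"

text \<open>\<open>''h''\<close> still holds the result of \<open>find_largest\<close>. It survives
  if no eligible facility has positive gain, which is the fallback in
  \<open>admissible\<close>.\<close>

definition find_best :: com where
  "find_best =
    (''key'' ::= NConst 0 ;;
     For ''i'' (V ''m'')
       (If (Not (NConst 0 [<] ''sel'' $$ V ''i'') [&] Not (''u'' $$ V ''i'' [<] V ''T'') [&]
            V ''key'' [<] ''cnt'' $$ V ''i'' [&] V ''key'' [<] ''u'' $$ V ''i'')
          (''h'' ::= V ''i'' ;;
           If (''cnt'' $$ V ''i'' [<] ''u'' $$ V ''i'')
             (''key'' ::= ''cnt'' $$ V ''i'') (''key'' ::= ''u'' $$ V ''i'')) Skip))"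

definition pick_step :: com where
  "pick_step =
    (find_largest ;;
     If (V ''q'' [<] V ''s'') Skip (threshold ;; find_best) ;;
     NAssign ''sel'' (V ''h'') (NConst 1) ;;
     ''U'' ::= V ''U'' [+] ''u'' $$ V ''h'' ;;
     If (''cnt'' $$ V ''h'' [<] ''u'' $$ V ''h'')
       (''rem'' ::= ''cnt'' $$ V ''h'') (''rem'' ::= ''u'' $$ V ''h'') ;;
     ''cur'' ::= V ''h'' ;;
     ''q'' ::= V ''q'' [+] NConst 1)"

text \<open>One iteration covers a client or picks a facility; interleaving both in a single loop keeps
  each iteration linear, without amortisation.\<close>

definition greedy_run :: com where
  "greedy_run =
    (reset ;;
     For ''e'' (V ''n'' [+] V ''kk'')
       (If (NConst 0 [<] V ''rem'') cover_step (If (V ''q'' [<] V ''kk'') pick_step Skip)))"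

definition keep :: com where
  "keep =
    (''by'' ::= V ''Y'' [+] NConst 1 ;;
     For ''i'' (V ''m'') (NAssign ''open'' (V ''i'') (''sel'' $$ V ''i'')) ;;
     For ''j'' (V ''n'') (NAssign ''batt'' (V ''j'') (''att'' $$ V ''j'')))"

text \<open>A replacement for division: \<open>''s''\<close> goes up whenever the counter completes
  another multiple of four.\<close>

definition quarter :: com where
  "quarter =
    (''s'' ::= NConst 0 ;;
     For ''i'' (V ''k'')
       (If (V ''i'' [+] NConst 1 [<] V ''s'' [+] V ''s'' [+] V ''s'' [+] V ''s'' [+] NConst 4)
          Skip (''s'' ::= V ''s'' [+] NConst 1)))"

definition threshold_search :: com where
  "threshold_search =
    (''by'' ::= NConst 0 ;; ''kk'' ::= V ''k'' ;; quarter ;;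
     For ''t1'' (V ''n'' [+] NConst 1) (For ''t2'' (V ''n'' [+] NConst 1)
       (greedy_run ;;
        If (Not (V ''U'' [<] V ''n'') [&] V ''by'' [<] V ''Y'' [+] NConst 1) keep Skip)))"

section \<open>Code of the knapsack dynamic program\<close>

definition loads :: com where
  "loads =
    (For ''i'' (V ''m'') (NAssign ''w'' (V ''i'') (NConst 0)) ;;
     For ''j'' (V ''n'')
       (If (NConst 0 [<] ''att'' $$ V ''j'')
          (NAssign ''w'' (''att'' $$ V ''j'' [-] NConst 1)
            (''w'' $$ (''att'' $$ V ''j'' [-] NConst 1) [+] NConst 1)) Skip))"

text \<open>Layers for successive items follow one another, so a running pointer replaces index
  arithmetic: the same cell one layer earlier is \<open>''st''\<close> back, and the predecessor
  that uses the item is a row and its weight further back. \<open>''x''\<close> may be meaningless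
  if \<open>''b''\<close> is 0 or the item is too heavy; the test then ignores it.\<close>

definition fill_table :: com where
  "fill_table =
    (''st'' ::= NConst 0 ;;
     For ''b'' (V ''k'' [+] NConst 1) (''st'' ::= V ''st'' [+] (V ''n'' [+] NConst 1)) ;;
     ''p'' ::= NConst 0 ;;
     For ''b'' (V ''k'' [+] NConst 1) (For ''W'' (V ''n'' [+] NConst 1)
       (NAssign ''E'' (V ''p'') (NConst 0) ;; ''p'' ::= V ''p'' [+] NConst 1)) ;;
     NAssign ''E'' (NConst 0) (NConst 1) ;;
     For ''i'' (V ''m'') (For ''b'' (V ''k'' [+] NConst 1) (For ''W'' (V ''n'' [+] NConst 1)
       (''x'' ::= ''E'' $$ (V ''p'' [-] (V ''st'' [+] (V ''n'' [+] NConst 1) [+] ''w'' $$ V ''i'')) ;;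
        NAssign ''E'' (V ''p'') (''E'' $$ (V ''p'' [-] V ''st'')) ;;
        If (NConst 0 [<] V ''b'' [&] Not (V ''W'' [<] ''w'' $$ V ''i'') [&] NConst 0 [<] V ''x'' [&]
            ''E'' $$ V ''p'' [<] V ''x'' [+] ''u'' $$ V ''i'')
          (NAssign ''E'' (V ''p'') (V ''x'' [+] ''u'' $$ V ''i'')) Skip ;;
        ''p'' ::= V ''p'' [+] NConst 1))))"

text \<open>\<open>''p''\<close> has arrived one past the table, so going back \<open>n + 1\<close>
  cells leads to the row for \<open>k\<close> chosen items in the last layer. Entries are one plus a
  capacity, hence the strict comparison with \<open>n\<close>; \<open>''bw''\<close> is one plus the
  largest suitable weight.\<close>

definition best_value :: com where
  "best_value =
    (''p'' ::= V ''p'' [-] (V ''n'' [+] NConst 1) ;; ''bw'' ::= NConst 0 ;;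
     For ''W'' (V ''n'' [+] NConst 1)
       (If (V ''n'' [<] ''E'' $$ (V ''p'' [+] V ''W'')) (''bw'' ::= V ''W'' [+] NConst 1) Skip))"

text \<open>Going back through the layers, an item is taken exactly if it strictly improved the
  entry; the entry then stems from the predecessor with one item less.\<close>

definition reconstruct :: com where
  "reconstruct =
    (''by'' ::= V ''bw'' ;; ''p'' ::= V ''p'' [+] (V ''bw'' [-] NConst 1) ;;
     For ''r'' (V ''m'')
       (''i'' ::= V ''m'' [-] (V ''r'' [+] NConst 1) ;;
        If (''E'' $$ (V ''p'' [-] V ''st'') [<] ''E'' $$ V ''p'')
          (NAssign ''open'' (V ''i'') (NConst 1) ;;
           ''p'' ::= V ''p'' [-] (V ''st'' [+] (V ''n'' [+] NConst 1) [+] ''w'' $$ V ''i''))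
          (NAssign ''open'' (V ''i'') (NConst 0) ;;
           ''p'' ::= V ''p'' [-] V ''st'')) ;;
     For ''j'' (V ''n'') (NAssign ''batt'' (V ''j'') (''att'' $$ V ''j'')))"

text \<open>With \<open>''s''\<close> and \<open>''kk''\<close> both equal to \<open>m\<close>, the
  greedy run opens all facilities by decreasing capacity. Their loads are the knapsack
  weights.\<close>

definition knapsack_search :: com where
  "knapsack_search =
    (''s'' ::= V ''m'' ;; ''kk'' ::= V ''m'' ;; greedy_run ;; loads ;; fill_table ;; best_value ;;
     If (V ''by'' [<] V ''bw'') reconstruct Skip)"

definition finish :: com where
  "finish =
    (For ''i'' (V ''m'') (NAssign ''ld'' (V ''i'') (NConst 0)) ;;
     For ''j'' (V ''n'')
       (NAssign ''done'' (V ''j'') (NConst 0) ;;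
        If (NConst 0 [<] ''batt'' $$ V ''j'' [&] NConst 0 [<] ''open'' $$ (''batt'' $$ V ''j'' [-] NConst 1))
          (''h'' ::= ''batt'' $$ V ''j'' [-] NConst 1 ;;
           NAssign ''assign'' (V ''j'') (V ''h'') ;;
           NAssign ''ld'' (V ''h'') (''ld'' $$ V ''h'' [+] NConst 1) ;;
           NAssign ''done'' (V ''j'') (NConst 1)) Skip) ;;
     For ''j'' (V ''n'')
       (If (NConst 0 [<] ''done'' $$ V ''j'') Skip
         (For ''i'' (V ''m'')
            (If (NConst 0 [<] ''open'' $$ V ''i'' [&] ''ld'' $$ V ''i'' [<] ''u'' $$ V ''i'')
               (''h'' ::= V ''i'') Skip) ;;
          NAssign ''assign'' (V ''j'') (V ''h'') ;;
          NAssign ''ld'' (V ''h'') (''ld'' $$ V ''h'' [+] NConst 1))))"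

text \<open>If \<open>m < k\<close>, there is no feasible solution. If \<open>''by''\<close> is
  still 0 at the end, neither search found \<open>k\<close> facilities of total capacity at least
  \<open>n\<close>.\<close>

definition main_program :: com where
  "main_program =
     If (V ''m'' [<] V ''k'') Skip
      (prepare ;; threshold_search ;; knapsack_search ;; If (NConst 0 [<] V ''by'') finish Skip)"

lemma loop_depth_main_program: "loop_depth main_program = 4"
  by (simp add: main_program_def prepare_def threshold_search_def knapsack_search_def finish_def
      greedy_run_def keep_def quarter_def reset_def cover_step_def pick_step_def threshold_def
      find_largest_def find_best_def loads_def fill_table_def best_value_def reconstruct_def)

section \<open>Correctness of the greedy run\<close>

lemma writes_simps [simp]:
  "writes reset = {''i'', ''cnt'', ''sel'', ''j'', ''att'', ''q'', ''U'', ''Y'', ''rem''}"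
  "writes cover_step = {''j'', ''h'', ''att'', ''rem'', ''Y'', ''i'', ''cnt''}"
  "writes threshold = {''T'', ''acc'', ''v''}"
  "writes find_largest = {''key'', ''i'', ''h''}"
  "writes find_best = {''key'', ''i'', ''h''}"
  by (auto simp: reset_def cover_step_def threshold_def find_largest_def find_best_def)

lemma writes_pick_step [simp]:
  "writes pick_step = {''key'', ''i'', ''h'', ''T'', ''acc'', ''v'', ''sel'', ''U'', ''rem'', ''cur'', ''q''}"
  by (auto simp: pick_step_def)

lemma writes_greedy_run [simp]:
  "writes greedy_run = {''i'', ''cnt'', ''sel'', ''j'', ''att'', ''q'', ''U'', ''Y'', ''rem'', ''h'',
     ''key'', ''T'', ''acc'', ''v'', ''cur'', ''e''}"
  by (auto simp: greedy_run_def)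

text \<open>\<open>N\<close> has to bound all loops. The longest one, in \<open>greedy_run\<close>,
  makes \<open>n + kk \<le> n + m\<close> iterations, and adding the two assumptions gives
  \<open>n + m < N\<close>.\<close>

locale program_run = coverage +
  fixes N k :: nat
  assumes N: "2 * n + 1 \<le> N" "2 * m + 1 \<le> N" and k_le: "k \<le> m"
begin

lemma N_le: "n \<le> N" "m \<le> N" "n + m \<le> N" "n + 1 \<le> N" "k + 1 \<le> N" "k \<le> N" "n + k \<le> N"
  using N k_le by auto

definition env :: "state \<Rightarrow> bool" where
  "env s \<longleftrightarrow> nats s ''n'' 0 = n \<and> nats s ''m'' 0 = m \<and> nats s ''k'' 0 = k \<and>
     (\<forall>i<m. nats s ''u'' i = u i) \<and> (\<forall>j<n. nats s ''row'' j = j * m) \<and>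
     (\<forall>j<n. \<forall>i<m. nats s ''adj'' (j * m + i) = of_bool (adj j i))"

lemma env_same:
  assumes "env s" "same_outside X s s'"
    and "''n'' \<notin> X" "''m'' \<notin> X" "''k'' \<notin> X" "''u'' \<notin> X" "''row'' \<notin> X" "''adj'' \<notin> X"
  shows "env s'"
  using assms(1,3-) same_outsideD[OF assms(2)] by (simp add: env_def)

definition params :: "nat \<Rightarrow> nat \<Rightarrow> nat \<Rightarrow> nat \<Rightarrow> state \<Rightarrow> bool" where
  "params kk s t1 t2 st \<longleftrightarrow> nats st ''kk'' 0 = kk \<and> nats st ''s'' 0 = s \<and>
     nats st ''t1'' 0 = t1 \<and> nats st ''t2'' 0 = t2"

definition selected :: "state \<Rightarrow> nat set" where
  "selected st = {i. i < m \<and> 0 < nats st ''sel'' i}"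

text \<open>The inductive predicate \<open>greedy\<close> itself is the invariant, so its analysis
  applies to whatever choices the program makes. The other clauses tie the counters to it.\<close>

definition run_state :: "nat \<Rightarrow> nat \<Rightarrow> nat \<Rightarrow> nat \<Rightarrow> state \<Rightarrow> bool" where
  "run_state kk s t1 t2 st \<longleftrightarrow> env st \<and> params kk s t1 t2 st \<and>
     greedy kk s t1 t2 (selected st) (nats st ''att'') (nats st ''cur'' 0) (nats st ''rem'' 0) \<and>
     (\<forall>i<m. nats st ''cnt'' i = card (free (nats st ''att'') i)) \<and>
     nats st ''q'' 0 = card (selected st) \<and> nats st ''U'' 0 = sum u (selected st) \<and>
     nats st ''Y'' 0 = covered (nats st ''att'')"

lemma env_vals:
  assumes "env s"
  shows "nats s ''n'' 0 = n" "nats s ''m'' 0 = m" "nats s ''k'' 0 = k"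
    "i < m \<Longrightarrow> nats s ''u'' i = u i" "j < n \<Longrightarrow> nats s ''row'' j = j * m"
    "j < n \<Longrightarrow> i < m \<Longrightarrow> nats s ''adj'' (j * m + i) = of_bool (adj j i)"
  using assms by (auto simp: env_def)

lemma run_vals:
  assumes "run_state kk s t1 t2 st"
  shows "nats st ''kk'' 0 = kk" "nats st ''s'' 0 = s" "nats st ''t1'' 0 = t1" "nats st ''t2'' 0 = t2"
    "i < m \<Longrightarrow> nats st ''cnt'' i = card (free (nats st ''att'') i)"
    "nats st ''q'' 0 = card (selected st)" "nats st ''U'' 0 = sum u (selected st)"
    "nats st ''Y'' 0 = covered (nats st ''att'')"
  using assms by (auto simp: run_state_def params_def)

lemma card_free_upd:
  "j < n \<Longrightarrow> att j = 0 \<Longrightarrow> card (free (att(j := Suc c)) i) = card (free att i) - of_bool (adj j i)"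
  by (simp add: free_upd card_Diff_singleton_if) (simp add: free_def)

lemma wp_cover_step:
  assumes "run_state kk s t1 t2 st" "0 < nats st ''rem'' 0"
  shows "wp N cover_step (\<lambda>st'. run_state kk s t1 t2 st' \<and> nats st' ''q'' 0 = nats st ''q'' 0 \<and>
    nats st' ''Y'' 0 = Suc (nats st ''Y'' 0)) st"
proof -
  let ?att = "nats st ''att''" and ?c = "nats st ''cur'' 0"
  have env: "env st" and g: "greedy kk s t1 t2 (selected st) ?att ?c (nats st ''rem'' 0)"
    using assms by (auto simp: run_state_def)
  have c: "?c < m" using greedy_basic[OF g] assms(2) by auto
  have "free ?att ?c \<noteq> {}" using greedy_basic[OF g] assms(2) by fastforce
  then have ex: "\<exists>j<n. j \<in> free ?att ?c" by (auto simp: free_def)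
  show ?thesis
    unfolding cover_step_def
  proof (rule wp_Seq, rule wp_For_same[where b = n and
        I = "\<lambda>i st'. (\<exists>j<i. j \<in> free ?att ?c) \<longrightarrow> nats st' ''h'' 0 \<in> free ?att ?c"], goal_cases)
    case (4 st')
    then show ?case by (simp add: env_vals[OF env] same_outsideD[OF 4])
  next
    case (5 j st')
    then show ?case using c
      by (intro wp_If wp_NAssign wp_Skip)
        (auto simp: env_vals[OF env] same_outsideD[OF 5(4)] free_def less_Suc_eq)
  next
    case (6 st1)
    note fr1 = same_outsideD[OF 6(2)]
    let ?h = "nats st1 ''h'' 0"
    let ?att' = "?att(?h := Suc ?c)"
    have h: "?h < n" "?att ?h = 0" "?h \<in> free ?att ?c" using ex 6 by (auto simp: free_def)
    have cov: "greedy kk s t1 t2 (selected st) ?att' ?c (nats st ''rem'' 0 - 1)"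
      using g assms(2) h(3) by (rule greedy.cover)
    show ?case
    proof (intro wp_Seq wp_NAssign, rule wp_For_same[where b = m and
          I = "\<lambda>i st'. (\<forall>i'<m. nats st' ''cnt'' i' =
            (if i' < i then card (free ?att' i') else card (free ?att i')))"], goal_cases)
      case 1
      then show ?case by (simp add: run_vals[OF assms(1)] fr1)
    next
      case (4 st')
      then show ?case by (simp add: env_vals[OF env] fr1 same_outsideD[OF 4])
    next
      case (5 i st')
      then show ?case using h(1) card_free_upd[of ?h ?att ?c i, OF h(1,2)]
        by (intro wp_NAssign)
          (auto simp: env_vals[OF env] same_outsideD[OF 5(4)] fr1 less_Suc_eq)
    next
      case (6 st2)
      note fr = same_outsideD[OF 6(2)]
      have same: "nats st2 x = nats st x"
        if "x \<notin> {''j'', ''h'', ''att'', ''rem'', ''Y'', ''i'', ''cnt''}" for x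
        using that by (simp add: fr fr1)
      have att: "nats st2 ''att'' = ?att'" and r: "nats st2 ''rem'' 0 = nats st ''rem'' 0 - 1"
        and Y: "nats st2 ''Y'' 0 = Suc (nats st ''Y'' 0)"
        by (simp_all add: fr fr1)
      have sel: "selected st2 = selected st" using same by (simp add: selected_def)
      show ?case
        using 6(1) assms cov covered_upd[of ?h ?att ?c, OF h(1,2)]
        by (simp add: run_state_def env_def params_def att r Y sel same)
    qed (use N_le in auto)
  qed (use N_le in auto)
qed

lemma wp_threshold:
  assumes "run_state kk s t1 t2 st" "nats st ''q'' 0 < kk"
  shows "wp N threshold (\<lambda>st'. \<forall>x. nats st' ''T'' 0 \<le> u x \<longleftrightarrow> eligible kk s t1 t2 (selected st) x) st"
proof -
  let ?U = "nats st ''U'' 0" and ?d = "kk - nats st ''q'' 0"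
  have env: "env st" using assms by (auto simp: run_state_def)
  show ?thesis
    unfolding threshold_def
  proof (intro wp_If wp_Seq wp_NAssign, goal_cases)
    case 1
    then show ?case by (simp add: run_vals[OF assms(1)] eligible_def)
  next
    case 2
    then show ?case by (simp add: run_vals[OF assms(1)] eligible_def)
  next
    case 3
    show ?case
    proof (rule wp_For_same[where b = n and
        I = "\<lambda>i st'. nats st' ''acc'' 0 = ?U + nats st' ''T'' 0 * ?d \<and>
          (\<forall>x<nats st' ''T'' 0. ?U + x * ?d < n) \<and> (nats st' ''T'' 0 = i \<or> n \<le> nats st' ''acc'' 0)"], goal_cases)
      case (4 st')
      then show ?case by (simp add: env_vals[OF env] same_outsideD[OF 4])
    next
      case (5 i st')
      note fr = same_outsideD[OF 5(4)]
      show ?case using 5(1-3)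
        by (intro wp_If wp_Seq wp_NAssign wp_Skip)
          (auto simp: env_vals[OF env] run_vals(1)[OF assms(1)] fr less_Suc_eq)
    next
      case (6 st')
      let ?T = "nats st' ''T'' 0"
      \<comment> \<open>If the sum never reached \<open>n\<close> earlier, then
        \<open>?T = n\<close>, and the factor \<open>?d \<ge> 1\<close> completes the bound.\<close>
      have "?T * 1 \<le> ?T * ?d" using assms(2) by (intro mult_le_mono2) simp
      then have T: "n \<le> ?U + ?T * ?d" using 6(1) by linarith
      have "?T \<le> u x \<longleftrightarrow> n \<le> ?U + ?d * u x" for x
      proof
        assume "?T \<le> u x"
        then have "?T * ?d \<le> ?d * u x" by (simp only: mult.commute[of ?d] mult_le_mono1)
        then show "n \<le> ?U + ?d * u x" using T by linarith
      next
        assume "n \<le> ?U + ?d * u x"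
        then show "?T \<le> u x" using 6(1) by (metis mult.commute not_le)
      qed
      then show ?case using 3 by (simp add: run_vals[OF assms(1)] eligible_def)
    qed (use N_le in auto)
  qed
qed

lemma wp_find_largest:
  assumes env: "env st" and ne: "selected st \<noteq> {..<m}"
  shows "wp N find_largest (\<lambda>st'. nats st' ''h'' 0 < m \<and> nats st' ''h'' 0 \<notin> selected st \<and>
    largest (selected st) (nats st' ''h'' 0)) st"
  unfolding find_largest_def
proof (intro wp_Seq wp_NAssign, rule wp_For_same[where b = m and
      I = "\<lambda>i st'. (\<forall>i'<i. i' \<notin> selected st \<longrightarrow> u i' < nats st' ''key'' 0) \<and>
        (0 < nats st' ''key'' 0 \<longrightarrow> nats st' ''h'' 0 < m \<and> nats st' ''h'' 0 \<notin> selected st \<and>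
          nats st' ''key'' 0 = Suc (u (nats st' ''h'' 0)))"], goal_cases)
  case (4 st')
  then show ?case by (simp add: env_vals[OF env] same_outsideD[OF 4])
next
  case (5 i st')
  note fr = same_outsideD[OF 5(4)]
  have "0 < nats st ''sel'' i \<longleftrightarrow> i \<in> selected st" using 5(1) by (simp add: selected_def)
  then show ?case using 5(1-3)
    apply (intro wp_If wp_Seq wp_NAssign wp_Skip)
     apply (simp_all add: env_vals[OF env] fr less_Suc_eq)
    proof goal_cases
      case 1
      then have "nats st' ''key'' 0 \<le> u i" by auto
      then show ?case using 1(3) by (meson less_le_trans)
    qed auto
next
  case (6 st')
  obtain i where "i < m" "i \<notin> selected st" using ne by (auto simp: selected_def)
  then show ?case using 6(1) by (simp add: largest_def) (metis gr_zeroI less_Suc_eq_le not_less0)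
qed (use N_le in auto)

text \<open>The key is kept below the gain of the current choice instead of equal to it, because the
  initial choice \<open>h0\<close> starts with key 0 whatever its gain.\<close>

lemma wp_find_best:
  assumes env: "env st" and h0: "h0 < m" "h0 \<notin> selected st" "nats st ''h'' 0 = h0"
    and cnt: "\<And>i. i < m \<Longrightarrow> nats st ''cnt'' i = card (free att i)"
  shows "wp N find_best (\<lambda>st'. let h = nats st' ''h'' 0 in h < m \<and> h \<notin> selected st \<and>
    (h = h0 \<or> nats st ''T'' 0 \<le> u h) \<and>
    (\<forall>i<m. i \<notin> selected st \<longrightarrow> nats st ''T'' 0 \<le> u i \<longrightarrow> gain att i \<le> gain att h)) st"
  unfolding find_best_def Let_def
proof (intro wp_Seq wp_NAssign, rule wp_For_same[where b = m and
      I = "\<lambda>i st'. nats st' ''h'' 0 < m \<and> nats st' ''h'' 0 \<notin> selected st \<and>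
        (nats st' ''h'' 0 = h0 \<or> nats st ''T'' 0 \<le> u (nats st' ''h'' 0)) \<and>
        nats st' ''key'' 0 \<le> gain att (nats st' ''h'' 0) \<and>
        (\<forall>i'<i. i' \<notin> selected st \<longrightarrow> nats st ''T'' 0 \<le> u i' \<longrightarrow> gain att i' \<le> nats st' ''key'' 0)"],
      goal_cases)
  case (4 st')
  then show ?case by (simp add: env_vals[OF env] same_outsideD[OF 4])
next
  case (5 i st')
  note fr = same_outsideD[OF 5(4)]
  have "0 < nats st ''sel'' i \<longleftrightarrow> i \<in> selected st" using 5(1) by (simp add: selected_def)
  then show ?case using 5(1-3)
    apply (intro wp_If wp_Seq wp_NAssign wp_Skip)
      apply (simp_all add: env_vals[OF env] fr cnt gain_def less_Suc_eq)
      apply (meson le_less_trans less_imp_le_nat)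
     apply (meson le_less_trans less_imp_le_nat)
    by (auto simp: min_def)
next
  case (6 st')
  then show ?case by (meson order_trans)
qed (use h0 N_le in auto)

lemma wp_pick_step:
  assumes run: "run_state kk s t1 t2 st" and rem: "nats st ''rem'' 0 = 0"
    and q: "nats st ''q'' 0 < kk" and kk: "kk \<le> m"
  shows "wp N pick_step (\<lambda>st'. run_state kk s t1 t2 st' \<and> nats st' ''q'' 0 = Suc (nats st ''q'' 0) \<and>
    nats st' ''Y'' 0 = nats st ''Y'' 0) st"
proof -
  let ?A = "selected st" and ?att = "nats st ''att''"
  have env: "env st" and g: "greedy kk s t1 t2 ?A ?att (nats st ''cur'' 0) 0"
    using run rem by (auto simp: run_state_def)
  have cA: "nats st ''q'' 0 = card ?A" using run_vals[OF run] by simp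
  have ne: "?A \<noteq> {..<m}"
  proof
    assume "?A = {..<m}"
    then have "card ?A = m" by simp
    then show False using cA q kk by simp
  qed
  have fin: "finite ?A" by (simp add: selected_def)
  \<comment> \<open>Both branches end with the same commands. These are treated once, for every
    state that differs from \<open>st\<close> in scratch arrays only and whose \<open>''h''\<close>
    is admissible.\<close>
  define update where "update =
    (NAssign ''sel'' (V ''h'') (NConst 1) ;;
     ''U'' ::= V ''U'' [+] ''u'' $$ V ''h'' ;;
     If (''cnt'' $$ V ''h'' [<] ''u'' $$ V ''h'')
       (''rem'' ::= ''cnt'' $$ V ''h'') (''rem'' ::= ''u'' $$ V ''h'') ;;
     ''cur'' ::= V ''h'' ;;
     ''q'' ::= V ''q'' [+] NConst 1)"
  have finish: "wp N update (\<lambda>st'. run_state kk s t1 t2 st' \<and> nats st' ''q'' 0 = Suc (nats st ''q'' 0) \<and>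
      nats st' ''Y'' 0 = nats st ''Y'' 0) st1"
    if adm: "admissible kk s t1 t2 ?A ?att (nats st1 ''h'' 0)"
      and same: "same_outside {''key'', ''i'', ''h'', ''T'', ''acc'', ''v''} st st1" for st1
  proof -
    note fr = same_outsideD[OF same]
    let ?h = "nats st1 ''h'' 0"
    have h: "?h < m" "?h \<notin> ?A" using adm by (auto simp: admissible_def)
    have "greedy kk s t1 t2 (insert ?h ?A) ?att ?h (gain ?att ?h)"
      using greedy.pick[OF g _ adm] q cA by simp
    moreover have "{i. i \<noteq> ?h \<longrightarrow> i < m \<and> 0 < nats st ''sel'' i} = insert ?h ?A"
      using h by (auto simp: selected_def)
    moreover have "card (free ?att ?h) < u ?h \<Longrightarrow> gain ?att ?h = card (free ?att ?h)"
      "\<not> card (free ?att ?h) < u ?h \<Longrightarrow> gain ?att ?h = u ?h" by (auto simp: gain_def)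
    ultimately show ?thesis
      unfolding update_def
      by (intro wp_Seq wp_NAssign wp_If)
        (simp_all add: run_state_def env_def params_def selected_def[of "nupdate _ _ _ _"]
          fr env_vals[OF env] run_vals[OF run] h fin)
  qed
  have "wp N (find_largest ;; If (V ''q'' [<] V ''s'') Skip (threshold ;; find_best) ;; update)
    (\<lambda>st'. run_state kk s t1 t2 st' \<and> nats st' ''q'' 0 = Suc (nats st ''q'' 0) \<and>
      nats st' ''Y'' 0 = nats st ''Y'' 0) st"
  proof (rule wp_Seq, rule wp_conseq[OF wp_find_largest[OF env ne]], intro wp_Seq wp_If wp_Skip, goal_cases)
    case (1 st1)
    note fr1 = same_outsideD[OF 1(2)]
    have "same_outside {''key'', ''i'', ''h'', ''T'', ''acc'', ''v''} st st1"
      using 1(2) by (simp add: same_outside_def)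
    moreover have "card ?A < s" using 1(3) by (simp add: fr1 run_vals[OF run])
    ultimately show ?case using 1 by (intro finish) (auto simp: admissible_def)
  next
    case (2 st1)
    let ?h = "nats st1 ''h'' 0"
    have fr1: "nats st1 x = nats st x" if "x \<notin> {''key'', ''i'', ''h''}" for x
      using same_outsideD[OF 2(2)] that by simp
    have sel1: "selected st1 = ?A" by (simp add: selected_def fr1)
    have run1: "run_state kk s t1 t2 st1"
      using run by (simp add: run_state_def env_def params_def sel1 fr1)
    have s: "s \<le> card ?A" using 2(3) by (simp add: fr1 run_vals[OF run])
    have q1: "nats st1 ''q'' 0 < kk" using q by (simp add: fr1)
    show ?case
    proof (rule wp_conseq[OF wp_threshold[OF run1 q1]])
      fix st2
      assume T: "\<forall>x. nats st2 ''T'' 0 \<le> u x \<longleftrightarrow> eligible kk s t1 t2 (selected st1) x"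
        and same2: "same_outside (writes threshold) st1 st2"
      have fr2: "nats st2 x = nats st1 x" if "x \<notin> {''T'', ''acc'', ''v''}" for x
        using same_outsideD[OF same2] that by simp
      have sel2: "selected st2 = ?A" using sel1 by (simp add: selected_def fr2)
      have env2: "env st2" using env by (simp add: env_def fr1 fr2)
      have cnt2: "nats st2 ''cnt'' i = card (free ?att i)" if "i < m" for i
        using run_vals(5)[OF run that] by (simp add: fr1 fr2)
      have h2: "nats st2 ''h'' 0 = ?h" by (simp add: fr2)
      show "wp N find_best (wp N update (\<lambda>st'. run_state kk s t1 t2 st' \<and>
        nats st' ''q'' 0 = Suc (nats st ''q'' 0) \<and> nats st' ''Y'' 0 = nats st ''Y'' 0)) st2"
      proof (rule wp_conseq[OF wp_find_best[where att = ?att and ?h0.0 = ?h]])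
        fix st3
        assume B: "let h = nats st3 ''h'' 0 in h < m \<and> h \<notin> selected st2 \<and>
            (h = ?h \<or> nats st2 ''T'' 0 \<le> u h) \<and>
            (\<forall>i<m. i \<notin> selected st2 \<longrightarrow> nats st2 ''T'' 0 \<le> u i \<longrightarrow> gain ?att i \<le> gain ?att h)"
          and same3: "same_outside (writes find_best) st2 st3"
        have "nats st3 x = nats st x" if "x \<notin> {''key'', ''i'', ''h'', ''T'', ''acc'', ''v''}" for x
          using same_outsideD[OF same3] that by (simp add: fr1 fr2)
        then have "same_outside {''key'', ''i'', ''h'', ''T'', ''acc'', ''v''} st st3"
          unfolding same_outside_def by blast
        moreover have "admissible kk s t1 t2 ?A ?att (nats st3 ''h'' 0)"
          using B T 2(1) s by (auto simp: Let_def admissible_def sel1 sel2)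
        ultimately show "wp N update (\<lambda>st'. run_state kk s t1 t2 st' \<and>
          nats st' ''q'' 0 = Suc (nats st ''q'' 0) \<and> nats st' ''Y'' 0 = nats st ''Y'' 0) st3"
          by (rule finish[rotated])
      qed (use env2 2(1) sel2 h2 cnt2 in auto)
    qed
  qed
  then show ?thesis by (simp add: pick_step_def update_def)
qed

lemma wp_reset:
  assumes env: "env st" and par: "params kk s t1 t2 st"
  shows "wp N reset (\<lambda>st'. run_state kk s t1 t2 st' \<and> nats st' ''q'' 0 = 0 \<and> nats st' ''Y'' 0 = 0) st"
  unfolding reset_def
proof (rule wp_Seq, rule wp_For_same[where b = m and
      I = "\<lambda>i st'. \<forall>i'<i. nats st' ''cnt'' i' = 0 \<and> nats st' ''sel'' i' = 0"], goal_cases)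
  case (4 st')
  then show ?case by (simp add: env_vals[OF env] same_outsideD[OF 4])
next
  case (5 i st')
  then show ?case by (intro wp_Seq wp_NAssign) (auto simp: less_Suc_eq)
next
  case (6 st1)
  note fr1 = same_outsideD[OF 6(2)]
  show ?case
  proof (rule wp_Seq, rule wp_For_same[where b = n and
        I = "\<lambda>j st'. (\<forall>j'<j. nats st' ''att'' j' = 0) \<and>
          (\<forall>i<m. nats st' ''cnt'' i = card {j'. j' < j \<and> adj j' i})"], goal_cases)
    case 1
    then show ?case using 6(1) by simp
  next
    case (4 st')
    then show ?case by (simp add: env_vals[OF env] same_outsideD[OF 4] fr1)
  next
    case (5 j st2)
    note fr2 = same_outsideD[OF 5(4)]
    show ?case
    proof (intro wp_Seq wp_NAssign, rule wp_For_same[where b = m and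
          I = "\<lambda>i st'. \<forall>i'<m. nats st' ''cnt'' i' =
            card {j'. j' < j \<and> adj j' i'} + (if i' < i then of_bool (adj j i') else 0)"], goal_cases)
      case 1
      then show ?case using 5(2) by simp
    next
      case (4 st')
      then show ?case by (simp add: env_vals[OF env] same_outsideD[OF 4] fr1 fr2)
    next
      case (5 i st')
      note fr = same_outsideD[OF 5(4)]
      show ?case using 5(1-3) \<open>nats st2 ''j'' 0 = j\<close> \<open>j < n\<close>
        by (intro wp_NAssign) (simp add: env_vals[OF env] fr fr1 fr2 less_Suc_eq)
    next
      case (6 st3)
      have "{j'. j' < Suc j \<and> adj j' i} =
        (if adj j i then insert j {j'. j' < j \<and> adj j' i} else {j'. j' < j \<and> adj j' i})" for i
        by (auto simp: less_Suc_eq)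
      then have c: "card {j'. j' < Suc j \<and> adj j' i} = card {j'. j' < j \<and> adj j' i} + of_bool (adj j i)" for i
        by simp
      show ?case using 6(1) \<open>nats st2 ''j'' 0 = j\<close> 5(2)
        by (auto simp: c same_outsideD[OF 6(2)] All_less_Suc)
    qed (use N_le in auto)
  next
    case (6 st2)
    note fr2 = same_outsideD[OF 6(2)]
    have zero: "nats st2 ''att'' j = 0" if "j < n" for j using 6 that by simp
    have sel: "selected (nupdate x p v st') = selected st'" if "x \<noteq> ''sel''" for x p v st'
      using that by (simp add: selected_def)
    have sel2: "selected st2 = {}"
      using \<open>\<forall>i'<m. nats st1 ''cnt'' i' = 0 \<and> nats st1 ''sel'' i' = 0\<close> by (simp add: selected_def fr2)
    have "card {j'. j' < n \<and> adj j' i} = card (free (nats st2 ''att'') i)" for i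
      unfolding free_def using zero by (intro arg_cong[where f = card]) auto
    moreover have "covered (nats st2 ''att'') = 0" using zero by (auto simp: covered_def)
    moreover have "greedy kk s t1 t2 {} (nats st2 ''att'') c 0" for c using zero by (rule greedy.start)
    ultimately show ?case using 6(1) par
      by (intro wp_Seq wp_NAssign)
        (simp add: run_state_def env_def params_def sel sel2 fr1 fr2 env_vals[OF env])
  qed (use N_le in auto)
qed (use N_le in auto)

text \<open>Each iteration raises \<open>q + Y\<close> by one until \<open>kk\<close> facilities are
  picked and nothing is pending. If the sum reaches \<open>n + kk\<close>, all clients are covered,
  and then nothing can be pending either.\<close>

lemma wp_greedy_run:
  assumes env: "env st" and par: "params kk s t1 t2 st" and kk: "kk \<le> m"
  shows "wp N greedy_run (\<lambda>st'. run_state kk s t1 t2 st' \<and> nats st' ''rem'' 0 = 0 \<and>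
    card (selected st') = kk) st"
  unfolding greedy_run_def
proof (rule wp_Seq, rule wp_conseq[OF wp_reset[OF env par]], goal_cases)
  case (1 st1)
  show ?case
  proof (rule wp_For[where b = "n + kk" and
        I = "\<lambda>e st'. run_state kk s t1 t2 st' \<and> (nats st' ''q'' 0 + nats st' ''Y'' 0 = e \<or>
          nats st' ''q'' 0 = kk \<and> nats st' ''rem'' 0 = 0)"], goal_cases)
    case 1
    have "selected (nupdate ''e'' 0 0 st1) = selected st1" by (simp add: selected_def)
    then show ?case using \<open>run_state kk s t1 t2 st1 \<and> _\<close>
      by (simp add: run_state_def env_def params_def)
  next
    case 3
    then show ?case using N kk by simp
  next
    case (4 e st')
    then show ?case by (simp add: run_state_def env_def params_def)
  next
    case (5 e st2)
    have e: "run_state kk s t1 t2 (nupdate ''e'' 0 v st') \<longleftrightarrow> run_state kk s t1 t2 st'" for v st'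
      by (simp add: run_state_def env_def params_def selected_def)
    have q: "nats st2 ''q'' 0 \<le> kk"
      using 5(2) greedy_card by (auto simp: run_state_def)
    have run: "run_state kk s t1 t2 st2" using 5(2) by simp
    show ?case
    proof (intro wp_If wp_Skip, goal_cases)
      case 1
      then have "0 < nats st2 ''rem'' 0" by simp
      from wp_cover_step[OF run this] show ?case
        by (rule wp_conseq) (use 5(2) \<open>0 < nats st2 ''rem'' 0\<close> in \<open>simp add: e\<close>)
    next
      case 2
      then have "nats st2 ''rem'' 0 = 0" "nats st2 ''q'' 0 < kk" using run_vals(1)[OF run] by simp_all
      from wp_pick_step[OF run this kk] show ?case
        by (rule wp_conseq) (use 5(2) \<open>nats st2 ''q'' 0 < kk\<close> in \<open>simp add: e\<close>)
    next
      case 3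
      then have "nats st2 ''rem'' 0 = 0" "nats st2 ''q'' 0 = kk" using q run_vals(1)[OF run] by simp_all
      then show ?case using run by (simp add: e)
    qed
  next
    case (6 st2)
    then have run: "run_state kk s t1 t2 st2" by simp
    let ?att = "nats st2 ''att''" and ?c = "nats st2 ''cur'' 0"
    have g: "greedy kk s t1 t2 (selected st2) ?att ?c (nats st2 ''rem'' 0)"
      using run by (simp add: run_state_def)
    have "nats st2 ''q'' 0 = kk \<and> nats st2 ''rem'' 0 = 0"
    proof (cases "nats st2 ''q'' 0 = kk \<and> nats st2 ''rem'' 0 = 0")
      case False
      have "card {j. j < n \<and> ?att j \<noteq> 0} \<le> n"
        using card_mono[of "{..<n}" "{j. j < n \<and> ?att j \<noteq> 0}"] by auto
      moreover have "card (selected st2) \<le> kk" using greedy_card[OF g] .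
      ultimately have c: "card (selected st2) = kk" "card {j. j < n \<and> ?att j \<noteq> 0} = n"
        using 6(1) False run_vals(6,8)[OF run] by (auto simp: covered_def)
      then have "{j. j < n \<and> ?att j \<noteq> 0} = {..<n}" by (intro card_subset_eq) auto
      then have "free ?att ?c = {}" by (auto simp: free_def)
      then have "nats st2 ''rem'' 0 = 0" using greedy_basic[OF g] by (cases "nats st2 ''rem'' 0") auto
      then show ?thesis using c run_vals(6)[OF run] by simp
    qed simp
    then show ?case using run run_vals(6)[OF run] by simp
  qed (use kk in auto)
qed

end

section \<open>Correctness of the two searches\<close>

lemma writes_search [simp]:
  "writes keep = {''by'', ''i'', ''open'', ''j'', ''batt''}"
  "writes quarter = {''s'', ''i''}"
  "writes loads = {''i'', ''w'', ''j''}"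
  "writes fill_table = {''st'', ''b'', ''p'', ''W'', ''E'', ''i'', ''x''}"
  "writes best_value = {''p'', ''bw'', ''W''}"
  "writes reconstruct = {''by'', ''p'', ''r'', ''i'', ''open'', ''j'', ''batt''}"
  by (auto simp: keep_def quarter_def loads_def fill_table_def best_value_def reconstruct_def)

context program_run
begin

definition opened :: "state \<Rightarrow> nat set" where
  "opened st = {i. i < m \<and> 0 < nats st ''open'' i}"

text \<open>The cell \<open>''by''\<close> holds one plus the number of covered clients of the best candidate so far, and 0
  as long as there is none.\<close>

definition kept :: "state \<Rightarrow> bool" where
  "kept st \<longleftrightarrow> card (opened st) = k \<and> n \<le> sum u (opened st) \<and>
     (\<forall>j<n. 0 < nats st ''batt'' j \<longrightarrow> nats st ''batt'' j - 1 < m \<and> adj j (nats st ''batt'' j - 1)) \<and>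
     (\<forall>i. load (nats st ''batt'') i \<le> u i) \<and>
     nats st ''by'' 0 = Suc (card {j. j < n \<and> 0 < nats st ''batt'' j \<and> nats st ''batt'' j - 1 \<in> opened st})"

definition best_ok :: "state \<Rightarrow> bool" where
  "best_ok st \<longleftrightarrow> nats st ''by'' 0 = 0 \<or> kept st"

lemma best_ok_same:
  "best_ok s \<Longrightarrow> same_outside X s s' \<Longrightarrow> ''open'' \<notin> X \<Longrightarrow> ''batt'' \<notin> X \<Longrightarrow> ''by'' \<notin> X \<Longrightarrow> best_ok s'"
  by (simp add: best_ok_def kept_def opened_def same_outsideD)

lemma load_cong: "(\<And>j. j < n \<Longrightarrow> att j = att' j) \<Longrightarrow> load att i = load att' i"
  unfolding load_def by (intro arg_cong[where f = card]) auto

lemma card_assigned: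
  assumes "finite A"
  shows "card {j. j < n \<and> 0 < att j \<and> att j - 1 \<in> A} = (\<Sum>i\<in>A. load att i)"
proof -
  have "{j. j < n \<and> 0 < att j \<and> att j - 1 \<in> A} = (\<Union>i\<in>A. {j. j < n \<and> att j = Suc i})"
    by force
  also have "card \<dots> = (\<Sum>i\<in>A. load att i)"
    unfolding load_def using assms by (intro card_UN_disjoint) auto
  finally show ?thesis .
qed

lemma wp_keep:
  assumes run: "run_state kk s t1 t2 st" and k: "card (selected st) = k" and cap: "n \<le> sum u (selected st)"
  shows "wp N keep (\<lambda>st'. kept st' \<and> nats st' ''by'' 0 = Suc (nats st ''Y'' 0)) st"
  unfolding keep_def
proof (intro wp_Seq wp_NAssign, rule wp_For_same[where b = m and
      I = "\<lambda>i st'. \<forall>i'<i. nats st' ''open'' i' = nats st ''sel'' i'"], goal_cases)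
  have env: "env st" using run by (simp add: run_state_def)
  note vals = env_vals[OF env]
  {
    case (4 st')
    then show ?case by (simp add: vals same_outsideD[OF 4])
  next
    case (5 i st')
    then show ?case by (intro wp_NAssign) (auto simp: same_outsideD[OF 5(4)] less_Suc_eq)
  next
    case (6 st1)
    note fr1 = same_outsideD[OF 6(2)]
    show ?case
    proof (rule wp_For_same[where b = n and
          I = "\<lambda>j st'. \<forall>j'<j. nats st' ''batt'' j' = nats st ''att'' j'"], goal_cases)
      case (4 st')
      then show ?case by (simp add: vals same_outsideD[OF 4] fr1)
    next
      case (5 j st')
      then show ?case by (intro wp_NAssign) (auto simp: same_outsideD[OF 5(4)] fr1 less_Suc_eq)
    next
      case (6 st2)
      note fr2 = same_outsideD[OF 6(2)]
      let ?att = "nats st ''att''" and ?batt = "nats st2 ''batt''"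
      have g: "greedy kk s t1 t2 (selected st) ?att (nats st ''cur'' 0) (nats st ''rem'' 0)"
        using run by (simp add: run_state_def)
      have o: "opened st2 = selected st"
        using \<open>\<forall>i'<m. nats st1 ''open'' i' = nats st ''sel'' i'\<close>
        by (auto simp: opened_def selected_def fr2)
      have att: "?batt j = ?att j" if "j < n" for j using 6(1) that by simp
      have A: "?att j - 1 \<in> selected st" "adj j (?att j - 1)" if "j < n" "0 < ?att j" for j
        using greedy_basic[OF g] that by auto
      have "{j. j < n \<and> 0 < ?batt j \<and> ?batt j - 1 \<in> selected st} = {j. j < n \<and> ?att j \<noteq> 0}"
        using A att by auto
      moreover have "nats st2 ''by'' 0 = Suc (covered ?att)"
        using run_vals(8)[OF run] by (simp add: fr1 fr2)
      moreover have "\<forall>j<n. 0 < ?batt j \<longrightarrow> ?batt j - 1 < m \<and> adj j (?batt j - 1)"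
        using A att by (auto simp: selected_def)
      moreover have "load ?batt i \<le> u i" for i
        using greedy_basic[OF g] load_cong[of ?batt ?att i] att by simp
      ultimately show ?case
        using k cap run_vals(8)[OF run] by (simp add: kept_def o covered_def)
    qed (use N_le in auto)
  }
qed (use N_le in auto)

lemma wp_quarter:
  assumes env: "env st"
  shows "wp N quarter (\<lambda>st'. nats st' ''s'' 0 = k div 4) st"
  unfolding quarter_def
proof (intro wp_Seq wp_NAssign, rule wp_For_same[where b = k and
      I = "\<lambda>i st'. nats st' ''s'' 0 = i div 4"], goal_cases)
  case (4 st')
  then show ?case by (simp add: env_vals[OF env] same_outsideD[OF 4])
next
  case (5 i st')
  have "i + 1 < i div 4 + i div 4 + i div 4 + i div 4 + 4 \<Longrightarrow> i div 4 = Suc i div 4"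
    "\<not> i + 1 < i div 4 + i div 4 + i div 4 + i div 4 + 4 \<Longrightarrow> Suc (i div 4) = Suc i div 4"
    by presburger+
  then show ?case using 5(1-3) by (intro wp_If wp_NAssign wp_Skip) simp_all
qed (use N_le in auto)

text \<open>\<open>a1\<close> and \<open>a2\<close> are a successful guess whenever
  \<open>good\<close> holds. The invariants only record whether the loops have passed that pair,
  since later rounds never decrease \<open>''by''\<close>.\<close>

lemma wp_threshold_search:
  assumes env: "env st"
    and good: "good \<Longrightarrow> a1 \<le> n" "good \<Longrightarrow> a2 \<le> n"
      "\<And>A att c. good \<Longrightarrow> greedy k (k div 4) a1 a2 A att c 0 \<Longrightarrow> card A = k \<Longrightarrow>
        n \<le> sum u A \<and> g \<le> covered att"
  shows "wp N threshold_search (\<lambda>st'. env st' \<and> best_ok st' \<and> (good \<longrightarrow> g < nats st' ''by'' 0)) st"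
  unfolding threshold_search_def
proof (intro wp_Seq wp_NAssign, rule wp_conseq[OF wp_quarter], goal_cases)
  case 1
  then show ?case using env by (simp add: env_def)
next
  case (2 st1)
  note fr1 = same_outsideD[OF 2(2)]
  have v1: "nats st1 ''kk'' 0 = k" "nats st1 ''s'' 0 = k div 4" "nats st1 ''by'' 0 = 0"
    using 2(1) by (simp_all add: fr1 env_vals[OF env])
  have env1: "env st1" using env by (simp add: env_def fr1)
  show ?case
  proof (rule wp_For_same[where b = "n + 1" and
        I = "\<lambda>t st'. best_ok st' \<and> (good \<and> a1 < t \<longrightarrow> g < nats st' ''by'' 0)"], goal_cases)
    case 1
    then show ?case by (simp add: best_ok_def v1)
  next
    case (4 st')
    then show ?case by (simp add: env_vals[OF env1] same_outsideD[OF 4])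
  next
    case (5 t1 st2)
    note fr2 = same_outsideD[OF 5(4)]
    have v2: "nats st2 ''kk'' 0 = k" "nats st2 ''s'' 0 = k div 4" by (simp_all add: fr2 v1)
    have env2: "env st2" using env1 5(4) by (rule env_same) auto
    show ?case
    proof (rule wp_For_same[where b = "n + 1" and
          I = "\<lambda>t st'. best_ok st' \<and> (good \<and> (a1 < t1 \<or> a1 = t1 \<and> a2 < t) \<longrightarrow> g < nats st' ''by'' 0)"], goal_cases)
      case 1
      then show ?case using 5(2) by (simp add: best_ok_def kept_def opened_def)
    next
      case (4 st')
      then show ?case by (simp add: env_vals[OF env2] same_outsideD[OF 4])
    next
      case (5 t2 st3)
      note fr3 = same_outsideD[OF 5(4)]
      have env3: "env st3" using env2 5(4) by (rule env_same) auto
      have par3: "params k (k div 4) t1 t2 st3"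
        using \<open>nats st2 ''t1'' 0 = t1\<close> 5(3) by (simp add: params_def fr3 v2)
      show ?case
      proof (rule wp_Seq, rule wp_conseq[OF wp_greedy_run[OF env3 par3 k_le]], goal_cases)
        case (1 st4)
        note fr4 = same_outsideD[OF 1(2)]
        have run: "run_state k (k div 4) t1 t2 st4" and c4: "card (selected st4) = k" using 1(1) by auto
        have best4: "best_ok st4" using 5(2) best_ok_same[OF _ 1(2)] by auto
        have by4: "nats st4 ''by'' 0 = nats st3 ''by'' 0" by (simp add: fr4)
        have env4: "env st4" using run by (simp add: run_state_def)
        have rem: "nats st4 ''rem'' 0 = 0" using 1(1) by simp
        have "greedy k (k div 4) t1 t2 (selected st4) (nats st4 ''att'') (nats st4 ''cur'' 0) 0"
          using run unfolding run_state_def rem by blast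
        from good(3)[OF _ _ c4, of "nats st4 ''att''" "nats st4 ''cur'' 0"] this
        have new: "n \<le> sum u (selected st4) \<and> g \<le> nats st4 ''Y'' 0" if "good" "a1 = t1" "a2 = t2"
          using that run_vals(8)[OF run] by simp
        have upd: "best_ok (nupdate ''t2'' 0 v st') \<longleftrightarrow> best_ok st'" for v st'
          by (simp add: best_ok_def kept_def opened_def)
        show ?case
        proof (rule wp_If)
          assume b: "bval (Not (V ''U'' [<] V ''n'') [&] V ''by'' [<] V ''Y'' [+] NConst 1) st4"
          then have "n \<le> sum u (selected st4)" using run_vals(7)[OF run] env_vals(1)[OF env4] by simp
          from wp_keep[OF run c4 this]
          show "wp N keep (\<lambda>s'. best_ok (nupdate ''t2'' 0 (Suc t2) s') \<and>
            (good \<and> (a1 < t1 \<or> a1 = t1 \<and> a2 < Suc t2) \<longrightarrow>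
              g < nats (nupdate ''t2'' 0 (Suc t2) s') ''by'' 0)) st4"
          proof (rule wp_conseq)
            fix s'
            assume s': "kept s' \<and> nats s' ''by'' 0 = Suc (nats st4 ''Y'' 0)"
            have "nats st4 ''by'' 0 < Suc (nats st4 ''Y'' 0)" using b by simp
            then have "g < nats s' ''by'' 0" if "good" "a1 < t1 \<or> a1 = t1 \<and> a2 < Suc t2"
              using 5(2) by4 new s' that by (auto simp: less_Suc_eq)
            then show "best_ok (nupdate ''t2'' 0 (Suc t2) s') \<and>
              (good \<and> (a1 < t1 \<or> a1 = t1 \<and> a2 < Suc t2) \<longrightarrow>
                g < nats (nupdate ''t2'' 0 (Suc t2) s') ''by'' 0)"
              using s' by (simp add: upd) (simp add: best_ok_def)
          qed
        next
          assume "\<not> bval (Not (V ''U'' [<] V ''n'') [&] V ''by'' [<] V ''Y'' [+] NConst 1) st4"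
          then have b: "n \<le> sum u (selected st4) \<Longrightarrow> nats st4 ''Y'' 0 < nats st4 ''by'' 0"
            using run_vals(7)[OF run] env_vals(1)[OF env4] by auto
          have "g < nats st4 ''by'' 0" if "good" "a1 < t1 \<or> a1 = t1 \<and> a2 < Suc t2"
            using 5(2) by4 new b that by (force simp: less_Suc_eq)
          then show "wp N Skip (\<lambda>s'. best_ok (nupdate ''t2'' 0 (Suc t2) s') \<and>
            (good \<and> (a1 < t1 \<or> a1 = t1 \<and> a2 < Suc t2) \<longrightarrow>
              g < nats (nupdate ''t2'' 0 (Suc t2) s') ''by'' 0)) st4"
            using best4 by (intro wp_Skip) (simp add: upd)
        qed
      qed
    next
      case (6 st3)
      have "best_ok (nupdate ''t1'' 0 v st') \<longleftrightarrow> best_ok st'" for v st'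
        by (simp add: best_ok_def kept_def opened_def)
      then show ?case using 6(1) good by (auto simp: less_Suc_eq)
    qed (use N_le in auto)
  next
    case (6 st2)
    have "env st2" using env1 6(2) by (rule env_same) auto
    then show ?case using 6(1) good by auto
  qed (use N_le in auto)
qed

lemma wp_loads:
  assumes env: "env st" and att: "\<And>j. j < n \<Longrightarrow> 0 < nats st ''att'' j \<Longrightarrow> nats st ''att'' j - 1 < m"
  shows "wp N loads (\<lambda>st'. \<forall>i<m. nats st' ''w'' i = load (nats st ''att'') i) st"
  unfolding loads_def
proof (rule wp_Seq, rule wp_For_same[where b = m and
      I = "\<lambda>i st'. \<forall>i'<i. nats st' ''w'' i' = 0"], goal_cases)
  case (4 st')
  then show ?case by (simp add: env_vals[OF env] same_outsideD[OF 4])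
next
  case (5 i st')
  then show ?case by (intro wp_NAssign) (auto simp: less_Suc_eq)
next
  case (6 st1)
  note fr1 = same_outsideD[OF 6(2)]
  let ?att = "nats st ''att''"
  show ?case
  proof (rule wp_For_same[where b = n and
        I = "\<lambda>j st'. \<forall>i<m. nats st' ''w'' i = card {j'. j' < j \<and> ?att j' = Suc i}"], goal_cases)
    case 1
    then show ?case using 6(1) by simp
  next
    case (4 st')
    then show ?case by (simp add: env_vals[OF env] same_outsideD[OF 4] fr1)
  next
    case (5 j st')
    note fr = same_outsideD[OF 5(4)]
    have "{j'. j' < Suc j \<and> ?att j' = Suc i} = (if ?att j = Suc i
        then insert j {j'. j' < j \<and> ?att j' = Suc i} else {j'. j' < j \<and> ?att j' = Suc i})" for i
      by (auto simp: less_Suc_eq)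
    then have c: "card {j'. j' < Suc j \<and> ?att j' = Suc i} =
        card {j'. j' < j \<and> ?att j' = Suc i} + of_bool (?att j = Suc i)" for i
      by simp
    show ?case using 5(1-3) att[OF 5(1)]
      by (intro wp_If wp_NAssign wp_Skip) (auto simp: fr fr1 c)
  qed (use N_le in \<open>auto simp: load_def\<close>)
qed (use N_le in auto)

section \<open>Layout and correctness of the knapsack table\<close>

abbreviation width :: nat where "width \<equiv> n + 1"

abbreviation stride :: nat where "stride \<equiv> (k + 1) * (n + 1)"

text \<open>The table entry for \<open>i\<close> items, \<open>b\<close> of them chosen, of weight \<open>W\<close> is stored at
  \<open>i * stride + b * width + W\<close>.\<close>

definition cell :: "(nat \<Rightarrow> nat) \<Rightarrow> nat \<Rightarrow> nat" where
  "cell w p = knapsack u w (p div stride) (p mod stride div width) (p mod stride mod width)"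

lemma cell_offset_less: "b \<le> k \<Longrightarrow> W \<le> n \<Longrightarrow> b * width + W < stride"
proof -
  assume "b \<le> k" "W \<le> n"
  then have "b * width + W \<le> k * width + n" by (intro add_mono mult_right_mono) auto
  then show ?thesis by simp
qed

lemma div_mod_offset: "x < y \<Longrightarrow> (c * y + x) div y = c" "x < y \<Longrightarrow> (c * y + x) mod y = x" for x y c :: nat
  by simp_all

lemma cell_eq:
  assumes "b \<le> k" "W \<le> n"
  shows "cell w (i * stride + b * width + W) = knapsack u w i b W"
proof -
  let ?o = "b * width + W"
  have o: "?o < stride" using assms by (rule cell_offset_less)
  have "(i * stride + ?o) div stride = i" "(i * stride + ?o) mod stride = ?o"
    using o by (rule div_mod_offset)+
  moreover have "?o div width = b" "?o mod width = W" using assms by (intro div_mod_offset; simp)+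
  ultimately show ?thesis by (simp only: cell_def add.assoc)
qed

lemma wp_fill_table:
  assumes env: "env st" and w: "\<And>i. i < m \<Longrightarrow> nats st ''w'' i = w i"
  shows "wp N fill_table (\<lambda>st'. nats st' ''st'' 0 = stride \<and> nats st' ''p'' 0 = (m + 1) * stride \<and>
    (\<forall>p<(m + 1) * stride. nats st' ''E'' p = cell w p)) st"
  unfolding fill_table_def
proof (intro wp_Seq wp_NAssign, rule wp_For_same[where b = "k + 1" and
      I = "\<lambda>b st'. nats st' ''st'' 0 = b * width"], goal_cases)
  case (4 st')
  then show ?case by (simp add: env_vals[OF env] same_outsideD[OF 4])
next
  case (5 i st')
  then show ?case by (intro wp_NAssign) (simp add: env_vals[OF env] same_outsideD[OF 5(4)])
next
  case (6 st1)
  note fr1 = same_outsideD[OF 6(2)]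
  have S1: "nats st1 ''st'' 0 = stride" using 6(1) by simp
  show ?case
  proof (intro wp_Seq wp_NAssign, rule wp_For_same[where b = "k + 1" and
        I = "\<lambda>b st'. nats st' ''p'' 0 = b * width \<and> (\<forall>p<b * width. nats st' ''E'' p = 0)"], goal_cases)
    case (4 st')
    then show ?case by (simp add: env_vals[OF env] same_outsideD[OF 4] fr1)
  next
    case (5 b st2)
    note fr2 = same_outsideD[OF 5(4)]
    show ?case
    proof (rule wp_For_same[where b = width and
          I = "\<lambda>W st'. nats st' ''p'' 0 = b * width + W \<and> (\<forall>p<b * width + W. nats st' ''E'' p = 0)"], goal_cases)
      case 1
      then show ?case using 5(2) by simp
    next
      case (4 st')
      then show ?case by (simp add: env_vals[OF env] same_outsideD[OF 4] fr1 fr2)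
    next
      case (5 W st')
      then show ?case by (intro wp_Seq wp_NAssign) (simp add: less_Suc_eq)
    next
      case (6 st3)
      then show ?case by (simp add: add.commute add.left_commute)
    qed (use N_le in auto)
  next
    case (6 st2)
    note fr2 = same_outsideD[OF 6(2)]
    have S2: "nats st2 ''st'' 0 = stride" by (simp add: fr2 S1)
    have first: "cell w p = (if p = 0 then 1 else 0)" if "p < stride" for p
    proof -
      have "p mod stride = p" "p div stride = 0" using that by simp_all
      moreover have "p div width = 0 \<and> p mod width = 0 \<longleftrightarrow> p = 0"
        by (metis div_0 mod_0 div_mult_mod_eq add_0 mult_0)
      ultimately show ?thesis by (simp only: cell_def knapsack.simps)
    qed
    show ?case
    proof (intro wp_Seq wp_NAssign, rule wp_For_same[where b = m and
          I = "\<lambda>i st'. nats st' ''p'' 0 = (i + 1) * stride \<and>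
            (\<forall>p<(i + 1) * stride. nats st' ''E'' p = cell w p)"], goal_cases)
      case 1
      then show ?case using 6(1) first by (simp del: mult_Suc mult_Suc_right)
    next
      case (4 st')
      then show ?case by (simp add: env_vals[OF env] same_outsideD[OF 4] fr1 fr2)
    next
      case (5 i st3)
      note fr3 = same_outsideD[OF 5(4)] and i = 5(1,3)
      show ?case
      proof (rule wp_For_same[where b = "k + 1" and
            I = "\<lambda>b st'. nats st' ''p'' 0 = (i + 1) * stride + b * width \<and>
              (\<forall>p<(i + 1) * stride + b * width. nats st' ''E'' p = cell w p)"], goal_cases)
        case 1
        then show ?case using 5(2) by (simp del: mult_Suc mult_Suc_right)
      next
        case (4 st')
        then show ?case by (simp add: env_vals[OF env] same_outsideD[OF 4] fr1 fr2 fr3)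
      next
        case (5 b st4)
        note fr4 = same_outsideD[OF 5(4)] and b = 5(1,3)
        show ?case
        proof (rule wp_For_same[where b = "width" and
              I = "\<lambda>W st'. nats st' ''p'' 0 = (i + 1) * stride + b * width + W \<and>
                (\<forall>p<(i + 1) * stride + b * width + W. nats st' ''E'' p = cell w p)"], goal_cases)
          case 1
          then show ?case using 5(2) by (simp del: mult_Suc mult_Suc_right)
        next
          case (4 st')
          then show ?case by (simp add: env_vals[OF env] same_outsideD[OF 4] fr1 fr2 fr3 fr4)
        next
          case (5 W st5)
          note fr5 = same_outsideD[OF 5(4)]
          let ?p = "(i + 1) * stride + b * width + W"
          have bW: "b \<le> k" "W \<le> n" using b 5(1) by auto
          have cur: "cell w ?p = knapsack u w (Suc i) b W"
            using cell_eq[OF bW, of w "i + 1"] by (simp only: Suc_eq_plus1)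
          have p0: "?p - stride = i * stride + b * width + W"
            by (simp only: add_mult_distrib) simp
          have "nats st5 ''E'' (?p - stride) = cell w (?p - stride)" using 5(2) by simp
          then have E0: "nats st5 ''E'' (?p - stride) = knapsack u w i b W"
            using cell_eq[OF bW, of w i] p0 by (simp only:)
          have E1: "nats st5 ''E'' (?p - (stride + width + w i)) = knapsack u w i (b - 1) (W - w i)"
            if "0 < b" and le: "w i \<le> W"
          proof -
            obtain b' where b': "b = Suc b'" using \<open>0 < b\<close> by (cases b) auto
            have p1: "?p - (stride + width + w i) = i * stride + b' * width + (W - w i)"
              using le by (simp only: add_mult_distrib b' mult_Suc) simp
            have "nats st5 ''E'' (?p - (stride + width + w i)) = cell w (?p - (stride + width + w i))"
              using 5(2) by simp
            then show ?thesis using cell_eq[of b' "W - w i" w i] p1 bW b' by simp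
          qed
          have vals: "nats st5 ''st'' 0 = stride" "nats st5 ''n'' 0 = n" "nats st5 ''w'' i = w i"
            "nats st5 ''u'' i = u i" "nats st5 ''i'' 0 = i" "nats st5 ''b'' 0 = b"
            using w i b by (simp_all add: env_vals[OF env] fr1 fr2 fr3 fr4 fr5 S1 del: mult_Suc mult_Suc_right)
          have p5: "nats st5 ''p'' 0 = ?p" and cells: "\<And>p. p < ?p \<Longrightarrow> nats st5 ''E'' p = cell w p"
            using 5(2) by auto
          \<comment> \<open>The abbreviations hide the products, so that the simplifier does not
            multiply them out.\<close>
          define P where "P = ?p"
          define S where "S = stride"
          define x where "x = nats st5 ''E'' (P - (S + width + w i))"
          have upd: "nats st5 ''E'' (P - S) = knapsack u w i b W"
            "cell w P = knapsack u w (Suc i) b W" "\<And>p. p < P \<Longrightarrow> nats st5 ''E'' p = cell w p"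
            "0 < b \<Longrightarrow> w i \<le> W \<Longrightarrow> x = knapsack u w i (b - 1) (W - w i)"
            using E0 cur cells E1 by (simp_all only: P_def S_def x_def)
          have "nats st5 ''st'' 0 = S" "nats st5 ''p'' 0 = P" using vals(1) p5 by (simp_all only: P_def S_def)
          note vals' = this vals(2-) \<open>nats st5 ''W'' 0 = W\<close>
          have x: "nats st5 ''E'' (P - Suc (S + n + w i)) = x" by (simp add: x_def)
          have I: "?p = P" "(i + 1) * stride + b * width + Suc W = Suc P" by (simp_all add: P_def)
          show ?case unfolding I
            by (intro wp_Seq wp_NAssign wp_If wp_Skip)
              (auto simp: vals' x upd less_Suc_eq max_def)
        next
          case (6 st')
          have "(i + 1) * stride + b * width + width = (i + 1) * stride + Suc b * width" by simp
          then show ?case using 6(1) b(2) by (simp add: same_outsideD[OF 6(2)] del: mult_Suc mult_Suc_right)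
        qed (use N_le in auto)
      next
        case (6 st')
        have "(i + 1) * stride + (k + 1) * width = (Suc i + 1) * stride" by simp
        then show ?case using 6(1) i(2) by (simp add: same_outsideD[OF 6(2)] del: mult_Suc mult_Suc_right)
      qed (use N_le in auto)
    next
      case (6 st')
      then show ?case using S2 by (simp add: same_outsideD[OF 6(2)] del: mult_Suc mult_Suc_right)
    qed (use N_le in auto)
  qed (use N_le in auto)
qed (use N_le in auto)

lemma wp_best_value:
  assumes env: "env st" and p: "nats st ''p'' 0 = (m + 1) * stride"
    and E: "\<And>p. p < (m + 1) * stride \<Longrightarrow> nats st ''E'' p = cell w p"
  shows "wp N best_value (\<lambda>st'. nats st' ''p'' 0 = m * stride + k * width \<and>
    (0 < nats st' ''bw'' 0 \<longrightarrow> nats st' ''bw'' 0 \<le> width \<and> n < knapsack u w m k (nats st' ''bw'' 0 - 1)) \<and>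
    (\<forall>W\<le>n. n < knapsack u w m k W \<longrightarrow> W < nats st' ''bw'' 0)) st"
  unfolding best_value_def
proof (intro wp_Seq wp_NAssign, rule wp_For_same[where b = width and
      I = "\<lambda>i st'. nats st' ''bw'' 0 \<le> i \<and>
        (0 < nats st' ''bw'' 0 \<longrightarrow> n < knapsack u w m k (nats st' ''bw'' 0 - 1)) \<and>
        (\<forall>W<i. n < knapsack u w m k W \<longrightarrow> W < nats st' ''bw'' 0)"], goal_cases)
  case (4 st')
  then show ?case by (simp add: env_vals[OF env] same_outsideD[OF 4])
next
  case (5 W st')
  note fr = same_outsideD[OF 5(4)]
  let ?p = "m * stride + k * width + W"
  have "nats st' ''p'' 0 = nats st ''p'' 0 - width" by (simp add: fr env_vals[OF env])
  also have "\<dots> = m * stride + k * width" unfolding p by simp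
  finally have pst: "nats st' ''p'' 0 = m * stride + k * width" .
  have "k * width + W < stride" using 5(1) by (intro cell_offset_less) auto
  then have "?p < (m + 1) * stride" by simp
  then have "nats st' ''E'' ?p = knapsack u w m k W"
    using E cell_eq[of k W w m] 5(1) by (simp add: fr del: mult_Suc mult_Suc_right)
  then have "nats st' ''E'' (nats st' ''p'' 0 + nats st' ''W'' 0) = knapsack u w m k W"
    by (simp only: pst 5(3))
  then show ?case using 5(1-3)
    by (intro wp_If wp_NAssign wp_Skip) (auto simp: fr env_vals[OF env] less_Suc_eq)
next
  case (6 st')
  note fr = same_outsideD[OF 6(2)]
  have "nats st' ''p'' 0 = nats st ''p'' 0 - width" by (simp add: fr env_vals[OF env])
  also have "\<dots> = m * stride + k * width" unfolding p by simp
  finally show ?case using 6(1) by (simp only: less_Suc_eq_le Suc_eq_plus1[symmetric]) auto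
qed (use N_le in auto)

text \<open>The items chosen so far and the parameters of the current cell always add up to
  \<open>k\<close>, \<open>W0\<close> and \<open>V0\<close>, and the current cell stays
  positive.\<close>

lemma wp_reconstruct:
  assumes env: "env st" and p: "nats st ''p'' 0 = m * stride + k * width" and s: "nats st ''st'' 0 = stride"
    and E: "\<And>p. p < (m + 1) * stride \<Longrightarrow> nats st ''E'' p = cell w p"
    and w: "\<And>i. i < m \<Longrightarrow> nats st ''w'' i = w i"
    and bw: "nats st ''bw'' 0 = Suc W0" "W0 \<le> n" "n < knapsack u w m k W0"
  shows "wp N reconstruct (\<lambda>st'. card (opened st') = k \<and> n \<le> sum u (opened st') \<and>
    sum w (opened st') = W0 \<and> nats st' ''by'' 0 = Suc W0 \<and>
    (\<forall>j<n. nats st' ''batt'' j = nats st ''att'' j)) st"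
proof -
  define V0 where "V0 = knapsack u w m k W0"
  define above where "above i st' = {i'. i \<le> i' \<and> i' < m \<and> 0 < nats st' ''open'' i'}" for i and st' :: state
  have fin: "finite (above i st')" for i st' by (simp add: above_def)
  have step_in: "above i (nupdate ''open'' i (Suc 0) st') = insert i (above (Suc i) st')"
    if "i < m" for i st'
    using that by (auto simp: above_def Suc_le_eq order_le_less)
  have step_out: "above i (nupdate ''open'' i 0 st') = above (Suc i) st'" if "i < m" for i st'
    using that by (auto simp: above_def Suc_le_eq order_le_less)
  have above_upd: "above i (nupdate x p v st') = above i st'" if "x \<noteq> ''open''" for i x p v st'
    using that by (simp add: above_def)
  have notin: "i \<notin> above (Suc i) st'" for i st' by (simp add: above_def)
  show ?thesis
    unfolding reconstruct_def
  proof (intro wp_Seq wp_NAssign, rule wp_For_same[where b = m and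
        I = "\<lambda>r st'. \<exists>q W. q \<le> k \<and> W \<le> n \<and> nats st' ''p'' 0 = (m - r) * stride + q * width + W \<and>
          0 < knapsack u w (m - r) q W \<and>
          card (above (m - r) st') + q = k \<and> sum w (above (m - r) st') + W = W0 \<and>
          sum u (above (m - r) st') + knapsack u w (m - r) q W = V0"], goal_cases)
    case 1
    have "above m st' = {}" for st' by (auto simp: above_def)
    then show ?case
      by - (rule exI[of _ k], rule exI[of _ W0],
        use p bw in \<open>simp add: V0_def del: mult_Suc mult_Suc_right\<close>)
  next
    case (4 st')
    then show ?case by (simp add: env_vals[OF env] same_outsideD[OF 4])
  next
    case (5 r st')
    note fr = same_outsideD[OF 5(4)]
    define i where "i = m - Suc r"
    have i: "i < m" "m - r = Suc i" using 5(1) by (auto simp: i_def)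
    obtain q W where q: "q \<le> k" "W \<le> n" and pst: "nats st' ''p'' 0 = Suc i * stride + q * width + W"
      and pos: "0 < knapsack u w (Suc i) q W"
      and A: "card (above (Suc i) st') + q = k" "sum w (above (Suc i) st') + W = W0"
        "sum u (above (Suc i) st') + knapsack u w (Suc i) q W = V0"
      using 5(2) unfolding i(2) by blast
    let ?p = "Suc i * stride + q * width + W"
    have "?p < (Suc i + 1) * stride" using cell_offset_less[OF q] by simp
    also have "\<dots> \<le> (m + 1) * stride" using i by (intro mult_right_mono) auto
    finally have lt: "?p < (m + 1) * stride" .
    have p0: "?p - stride = i * stride + q * width + W" by simp
    have fE: "nats st' ''E'' = nats st ''E''" by (simp add: fr)
    have E1: "nats st' ''E'' ?p = knapsack u w (Suc i) q W"
      using E[OF lt] cell_eq[OF q, of w "Suc i"] by (simp only: fE)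
    have "?p - stride < (m + 1) * stride" using lt by linarith
    from E[OF this] have E0: "nats st' ''E'' (?p - stride) = knapsack u w i q W"
      unfolding p0 using cell_eq[OF q, of w i] by (simp only: fE)
    have vals: "nats st' ''m'' 0 - (nats st' ''r'' 0 + 1) = i" "nats st' ''st'' 0 = stride"
      "nats st' ''n'' 0 = n" "nats st' ''w'' i = w i"
      using w i 5(3) by (simp_all add: fr env_vals[OF env] s i_def del: mult_Suc mult_Suc_right)
    define P where "P = ?p"
    define S where "S = stride"
    have E': "nats st' ''E'' P = knapsack u w (Suc i) q W" "nats st' ''E'' (P - S) = knapsack u w i q W"
      "nats st' ''p'' 0 = P" "nats st' ''st'' 0 = S"
      using E1 E0 pst vals(2) by (simp_all only: P_def S_def)
    show ?case
    proof (intro wp_Seq wp_NAssign wp_If, goal_cases)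
      case 1
      then have "knapsack u w i q W < knapsack u w (Suc i) q W" using vals(1) by (simp add: E')
      then have take: "0 < q" "w i \<le> W" "0 < knapsack u w i (q - 1) (W - w i)"
        "knapsack u w (Suc i) q W = knapsack u w i (q - 1) (W - w i) + u i"
        by (auto simp: max_def split: if_splits)
      obtain q' where q': "q = Suc q'" using take(1) by (cases q) auto
      have pt: "?p - (stride + width + w i) = i * stride + q' * width + (W - w i)"
        using take(2) by (simp add: q')
      have "P - (S + (n + 1) + w i) = i * stride + q' * width + (W - w i)"
        unfolding P_def S_def by (fact pt)
      then show ?case
        by - (rule exI[of _ q'], rule exI[of _ "W - w i"],
          use take q' q A i notin[of i st'] fin[of "Suc i" st'] vals(1) 5(1) in
          \<open>simp add: E' vals(3,4) above_upd step_in i_def[symmetric] del: mult_Suc mult_Suc_right knapsack.simps\<close>)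
    next
      case 2
      then have "\<not> knapsack u w i q W < knapsack u w (Suc i) q W" using vals(1) by (simp add: E')
      moreover have "knapsack u w i q W \<le> knapsack u w (Suc i) q W" by simp
      ultimately have eq: "knapsack u w (Suc i) q W = knapsack u w i q W" by linarith
      have "P - S = i * stride + q * width + W" unfolding P_def S_def by (fact p0)
      then show ?case
        by - (rule exI[of _ q], rule exI[of _ W],
          use eq q A i pos vals(1) 5(1) in
          \<open>simp add: E' vals(3,4) above_upd step_out i_def[symmetric] del: mult_Suc mult_Suc_right knapsack.simps\<close>)
    qed
  next
    case (6 st1)
    note fr1 = same_outsideD[OF 6(2)]
    obtain q W where q: "0 < knapsack u w 0 q W" "card (above 0 st1) + q = k"
      "sum w (above 0 st1) + W = W0" "sum u (above 0 st1) + knapsack u w 0 q W = V0"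
      using 6(1) by auto
    \<comment> \<open>In the layer without items only the cell for no items and weight 0 is
      positive. Its value 1 is the offset by which \<open>V0\<close> exceeds the capacity.\<close>
    have "q = 0" "W = 0" using q(1) by (simp_all split: if_splits)
    then have A: "card (above 0 st1) = k" "sum w (above 0 st1) = W0" "n \<le> sum u (above 0 st1)"
      using q bw(3) by (simp_all add: V0_def)
    have opened: "above 0 st' = opened st'" for st' by (simp add: above_def opened_def)
    show ?case
    proof (rule wp_For_same[where b = n and
          I = "\<lambda>j st'. \<forall>j'<j. nats st' ''batt'' j' = nats st ''att'' j'"], goal_cases)
      case (4 st')
      then show ?case by (simp add: env_vals[OF env] same_outsideD[OF 4] fr1)
    next
      case (5 j st')
      then show ?case by (intro wp_NAssign) (auto simp: same_outsideD[OF 5(4)] fr1 less_Suc_eq)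
    next
      case (6 st')
      have "opened st' = opened st1" by (simp add: opened_def same_outsideD[OF 6(2)])
      then show ?case using 6(1) A by (simp add: opened same_outsideD[OF 6(2)] fr1 bw(1))
    qed (use N_le in auto)
  qed (use N_le in auto)
qed

text \<open>By \<open>knapsack_ge\<close> a suitable set \<open>S\<close> leaves an entry above
  \<open>n\<close> at its own total load, and \<open>best_value\<close> returns a load at least as
  large.\<close>

lemma wp_knapsack_search:
  assumes env: "env st" and best: "best_ok st"
    and good: "\<And>t1 t2 att c. good \<Longrightarrow> greedy m m t1 t2 {..<m} att c 0 \<Longrightarrow>
        \<exists>S\<subseteq>{..<m}. card S = k \<and> n \<le> sum u S \<and> g \<le> (\<Sum>i\<in>S. load att i)"
  shows "wp N knapsack_search (\<lambda>st'. env st' \<and> best_ok st' \<and> nats st ''by'' 0 \<le> nats st' ''by'' 0 \<and>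
    (good \<longrightarrow> g < nats st' ''by'' 0)) st"
  unfolding knapsack_search_def
proof (intro wp_Seq wp_NAssign, goal_cases)
  case 1
  let ?st0 = "nupdate ''kk'' 0 m (nupdate ''s'' 0 m st)"
  have "env ?st0" using env by (simp add: env_def)
  moreover have "params m m (nats st ''t1'' 0) (nats st ''t2'' 0) ?st0" by (simp add: params_def)
  ultimately have run0: "wp N greedy_run (\<lambda>st'. run_state m m (nats st ''t1'' 0) (nats st ''t2'' 0) st' \<and>
    nats st' ''rem'' 0 = 0 \<and> card (selected st') = m) ?st0" by (rule wp_greedy_run) simp
  have eq: "nupdate ''kk'' (nval (NConst 0) (nupdate ''s'' (nval (NConst 0) st) (nval (V ''m'') st) st))
      (nval (V ''m'') (nupdate ''s'' (nval (NConst 0) st) (nval (V ''m'') st) st))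
      (nupdate ''s'' (nval (NConst 0) st) (nval (V ''m'') st) st) = ?st0"
    using env by (simp add: env_def)
  show ?case unfolding eq
  proof (rule wp_conseq[OF run0], goal_cases)
    case (1 st1)
    note fr1 = same_outsideD[OF 1(2)]
    let ?att = "nats st1 ''att''"
    let ?w = "load ?att"
    have run: "run_state m m (nats st ''t1'' 0) (nats st ''t2'' 0) st1" and rem: "nats st1 ''rem'' 0 = 0"
      and "card (selected st1) = m" using 1(1) by auto
    moreover have "selected st1 \<subseteq> {..<m}" by (auto simp: selected_def)
    ultimately have sel: "selected st1 = {..<m}" by (intro card_subset_eq) auto
    have g: "greedy m m (nats st ''t1'' 0) (nats st ''t2'' 0) {..<m} ?att (nats st1 ''cur'' 0) 0"
      using run unfolding run_state_def rem sel by blast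
    have env1: "env st1" using run by (simp add: run_state_def)
    note basic = greedy_basic[OF g]
    show ?case
    proof (rule wp_Seq, rule wp_conseq, rule wp_loads[OF env1], goal_cases)
      case (1 j)
      then show ?case using basic by simp
    next
      case (2 st2)
      note fr2 = same_outsideD[OF 2(2)]
      have env2: "env st2" using env1 2(2) by (rule env_same) auto
      have w2: "nats st2 ''w'' i = ?w i" if "i < m" for i using 2(1) that by simp
      show ?case
      proof (rule wp_Seq, rule wp_conseq[OF wp_fill_table[OF env2 w2]], assumption, goal_cases)
        case (1 st3)
        note fr3 = same_outsideD[OF 1(2)]
        have env3: "env st3" using env2 1(2) by (rule env_same) auto
        have E3: "nats st3 ''E'' p = cell ?w p" if "p < (m + 1) * stride" for p using 1(1) that by blast
        have p3: "nats st3 ''p'' 0 = (m + 1) * stride" and s3: "nats st3 ''st'' 0 = stride" using 1(1) by auto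
        show ?case
        proof (rule wp_Seq, rule wp_conseq[OF wp_best_value[OF env3 p3 E3]], assumption, goal_cases)
          case (1 st4)
          note fr4 = same_outsideD[OF 1(2)]
          have env4: "env st4" using env3 1(2) by (rule env_same) auto
          have old: "nats st4 x = nats st x" if "x \<in> {''by'', ''open'', ''batt''}" for x
            using that by (auto simp: fr1 fr2 fr3 fr4)
          have best4: "best_ok st4"
            using best by (simp add: best_ok_def kept_def opened_def old)
          have new: "g < nats st4 ''bw'' 0" if gd: good
          proof -
            obtain S where S: "S \<subseteq> {..<m}" "card S = k" "n \<le> sum u S" "g \<le> sum ?w S"
              using assms(3)[OF gd g] by blast
            have "finite S" using S finite_subset by blast
            \<comment> \<open>Loads count distinct clients, so the weight of \<open>S\<close> lies
              within the columns \<open>0\<close> to \<open>n\<close> of the table.\<close>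
            have "sum ?w S = card {j. j < n \<and> 0 < ?att j \<and> ?att j - 1 \<in> S}"
              using card_assigned[OF \<open>finite S\<close>] by simp
            also have "\<dots> \<le> card {..<n}" by (intro card_mono) auto
            finally have "sum ?w S \<le> n" by simp
            moreover have "n < knapsack u ?w m k (sum ?w S)"
              using knapsack_ge[OF S(1), of u ?w] S(2,3) by simp
            ultimately show ?thesis using 1(1) S(4) by fastforce
          qed
          show ?case
          proof (rule wp_If)
            assume b: "bval (V ''by'' [<] V ''bw'') st4"
            then obtain W0 where W0: "nats st4 ''bw'' 0 = Suc W0" by (cases "nats st4 ''bw'' 0") auto
            have W0': "W0 \<le> n" "n < knapsack u ?w m k W0" using 1(1) W0 by auto
            have p4: "nats st4 ''p'' 0 = m * stride + k * width" using 1(1) by blast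
            have s4: "nats st4 ''st'' 0 = stride" using s3 fr4[of "''st''"] by simp
            have E4: "nats st4 ''E'' p = cell ?w p" if "p < (m + 1) * stride" for p
              using E3[OF that] fr4[of "''E''"] by simp
            have w4: "nats st4 ''w'' i = ?w i" if "i < m" for i using w2[OF that] by (simp add: fr3 fr4)
            have att4: "nats st4 ''att'' = ?att" by (simp add: fr2 fr3 fr4)
            show "wp N reconstruct (\<lambda>st'. env st' \<and> best_ok st' \<and> nats st ''by'' 0 \<le> nats st' ''by'' 0 \<and>
              (good \<longrightarrow> g < nats st' ''by'' 0)) st4"
            proof (rule wp_conseq, rule wp_reconstruct[OF env4 p4 s4 E4 w4 W0 W0'], goal_cases)
              case (3 st5)
              let ?batt = "nats st5 ''batt''"
              have batt: "?batt j = ?att j" if "j < n" for j using 3(1) that by (simp add: att4)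
              have "{j. j < n \<and> 0 < ?batt j \<and> ?batt j - 1 \<in> opened st5} =
                {j. j < n \<and> 0 < ?att j \<and> ?att j - 1 \<in> opened st5}" using batt by auto
              then have "card {j. j < n \<and> 0 < ?batt j \<and> ?batt j - 1 \<in> opened st5} = W0"
                using card_assigned[of "opened st5" ?att] 3(1) by (simp add: opened_def)
              moreover have "load ?batt i \<le> u i" for i
                using basic load_cong[of ?batt ?att i] batt by simp
              moreover have "\<forall>j<n. 0 < ?batt j \<longrightarrow> ?batt j - 1 < m \<and> adj j (?batt j - 1)"
                using basic batt by auto
              ultimately have "kept st5" using 3(1) by (simp add: kept_def)
              moreover have "env st5" using env4 3(2) by (rule env_same) auto
              moreover have "nats st ''by'' 0 < Suc W0" using b W0 old[of "''by''"] by simp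
              ultimately show ?case using 3(1) new W0 by (simp add: best_ok_def)
            qed
          next
            assume "\<not> bval (V ''by'' [<] V ''bw'') st4"
            then have "nats st4 ''bw'' 0 \<le> nats st4 ''by'' 0" by simp
            then show "wp N Skip (\<lambda>st'. env st' \<and> best_ok st' \<and> nats st ''by'' 0 \<le> nats st' ''by'' 0 \<and>
              (good \<longrightarrow> g < nats st' ''by'' 0)) st4"
              using env4 best4 new old[of "''by''"] by (intro wp_Skip) auto
          qed
        qed
      qed
    qed
  qed
qed

end

section \<open>Approximation ratio and running time\<close>

lemma writes_finish [simp]: "writes finish = {''i'', ''ld'', ''j'', ''done'', ''h'', ''assign''}"
  by (auto simp: finish_def)

lemma writes_prepare [simp]: "writes prepare = {''p'', ''j'', ''i'', ''row'', ''adj''}"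
  by (auto simp: prepare_def)

lemma wp_prepare:
  assumes n: "nats st ''n'' 0 = n" "n \<le> N" and m: "nats st ''m'' 0 = m" "m \<le> N"
    and d: "reals st ''d'' = d"
  shows "wp N prepare (\<lambda>st'. \<exists>mn. (\<forall>p<n * m. mn \<le> d p) \<and> (0 < n * m \<longrightarrow> (\<exists>p<n * m. mn = d p)) \<and>
    (\<forall>j<n. nats st' ''row'' j = j * m) \<and> (\<forall>p<n * m. nats st' ''adj'' p = of_bool (d p \<le> mn))) st"
proof -
  have idx: "j * m + i < n * m" if "j < n" "i < m" for j i
  proof -
    have "j * m + i < Suc j * m" using that by simp
    also have "\<dots> \<le> n * m" using that by (intro mult_right_mono) auto
    finally show ?thesis .
  qed
  \<comment> \<open>Attainment refers to the whole matrix and not to the first \<open>p\<close>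
    entries, so that the initial value \<open>d 0\<close> qualifies before any entry is
    visited.\<close>
  define low where "low p x \<longleftrightarrow> (\<forall>p'<p. x \<le> d p') \<and> (0 < n * m \<longrightarrow> (\<exists>p<n * m. x = d p))" for p x
  have low_0: "low 0 (d 0)" by (auto simp: low_def intro!: exI[of _ 0])
  have low_step: "low (Suc p) (if d p < x then d p else x)" if "low p x" "p < n * m" for p x
    using that by (auto simp: low_def less_Suc_eq intro: order_trans less_imp_le)
  show ?thesis
    unfolding prepare_def
  proof (intro wp_Seq wp_NAssign wp_RAssign, rule wp_For_same[where b = n and
        I = "\<lambda>j st'. nats st' ''p'' 0 = j * m \<and> reals st' ''d'' = d \<and> low (j * m) (reals st' ''min'' 0)"], goal_cases)
    case 1
    then show ?case using d low_0 by simp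
  next
    case (4 st')
    then show ?case by (simp add: same_outsideD[OF 4] n)
  next
    case (5 j st1)
    note fr1 = same_outsideD[OF 5(4)]
    show ?case
    proof (rule wp_For_same[where b = m and
        I = "\<lambda>i st'. nats st' ''p'' 0 = j * m + i \<and> reals st' ''d'' = d \<and>
          low (j * m + i) (reals st' ''min'' 0)"], goal_cases)
      case 1
      then show ?case using 5(2) by simp
    next
      case (4 st')
      then show ?case by (simp add: same_outsideD[OF 4] fr1 m)
    next
      case (5 i st')
      then show ?case using low_step[of "j * m + i" "reals st' ''min'' 0"] idx[OF \<open>j < n\<close> \<open>i < m\<close>]
        by (intro wp_Seq wp_If wp_NAssign wp_RAssign wp_Skip) simp_all
    next
      case (6 st')
      then show ?case by (simp add: add.commute)
    qed (use m in auto)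
  next
    case (6 st1)
    note fr1 = same_outsideD[OF 6(2)]
    define mn where "mn = reals st1 ''min'' 0"
    have mn: "low (n * m) mn" "reals st1 ''d'' = d" using 6(1) by (simp_all add: mn_def)
    show ?case
    proof (intro wp_Seq wp_NAssign, rule wp_For_same[where b = n and
        I = "\<lambda>j st'. nats st' ''p'' 0 = j * m \<and> reals st' ''d'' = d \<and> reals st' ''min'' 0 = mn \<and>
          (\<forall>j'<j. nats st' ''row'' j' = j' * m) \<and>
          (\<forall>p<j * m. nats st' ''adj'' p = of_bool (d p \<le> mn))"], goal_cases)
      case 1
      then show ?case using mn by (simp add: mn_def)
    next
      case (4 st')
      then show ?case by (simp add: same_outsideD[OF 4] fr1 n)
    next
      case (5 j st2)
      note fr2 = same_outsideD[OF 5(4)]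
      show ?case
      proof (intro wp_Seq wp_NAssign, rule wp_For_same[where b = m and
          I = "\<lambda>i st'. nats st' ''p'' 0 = j * m + i \<and> reals st' ''d'' = d \<and> reals st' ''min'' 0 = mn \<and>
            (\<forall>j'<Suc j. nats st' ''row'' j' = j' * m) \<and>
            (\<forall>p<j * m + i. nats st' ''adj'' p = of_bool (d p \<le> mn))"], goal_cases)
        case 1
        then show ?case using 5(2,3) by (simp add: less_Suc_eq)
      next
        case (4 st')
        then show ?case by (simp add: same_outsideD[OF 4] fr1 fr2 m)
      next
        case (5 i st')
        then show ?case
          by (intro wp_Seq wp_If wp_NAssign wp_RAssign wp_Skip) (simp_all add: less_Suc_eq)
      next
        case (6 st')
        then show ?case by (simp add: add.commute)
      qed (use m in auto)
    next
      case (6 st')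
      then show ?case using mn(1) by (intro exI[of _ mn]) (simp add: low_def)
    qed (use n in auto)
  qed (use n in auto)
qed

section \<open>Completing a candidate to an assignment, and the guarantees of both searches\<close>

context program_run
begin

definition output_ok :: "nat \<Rightarrow> state \<Rightarrow> bool" where
  "output_ok g st \<longleftrightarrow> card (opened st) = k \<and> (\<forall>j<n. nats st ''assign'' j \<in> opened st) \<and>
     (\<forall>i\<in>opened st. card {j. j < n \<and> nats st ''assign'' j = i} \<le> u i) \<and>
     g \<le> card {j. j < n \<and> adj j (nats st ''assign'' j)}"

text \<open>Clients covered by an open facility keep it, which accounts for \<open>g\<close>
  adjacent ones. For any other client \<open>j\<close> some open facility has room: the open
  capacity is at least \<open>n\<close>, and at most \<open>n - 1\<close> clients are assigned while
  \<open>j\<close> is not.\<close>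

lemma wp_finish:
  assumes env: "env st" and kept: "kept st" and g: "g < nats st ''by'' 0"
  shows "wp N finish (output_ok g) st"
proof -
  let ?O = "opened st" and ?b = "nats st ''batt''"
  define P where "P j \<longleftrightarrow> 0 < ?b j \<and> ?b j - 1 \<in> ?O" for j
  have O: "card ?O = k" "n \<le> sum u ?O" "finite ?O" using kept by (auto simp: kept_def opened_def)
  have b: "?b j - 1 < m" "adj j (?b j - 1)" if "j < n" "0 < ?b j" for j
    using kept that by (auto simp: kept_def)
  have bl: "load ?b i \<le> u i" for i using kept by (simp add: kept_def)
  have cP: "g \<le> card {j. j < n \<and> P j}" using kept g by (simp add: kept_def P_def)
  have Pj: "P j \<longleftrightarrow> 0 < ?b j \<and> 0 < nats st ''open'' (?b j - Suc 0)" if "j < n" for j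
    using b that by (auto simp: P_def opened_def)
  show ?thesis
    unfolding finish_def
  proof (rule wp_Seq, rule wp_For_same[where b = m and I = "\<lambda>i st'. \<forall>i'<i. nats st' ''ld'' i' = 0"], goal_cases)
    case (4 st')
    then show ?case by (simp add: env_vals[OF env] same_outsideD[OF 4])
  next
    case (5 i st')
    then show ?case by (intro wp_NAssign) (auto simp: less_Suc_eq)
  next
    case (6 st1)
    note fr1 = same_outsideD[OF 6(2)]
    show ?case
    proof (rule wp_Seq, rule wp_For_same[where b = n and
          I = "\<lambda>j st'. (\<forall>j'<j. 0 < nats st' ''done'' j' \<longleftrightarrow> P j') \<and>
            (\<forall>j'<j. P j' \<longrightarrow> nats st' ''assign'' j' = ?b j' - 1) \<and>
            (\<forall>i<m. nats st' ''ld'' i = card {j'. j' < j \<and> P j' \<and> ?b j' = Suc i})"], goal_cases)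
      case 1
      then show ?case using 6(1) by simp
    next
      case (4 st')
      then show ?case by (simp add: env_vals[OF env] same_outsideD[OF 4] fr1)
    next
      case (5 j st')
      note fr = same_outsideD[OF 5(4)]
      have "{j'. j' < Suc j \<and> P j' \<and> ?b j' = Suc i} = (if P j \<and> ?b j = Suc i
          then insert j {j'. j' < j \<and> P j' \<and> ?b j' = Suc i} else {j'. j' < j \<and> P j' \<and> ?b j' = Suc i})" for i
        by (auto simp: less_Suc_eq)
      then have c: "card {j'. j' < Suc j \<and> P j' \<and> ?b j' = Suc i} =
          card {j'. j' < j \<and> P j' \<and> ?b j' = Suc i} + of_bool (P j \<and> ?b j = Suc i)" for i
        by simp
      show ?case
      proof (intro wp_Seq wp_If wp_NAssign wp_Skip, goal_cases)
        case 1
        then have p: "P j" using Pj[OF 5(1)] 5(3) by (simp add: fr fr1)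
        then obtain h where h: "?b j = Suc h" using gr0_implies_Suc unfolding P_def by blast
        moreover have "h < m" using b(1)[OF 5(1)] h by simp
        ultimately show ?case using 5(1-3) p by (simp add: fr fr1 c All_less_Suc)
      next
        case 2
        then have "\<not> P j" using Pj[OF 5(1)] 5(3) by (simp add: fr fr1)
        then show ?case using 5(1-3) by (simp add: fr fr1 c All_less_Suc)
      qed
    next
      case (6 st2)
      note fr2 = same_outsideD[OF 6(2)]
      have ld2: "nats st2 ''ld'' i \<le> u i" if "i < m" for i
      proof -
        have "nats st2 ''ld'' i \<le> load ?b i"
          using 6(1) that by (auto simp: load_def intro!: card_mono)
        then show ?thesis using bl order_trans by blast
      qed
      show ?case
      proof (rule wp_For_same[where b = n and
            I = "\<lambda>j st'. (\<forall>j'<n. P j' \<longrightarrow> nats st' ''assign'' j' = ?b j' - 1) \<and>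
              (\<forall>j'<n. P j' \<or> j' < j \<longrightarrow> nats st' ''assign'' j' \<in> ?O) \<and>
              (\<forall>i<m. nats st' ''ld'' i = card {j'. j' < n \<and> (P j' \<or> j' < j) \<and> nats st' ''assign'' j' = i}) \<and>
              (\<forall>i<m. nats st' ''ld'' i \<le> u i)"], goal_cases)
        case 1
        have "{j'. j' < n \<and> P j' \<and> nats st2 ''assign'' j' = i} = {j'. j' < n \<and> P j' \<and> ?b j' = Suc i}" for i
          using 6(1) by (force simp: P_def)
        then show ?case using 6(1) ld2 by (auto simp: P_def)
      next
        case (4 st')
        then show ?case by (simp add: env_vals[OF env] same_outsideD[OF 4] fr1 fr2)
      next
        case (5 j st3)
        note fr3 = same_outsideD[OF 5(4)]
        have marked: "0 < nats st3 ''done'' j \<longleftrightarrow> P j" using 6(1) 5(1) by (simp add: fr3)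
        show ?case
        proof (rule wp_If)
          assume "bval (NConst 0 [<] ''done'' $$ V ''j'') st3"
          then have p: "P j" using marked 5(3) by simp
          then have iff: "P j' \<or> j' < Suc j \<longleftrightarrow> P j' \<or> j' < j" for j' by (auto simp: less_Suc_eq)
          have same: "nats (nupdate ''j'' 0 (Suc j) st3) ''assign'' = nats st3 ''assign''"
            "nats (nupdate ''j'' 0 (Suc j) st3) ''ld'' = nats st3 ''ld''" by simp_all
          show "wp N Skip (\<lambda>s'. (\<forall>j'<n. P j' \<longrightarrow> nats (nupdate ''j'' 0 (Suc j) s') ''assign'' j' = ?b j' - 1) \<and>
              (\<forall>j'<n. P j' \<or> j' < Suc j \<longrightarrow> nats (nupdate ''j'' 0 (Suc j) s') ''assign'' j' \<in> ?O) \<and>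
              (\<forall>i<m. nats (nupdate ''j'' 0 (Suc j) s') ''ld'' i =
                card {j'. j' < n \<and> (P j' \<or> j' < Suc j) \<and> nats (nupdate ''j'' 0 (Suc j) s') ''assign'' j' = i}) \<and>
              (\<forall>i<m. nats (nupdate ''j'' 0 (Suc j) s') ''ld'' i \<le> u i)) st3"
            by (rule wp_Skip) (use 5(2) in \<open>simp only: iff same\<close>)
        next
          assume "\<not> bval (NConst 0 [<] ''done'' $$ V ''j'') st3"
          then have nP: "\<not> P j" using marked 5(3) by simp
          let ?ld = "nats st3 ''ld''" and ?as = "nats st3 ''assign''"
          define X where "X i = {j'. j' < n \<and> (P j' \<or> j' < j) \<and> ?as j' = i}" for i
          have ld: "?ld i = card (X i)" if "i < m" for i using 5(2) that by (simp add: X_def)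
          have "\<exists>i\<in>?O. ?ld i < u i"
          proof (rule ccontr)
            assume "\<not> ?thesis"
            then have "sum u ?O \<le> sum ?ld ?O" by (intro sum_mono) (auto simp: not_less)
            also have "\<dots> = (\<Sum>i\<in>?O. card (X i))" using ld by (intro sum.cong) (auto simp: opened_def)
            also have "\<dots> = card (\<Union>i\<in>?O. X i)"
              using O by (intro card_UN_disjoint[symmetric]) (auto simp: X_def)
            also have "\<dots> \<le> card ({..<n} - {j})" using nP by (intro card_mono) (auto simp: X_def)
            also have "\<dots> < n" using 5(1) by simp
            finally show False using O by simp
          qed
          then obtain i0 where i0: "i0 < m" "i0 \<in> ?O" "?ld i0 < u i0" by (auto simp: opened_def)
          show "wp N (For ''i'' (V ''m'') (If (NConst 0 [<] ''open'' $$ V ''i'' [&] ''ld'' $$ V ''i'' [<] ''u'' $$ V ''i'')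
                (''h'' ::= V ''i'') Skip) ;;
              NAssign ''assign'' (V ''j'') (V ''h'') ;;
              NAssign ''ld'' (V ''h'') (''ld'' $$ V ''h'' [+] NConst 1))
            (\<lambda>s'. (\<forall>j'<n. P j' \<longrightarrow> nats (nupdate ''j'' 0 (Suc j) s') ''assign'' j' = ?b j' - 1) \<and>
              (\<forall>j'<n. P j' \<or> j' < Suc j \<longrightarrow> nats (nupdate ''j'' 0 (Suc j) s') ''assign'' j' \<in> ?O) \<and>
              (\<forall>i<m. nats (nupdate ''j'' 0 (Suc j) s') ''ld'' i =
                card {j'. j' < n \<and> (P j' \<or> j' < Suc j) \<and> nats (nupdate ''j'' 0 (Suc j) s') ''assign'' j' = i}) \<and>
              (\<forall>i<m. nats (nupdate ''j'' 0 (Suc j) s') ''ld'' i \<le> u i)) st3"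
          proof (rule wp_Seq, rule wp_For_same[where b = m and
                I = "\<lambda>i st'. (\<exists>i'<i. i' \<in> ?O \<and> ?ld i' < u i') \<longrightarrow>
                  nats st' ''h'' 0 < m \<and> nats st' ''h'' 0 \<in> ?O \<and> ?ld (nats st' ''h'' 0) < u (nats st' ''h'' 0)"], goal_cases)
            case (4 st')
            then show ?case by (simp add: env_vals[OF env] same_outsideD[OF 4] fr1 fr2 fr3)
          next
            case (5 i st')
            have "0 < nats st ''open'' i \<longleftrightarrow> i \<in> ?O" using 5(1) by (simp add: opened_def)
            then show ?case using 5(1-3)
              by (intro wp_If wp_NAssign wp_Skip)
                (auto simp: env_vals[OF env] same_outsideD[OF 5(4)] fr1 fr2 fr3 less_Suc_eq)
          next
            case (6 st4)
            note fr4 = same_outsideD[OF 6(2)]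
            let ?h = "nats st4 ''h'' 0"
            have h: "?h < m" "?h \<in> ?O" "?ld ?h < u ?h" using 6(1) i0 by auto
            define as where "as = ?as(j := ?h)"
            define ld' where "ld' = ?ld(?h := ?ld ?h + 1)"
            have "{j'. j' < n \<and> (P j' \<or> j' < Suc j) \<and> as j' = i} = (if ?h = i then insert j (X i) else X i)" for i
              using \<open>j < n\<close> nP by (auto simp: X_def as_def less_Suc_eq)
            moreover have "j \<notin> X i" "finite (X i)" for i using nP by (auto simp: X_def)
            ultimately have card: "card {j'. j' < n \<and> (P j' \<or> j' < Suc j) \<and> as j' = i} =
                card (X i) + of_bool (?h = i)" for i
              by simp
            have "\<forall>j'<n. P j' \<longrightarrow> as j' = ?b j' - 1" using 5(2) nP by (auto simp: as_def)
            moreover have "\<forall>j'<n. P j' \<or> j' < Suc j \<longrightarrow> as j' \<in> ?O"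
            proof (intro allI impI)
              fix j'
              assume "j' < n" "P j' \<or> j' < Suc j"
              then show "as j' \<in> ?O" using 5(2) h(2) by (cases "j' = j") (auto simp: as_def less_Suc_eq)
            qed
            moreover have "\<forall>i<m. ld' i = card {j'. j' < n \<and> (P j' \<or> j' < Suc j) \<and> as j' = i}"
              unfolding card using ld by (auto simp: ld'_def)
            moreover have "\<forall>i<m. ?ld i \<le> u i" using 5(2) by blast
            then have "\<forall>i<m. ld' i \<le> u i" using h(3) by (simp add: ld'_def)
            moreover have "nats st4 ''assign'' = ?as" "nats st4 ''ld'' = ?ld" "nats st4 ''j'' 0 = j"
              using 5(3) by (simp_all add: fr4)
            ultimately show ?case
              by (intro wp_Seq wp_NAssign) (simp add: as_def[symmetric] ld'_def[symmetric, simplified])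
          qed (use N_le in auto)
        qed
      next
        case (6 st3)
        note fr3 = same_outsideD[OF 6(2)]
        have o: "opened st3 = ?O" by (simp add: opened_def fr1 fr2 fr3)
        have "{j. j < n \<and> P j} \<subseteq> {j. j < n \<and> adj j (nats st3 ''assign'' j)}"
          using 6(1) b by (auto simp: P_def)
        then have "card {j. j < n \<and> P j} \<le> card {j. j < n \<and> adj j (nats st3 ''assign'' j)}"
          by (intro card_mono) auto
        then have "g \<le> card {j. j < n \<and> adj j (nats st3 ''assign'' j)}" using cP by linarith
        moreover have "card {j. j < n \<and> nats st3 ''assign'' j = i} \<le> u i" if "i \<in> ?O" for i
        proof -
          have i: "i < m" using that by (simp add: opened_def)
          have "{j. j < n \<and> (P j \<or> j < n) \<and> nats st3 ''assign'' j = i} = {j. j < n \<and> nats st3 ''assign'' j = i}"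
            by auto
          then have "nats st3 ''ld'' i = card {j. j < n \<and> nats st3 ''assign'' j = i}" using 6(1) i by simp
          then show ?thesis using 6(1) i by metis
        qed
        ultimately show ?case using 6(1) O by (simp add: output_ok_def o)
      qed (use N_le in auto)
    qed (use N_le in auto)
  qed (use N_le in auto)
qed

text \<open>\<open>greedy\<close> leaves ties open, so the guarantee has to hold for all its runs.
  The first disjunct is what \<open>threshold_search\<close> can achieve, the second one belongs to
  \<open>knapsack_search\<close>.\<close>

definition reachable :: "nat \<Rightarrow> bool" where
  "reachable g \<longleftrightarrow>
     (\<exists>a1\<le>n. \<exists>a2\<le>n. \<forall>A att c. greedy k (k div 4) a1 a2 A att c 0 \<longrightarrow> card A = k \<longrightarrow>
        n \<le> sum u A \<and> g \<le> covered att) \<or>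
     (\<forall>t1 t2 att c. greedy m m t1 t2 {..<m} att c 0 \<longrightarrow>
        (\<exists>S\<subseteq>{..<m}. card S = k \<and> n \<le> sum u S \<and> g \<le> (\<Sum>i\<in>S. load att i)))"

lemma wp_search:
  assumes env: "env st"
  shows "wp N (threshold_search ;; knapsack_search ;; If (NConst 0 [<] V ''by'') finish Skip)
    (\<lambda>st'. reachable g \<longrightarrow> output_ok g st') st"
proof -
  define P where "P a1 a2 \<longleftrightarrow> a1 \<le> n \<and> a2 \<le> n \<and>
    (\<forall>A att c. greedy k (k div 4) a1 a2 A att c 0 \<longrightarrow> card A = k \<longrightarrow> n \<le> sum u A \<and> g \<le> covered att)" for a1 a2
  define good1 where "good1 \<longleftrightarrow> (\<exists>a1 a2. P a1 a2)"
  define good2 where "good2 \<longleftrightarrow> (\<forall>t1 t2 att c. greedy m m t1 t2 {..<m} att c 0 \<longrightarrow>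
        (\<exists>S\<subseteq>{..<m}. card S = k \<and> n \<le> sum u S \<and> g \<le> (\<Sum>i\<in>S. load att i)))"
  have r: "reachable g \<longleftrightarrow> good1 \<or> good2" unfolding reachable_def good1_def good2_def P_def by blast
  obtain a1 a2 where a: "good1 \<Longrightarrow> P a1 a2" unfolding good1_def by blast
  show ?thesis
  proof (rule wp_Seq, rule wp_conseq, rule wp_threshold_search[where good = good1 and ?a1.0 = a1 and ?a2.0 = a2 and g = g, OF env], goal_cases)
    case (4 st1)
    have k2: "wp N knapsack_search (\<lambda>st'. env st' \<and> best_ok st' \<and> nats st1 ''by'' 0 \<le> nats st' ''by'' 0 \<and>
      (good2 \<longrightarrow> g < nats st' ''by'' 0)) st1"
    proof (rule wp_knapsack_search)
      show "env st1" "best_ok st1" using 4(1) by auto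
    qed (unfold good2_def, blast)
    show ?case
    proof (rule wp_Seq, rule wp_conseq[OF k2], rule wp_If, goal_cases)
      case (1 st2)
      then have k: "kept st2" by (auto simp: best_ok_def)
      show ?case
      proof (cases "reachable g")
        case True
        then have "g < nats st2 ''by'' 0" using 1(1) 4(1) r by auto
        then show ?thesis using wp_finish[of st2 g] k 1(1) by (auto elim: wp_conseq)
      next
        case False
        have "0 < nats st2 ''by'' 0" using 1(3) by simp
        then have "wp N finish (output_ok 0) st2" using wp_finish k 1(1) by blast
        then show ?thesis by (rule wp_conseq) (use False in simp)
      qed
    next
      case (2 st2)
      then have "\<not> reachable g" using 4(1) r by auto
      then show ?case by (intro wp_Skip) simp
    qed
  next
    case (3 A att c)
    then show ?case using a unfolding P_def by blast
  qed (use a in \<open>simp_all add: P_def\<close>)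
qed

text \<open>Sorting \<open>F\<close> by decreasing load gives a \<open>ranked_solution\<close>. The
  bound is the ceiling of \<open>(4 * f - n) / 8\<close> for \<open>f\<close> adjacent clients, with
  a negative numerator cut off at 0.\<close>

lemma reachable_ranked:
  assumes F: "F \<subseteq> {..<m}" "card F = k" and \<sigma>: "\<And>j. j < n \<Longrightarrow> \<sigma> j \<in> F"
    and cap: "\<And>i. i \<in> F \<Longrightarrow> card {j. j < n \<and> \<sigma> j = i} \<le> u i"
  shows "reachable ((4 * card {j. j < n \<and> adj j (\<sigma> j)} - n + 7) div 8)"
proof -
  have fin: "finite F" using F finite_subset by blast
  define L where "L i = card {j. j < n \<and> \<sigma> j = i}" for i
  define xs where "xs = rev (sort_key L (sorted_list_of_set F))"
  define f where "f r = xs ! r" for r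
  define D where "D r = {j. j < n \<and> adj j (\<sigma> j) \<and> \<sigma> j = f r}" for r
  define s where "s = k div 4"
  \<comment> \<open>A rank beyond the solution imposes no condition; the default 0 only has to be
    one of the values that the program tries.\<close>
  define t1 where "t1 = (if s < k then L (f s) else 0)"
  define t2 where "t2 = (if 2 * s + 1 < k then L (f (2 * s + 1)) else 0)"
  have xs: "distinct xs" "set xs = F" "length xs = k"
    using fin F by (auto simp: xs_def)
  have inj: "inj_on f {..<k}" using xs by (auto simp: f_def inj_on_def nth_eq_iff_index_eq)
  have img: "f ` {..<k} = F" using xs by (auto simp: f_def set_conv_nth)
  have fF: "f r \<in> F" if "r < k" for r using img that by auto
  have "sorted (map L (rev xs))" by (simp add: xs_def)
  then have mono: "L (f r') \<le> L (f r)" if "r \<le> r'" "r' < k" for r r'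
    using that xs(3) sorted_nth_mono[of "map L (rev xs)" "k - Suc r'" "k - Suc r"]
    by (simp add: f_def rev_nth)
  have sum_f: "(\<Sum>r<k. h (f r)) = sum h F" for h :: "nat \<Rightarrow> nat"
    using sum.reindex[OF inj, of h] img by simp
  have part: "(\<Sum>i\<in>F. card {j. j < n \<and> Q j \<and> \<sigma> j = i}) = card {j. j < n \<and> Q j}" for Q
  proof -
    have "{j. j < n \<and> Q j} = (\<Union>i\<in>F. {j. j < n \<and> Q j \<and> \<sigma> j = i})" using \<sigma> by auto
    also have "card \<dots> = (\<Sum>i\<in>F. card {j. j < n \<and> Q j \<and> \<sigma> j = i})"
      using fin by (intro card_UN_disjoint) auto
    finally show ?thesis by simp
  qed
  have L_le: "L i \<le> n" for i
    using card_mono[of "{..<n}" "{j. j < n \<and> \<sigma> j = i}"] by (auto simp: L_def)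
  interpret ranked_solution n m u adj k s t1 t2 f "\<lambda>r. L (f r)" D
  proof
    show "inj_on f {..<k}" by (fact inj)
    show "f r < m" if "r < k" for r using fF[OF that] F by auto
    show "L (f r) \<le> u (f r)" if "r < k" for r using fF[OF that] cap by (simp add: L_def)
    show "L (f r') \<le> L (f r)" if "r \<le> r'" "r' < k" for r r' using that by (rule mono)
    show "(\<Sum>r<k. L (f r)) = n" using part[of "\<lambda>_. True"] sum_f[of L] by (simp add: L_def)
    show "j < n \<and> adj j (f r)" if "r < k" "j \<in> D r" for r j using that by (auto simp: D_def)
    show "card (D r) \<le> L (f r)" for r unfolding D_def L_def by (intro card_mono) auto
    show "D r \<inter> D r' = {}" if "r < k" "r' < k" "r \<noteq> r'" for r r'
      using that inj by (auto simp: D_def inj_on_def)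
    show "k \<le> 4 * s + 3" "4 * s \<le> k" by (simp_all add: s_def)
    show "s < k \<Longrightarrow> t1 = L (f s)" "2 * s + 1 < k \<Longrightarrow> t2 = L (f (2 * s + 1))"
      by (simp_all add: t1_def t2_def)
  qed
  have sum_D: "(\<Sum>r<k. card (D r)) = card {j. j < n \<and> adj j (\<sigma> j)}"
    using part[of "\<lambda>j. adj j (\<sigma> j)"] sum_f[of "\<lambda>i. card {j. j < n \<and> adj j (\<sigma> j) \<and> \<sigma> j = i}"]
    by (simp add: D_def)
  have "n \<le> sum u A \<and> (4 * card {j. j < n \<and> adj j (\<sigma> j)} - n + 7) div 8 \<le> covered att"
    if "greedy k s t1 t2 A att c 0" "card A = k" for A att c
    using greedy_covers[OF that] sum_D by simp
  moreover have "t1 \<le> n" "t2 \<le> n" using L_le by (simp_all add: t1_def t2_def)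
  ultimately show ?thesis unfolding reachable_def s_def[symmetric] by blast
qed

text \<open>Once all facilities are picked, nothing remains or is pending, so the potentials in
  \<open>greedy_by_capacity\<close> vanish and the loads of \<open>S\<close> alone bound the
  adjacent clients.\<close>

lemma reachable_bicliques:
  assumes bi: "bicliques n m adj"
    and F: "F \<subseteq> {..<m}" "card F = k" and \<sigma>: "\<And>j. j < n \<Longrightarrow> \<sigma> j \<in> F"
    and cap: "\<And>i. i \<in> F \<Longrightarrow> card {j. j < n \<and> \<sigma> j = i} \<le> u i"
  shows "reachable (card {j. j < n \<and> adj j (\<sigma> j)})"
proof -
  interpret bicliques n m u adj by (fact bi)
  have fin: "finite F" using F finite_subset by blast
  have "n = card (\<Union>i\<in>F. {j. j < n \<and> \<sigma> j = i})"
  proof -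
    have "(\<Union>i\<in>F. {j. j < n \<and> \<sigma> j = i}) = {..<n}" using \<sigma> by auto
    then show ?thesis by simp
  qed
  also have "\<dots> \<le> (\<Sum>i\<in>F. card {j. j < n \<and> \<sigma> j = i})" using fin by (rule card_UN_le)
  also have "\<dots> \<le> sum u F" using cap by (rule sum_mono)
  finally have n: "n \<le> sum u F" .
  have "\<exists>S\<subseteq>{..<m}. card S = k \<and> n \<le> sum u S \<and>
    card {j. j < n \<and> adj j (\<sigma> j)} \<le> (\<Sum>i\<in>S. load att i)"
    if g: "greedy m m t1 t2 {..<m} att c 0" for t1 t2 att c
  proof -
    obtain S where S: "S \<subseteq> {..<m}" "card S = card F" "sum u F \<le> sum u S"
      "card {j. j < n \<and> adj j (\<sigma> j)} \<le> (\<Sum>i\<in>S \<inter> {..<m}. load att i) +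
        (\<Sum>N\<in>nbrs ` {..<m}. potential S {..<m} att c 0 N)"
      using greedy_by_capacity[OF g le_refl F(1) \<sigma> cap] by blast
    have "{i. i \<in> S - {..<m} \<and> nbrs i = N} = {}" for N using S(1) by auto
    then have "potential S {..<m} att c 0 N = 0" for N by (simp only: potential_def remaining_def) simp
    moreover have "S \<inter> {..<m} = S" using S(1) by auto
    ultimately show ?thesis using S F n by (intro exI[of _ S]) auto
  qed
  then show ?thesis unfolding reachable_def by blast
qed

end

text \<open>\<open>d\<close> has no distances between two clients or two facilities, so the triangle
  inequality is applied in the extension \<open>D\<close>, along the path from \<open>j\<close> over
  \<open>i'\<close> and \<open>j'\<close> to \<open>i\<close>.\<close>

lemma metric_distance_three_hops:
  assumes "metric_distance C F d" "j \<in> C" "j' \<in> C" "i \<in> F" "i' \<in> F"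
  shows "d j i \<le> d j i' + d j' i' + d j' i"
proof -
  obtain D where D: "pseudometric_on (C <+> F) D" "\<And>j i. j \<in> C \<Longrightarrow> i \<in> F \<Longrightarrow> D (Inl j) (Inr i) = d j i"
    using assms(1) unfolding metric_distance_def by blast
  have X: "Inl j \<in> C <+> F" "Inl j' \<in> C <+> F" "Inr i \<in> C <+> F" "Inr i' \<in> C <+> F" using assms by auto
  have "D (Inl j) (Inr i) \<le> D (Inl j) (Inr i') + D (Inr i') (Inr i)"
    "D (Inr i') (Inr i) \<le> D (Inr i') (Inl j') + D (Inl j') (Inr i)"
    "D (Inr i') (Inl j') = D (Inl j') (Inr i')"
    using D(1) X unfolding pseudometric_on_def by blast+
  then show ?thesis using D(2) assms by simp
qed

section \<open>From adjacency back to distances\<close>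

definition near :: "(nat, nat) ckm \<Rightarrow> real \<Rightarrow> nat \<Rightarrow> nat \<Rightarrow> bool" where
  "near I x j i \<longleftrightarrow> distance I j i \<le> x"

definition nearest :: "(nat, nat) ckm \<Rightarrow> real \<Rightarrow> bool" where
  "nearest I x \<longleftrightarrow> (\<forall>j<card (clients I). \<forall>i<card (facilities I). x \<le> distance I j i) \<and>
     (0 < card (clients I) \<longrightarrow> 0 < card (facilities I) \<longrightarrow>
       (\<exists>j<card (clients I). \<exists>i<card (facilities I). x = distance I j i))"

text \<open>The smallest distance \<open>x\<close> becomes known only during the run, hence the
  guarantee \<open>g\<close> is a function of it. No property of \<open>I\<close> is assumed, so
  termination and the step bound follow for every input.\<close>

lemma wp_main_program:
  fixes I :: "(nat, nat) ckm"
  defines "n \<equiv> card (clients I)" and "m \<equiv> card (facilities I)" and "k \<equiv> num_open I"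
  shows "wp (2 * input_size I + 1) main_program (\<lambda>s. k \<le> m \<longrightarrow> (\<exists>x. nearest I x \<and>
    (program_run.reachable n m (capacity I) (near I x) k (g x) \<longrightarrow>
     program_run.output_ok n m (capacity I) (near I x) k (g x) s))) (encode I)"
  unfolding main_program_def
proof (rule wp_If, goal_cases)
  let ?N = "2 * input_size I + 1" and ?st = "encode I"
  define d where "d = reals ?st ''d''"
  have N: "2 * n + 1 \<le> ?N" "2 * m + 1 \<le> ?N" by (simp_all add: input_size_def n_def m_def)
  have st: "nats ?st ''n'' 0 = n" "nats ?st ''m'' 0 = m" "nats ?st ''k'' 0 = k"
    "\<And>i. i < m \<Longrightarrow> nats ?st ''u'' i = capacity I i"
    by (simp_all add: encode_def Let_def n_def m_def k_def)
  have d: "d p = distance I (p div m) (p mod m)" if "p < n * m" for p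
    using that by (simp add: d_def encode_def Let_def n_def m_def)
  {
    case 1
    then show ?case using st by (intro wp_Skip) simp
  next
    case 2
    then have k: "k \<le> m" using st by simp
    have prep: "wp ?N prepare (\<lambda>st'. \<exists>x. (\<forall>p<n * m. x \<le> d p) \<and> (0 < n * m \<longrightarrow> (\<exists>p<n * m. x = d p)) \<and>
      (\<forall>j<n. nats st' ''row'' j = j * m) \<and> (\<forall>p<n * m. nats st' ''adj'' p = of_bool (d p \<le> x))) ?st"
      using N st by (intro wp_prepare) (auto simp: d_def)
    show ?case
    proof (rule wp_Seq, rule wp_conseq[OF prep], goal_cases)
      case (1 st1)
      from 1(1) obtain x where X: "(\<forall>p<n * m. x \<le> d p) \<and> (0 < n * m \<longrightarrow> (\<exists>p<n * m. x = d p)) \<and>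
        (\<forall>j<n. nats st1 ''row'' j = j * m) \<and> (\<forall>p<n * m. nats st1 ''adj'' p = of_bool (d p \<le> x))"
        by (elim exE)
      then have x: "x \<le> d p" "nats st1 ''adj'' p = of_bool (d p \<le> x)" if "p < n * m" for p
        using that by simp_all
      have row: "nats st1 ''row'' j = j * m" if "j < n" for j using X that by simp
      have ex: "\<exists>p<n * m. x = d p" if "0 < n * m" using X that by simp
      have idx: "j * m + i < n * m" "d (j * m + i) = distance I j i" if "j < n" "i < m" for j i
      proof -
        have "j * m + i < Suc j * m" using that by simp
        also have "\<dots> \<le> n * m" using that by (intro mult_right_mono) auto
        finally show "j * m + i < n * m" .
        from d[OF this] show "d (j * m + i) = distance I j i" using that by simp
      qed
      interpret program_run n m "capacity I" "near I x" ?N k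
        using N k by unfold_locales
      have "env st1"
        using st x row idx same_outsideD[OF 1(2)] by (simp add: env_def near_def)
      have near: "nearest I x"
        unfolding nearest_def n_def[symmetric] m_def[symmetric]
      proof (intro conjI allI impI)
        show "x \<le> distance I j i" if "j < n" "i < m" for j i using x(1) idx that by metis
        assume "0 < n" "0 < m"
        then obtain p where p: "p < n * m" "x = d p" using ex by auto
        have "p div m < n" using p by (simp add: less_mult_imp_div_less)
        moreover have "p mod m < m" using \<open>0 < m\<close> by simp
        ultimately show "\<exists>j<n. \<exists>i<m. x = distance I j i" using p d by blast
      qed
      from wp_search[OF \<open>env st1\<close>, of "g x"] show ?case
        by (rule wp_conseq) (use near in blast)
    qed
  }
qed

text \<open>The cost is \<open>b * n\<close> minus \<open>b - a\<close> for each near client, so a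
  guarantee on near clients carries over linearly. Comparing with an arbitrary feasible solution
  avoids showing that the infimum in \<open>opt\<close> is attained.\<close>

theorem approximation_ratio:
  fixes I :: "(nat, nat) ckm"
  defines "n \<equiv> card (clients I)" and "m \<equiv> card (facilities I)" and "k \<equiv> num_open I"
  assumes I: "ckm_instance I" "indexed I" "two_valued I" and feas: "feasible I (F, \<sigma>)"
  shows "wp (2 * input_size I + 1) main_program
    (\<lambda>s. feasible I (decode I s) \<and> cost I (decode I s) \<le> 2.25 * cost I (F, \<sigma>)) (encode I)"
proof -
  have C: "clients I = {..<n}" and M: "facilities I = {..<m}"
    using I(2) by (auto simp: indexed_def n_def m_def)
  have F: "F \<subseteq> {..<m}" "card F = k" "\<And>j. j < n \<Longrightarrow> \<sigma> j \<in> F"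
    "\<And>i. i \<in> F \<Longrightarrow> card {j. j < n \<and> \<sigma> j = i} \<le> capacity I i"
    using feas by (auto simp: C M k_def)
  have k: "k \<le> m" using F card_mono[of "{..<m}" F] by simp
  define f where "f x = card {j. j < n \<and> near I x j (\<sigma> j)}" for x
  define g where "g x = (if bicliques n m (near I x) then f x else (4 * f x - n + 7) div 8)" for x
  show ?thesis
  proof (rule wp_conseq[OF wp_main_program[where g = g and I = I, folded n_def m_def k_def]], goal_cases)
    case (1 s)
    then obtain x where x: "nearest I x"
      "program_run.reachable n m (capacity I) (near I x) k (g x) \<Longrightarrow>
       program_run.output_ok n m (capacity I) (near I x) k (g x) s" using k by blast
    interpret program_run n m "capacity I" "near I x" "2 * input_size I + 1" k
      using k by unfold_locales (simp_all add: input_size_def n_def m_def)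
    have "reachable (g x)"
      using reachable_ranked[OF F] reachable_bicliques[OF _ F] by (auto simp: g_def f_def)
    then have out: "output_ok (g x) s" by (rule x(2))
    define \<tau> where "\<tau> = nats s ''assign''"
    have dec: "decode I s = (opened s, \<tau>)" by (auto simp: decode_def opened_def M \<tau>_def)
    have \<tau>: "\<And>j. j < n \<Longrightarrow> \<tau> j \<in> opened s" "g x \<le> card {j. j < n \<and> near I x j (\<tau> j)}"
      using out by (auto simp: output_ok_def \<tau>_def)
    have feas': "feasible I (decode I s)"
      using out by (auto simp: dec output_ok_def C M k_def[symmetric] \<tau>_def opened_def)
    obtain a b where ab: "0 \<le> a" "a \<le> b"
      "\<And>j i. j < n \<Longrightarrow> i < m \<Longrightarrow> distance I j i = (if near I x j i then a else b)"
    proof (cases "0 < n \<and> 0 < m")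
      case True
      obtain a b where "0 \<le> a" "0 \<le> b" "\<forall>j\<in>clients I. \<forall>i\<in>facilities I. distance I j i \<in> {a, b}"
        using I(3) by (auto simp: two_valued_def)
      then have ab: "0 \<le> a" "0 \<le> b" "\<And>j i. j < n \<Longrightarrow> i < m \<Longrightarrow> distance I j i \<in> {a, b}"
        by (auto simp: C M)
      have le: "\<And>j i. j < n \<Longrightarrow> i < m \<Longrightarrow> x \<le> distance I j i" and ex: "\<exists>j<n. \<exists>i<m. x = distance I j i"
        using x(1) True by (auto simp: nearest_def n_def m_def)
      \<comment> \<open>The attained minimum \<open>x\<close> takes the place of the smaller value.
        If \<open>x\<close> is the larger one, then all distances are equal to it and all pairs are
        near.\<close>
      have "x = a \<or> x = b" using ex ab(3) by blast
      then have x0: "0 \<le> x" "x \<le> max a b" using ab by auto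
      moreover have "distance I j i = (if near I x j i then x else max a b)" if "j < n" "i < m" for j i
        using le[OF that] ab(3)[OF that] \<open>x = a \<or> x = b\<close> by (auto simp: near_def)
      ultimately show ?thesis using that by blast
    next
      case False
      then show ?thesis using that[of 0 0] by auto
    qed
    have cost: "(\<Sum>j<n. distance I j (\<rho> j)) = b * n - (b - a) * card {j. j < n \<and> near I x j (\<rho> j)}"
      if "\<And>j. j < n \<Longrightarrow> \<rho> j < m" for \<rho>
    proof -
      have "(\<Sum>j<n. distance I j (\<rho> j)) = (\<Sum>j<n. b - (b - a) * of_bool (near I x j (\<rho> j)))"
        using ab(3) that by (intro sum.cong) auto
      also have "\<dots> = b * n - (b - a) * (\<Sum>j<n. of_bool (near I x j (\<rho> j)))"
        by (simp add: sum_subtractf sum_distrib_left)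
      also have "(\<Sum>j<n. of_bool (near I x j (\<rho> j))) = real (card {j. j < n \<and> near I x j (\<rho> j)})"
        by (simp add: of_bool_def sum.If_cases Int_def)
      finally show ?thesis .
    qed
    have cost_F: "cost I (F, \<sigma>) = b * n - (b - a) * f x"
      using cost[of \<sigma>] F by (auto simp: C f_def)
    have "cost I (decode I s) = b * n - (b - a) * card {j. j < n \<and> near I x j (\<tau> j)}"
      using cost[of \<tau>] \<tau>(1) by (auto simp: C dec opened_def)
    also have "\<dots> \<le> b * n - (b - a) * g x"
      using \<tau>(2) ab(2) by (intro diff_left_mono mult_left_mono) auto
    finally have cost_\<tau>: "cost I (decode I s) \<le> b * n - (b - a) * g x" .
    have fn: "f x \<le> n" unfolding f_def using card_mono[of "{..<n}" "{j. j < n \<and> near I x j (\<sigma> j)}"] by auto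
    have "b * n - (b - a) * g x \<le> 2.25 * (b * n - (b - a) * f x)"
    proof (cases "bicliques n m (near I x)")
      case True
      have "(b - a) * f x \<le> (b - a) * n" using fn ab by (intro mult_left_mono) auto
      moreover have "0 \<le> a * n" using ab by simp
      ultimately have "0 \<le> b * n - (b - a) * f x" by (simp add: algebra_simps)
      then show ?thesis using True by (simp add: g_def)
    next
      case False
      \<comment> \<open>Otherwise three near hops have total length \<open>3 * a < b\<close>, so the
        pair that closes the path is near as well and the relation consists of bicliques.\<close>
      have "b \<le> 3 * a"
      proof (rule ccontr)
        assume neg: "\<not> b \<le> 3 * a"
        have "bicliques n m (near I x)"
        proof
          fix i i' j j'
          assume *: "i < m" "i' < m" "j < n" "j' < n" "near I x j i" "near I x j i'" "near I x j' i"
          have "distance I j' i' \<le> distance I j' i + distance I j i + distance I j i'"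
            using I(1) * by (intro metric_distance_three_hops[of "clients I" "facilities I"])
              (auto simp: ckm_instance_def C M)
          also have "\<dots> = 3 * a" using * ab(3) by simp
          finally show "near I x j' i'" using neg ab(3)[of j' i'] * by (auto split: if_splits)
        qed
        then show False using False by blast
      qed
      have "4 * f x \<le> 8 * g x + n" using False by (simp add: g_def)
      then have fg: "4 * real (f x) \<le> 8 * real (g x) + real n" by linarith
      have "(b - a) * (4 * real (f x) - real n) \<le> (b - a) * (8 * real (g x))"
        using fg ab by (intro mult_left_mono) auto
      moreover have "(b - a) * f x \<le> (b - a) * n" using fn ab by (intro mult_left_mono) auto
      moreover have "b * n \<le> 3 * a * n" using \<open>b \<le> 3 * a\<close> by (intro mult_right_mono) auto
      \<comment> \<open>The bound on \<open>g x\<close> and \<open>f x \<le> n\<close> reduce the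
        claim to \<open>1.875 * (b - a) * n \<le> 1.25 * b * n\<close>, which is
        \<open>b \<le> 3 * a\<close> multiplied by \<open>0.625 * n\<close>.\<close>
      ultimately show ?thesis by (simp add: algebra_simps)
    qed
    with cost_\<tau> have "cost I (decode I s) \<le> 2.25 * cost I (F, \<sigma>)"
      unfolding cost_F by (rule order_trans)
    then show ?case using feas' by blast
  qed
qed

lemma wp_exec: "wp N c Q s \<Longrightarrow> \<exists>t s'. exec c s t s' \<and> t \<le> time_bound N c \<and> Q s'"
  by (simp add: wp_def)

theorem theorem7:
  shows "\<exists>c. approximation_algorithm c two_valued 2.294 \<and>
    (\<exists>T. runs_in_time c two_valued T \<and> (\<lambda>n. real (T n)) \<in> O(\<lambda>n. real n ^ 4))"
proof (intro exI conjI)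
  show "approximation_algorithm main_program two_valued 2.294"
    unfolding approximation_algorithm_def
  proof (intro allI impI)
    fix I :: "(nat, nat) ckm"
    assume I: "ckm_instance I \<and> indexed I \<and> two_valued I"
    \<comment> \<open>One run is fixed first. By determinism the runs obtained for the various
      feasible \<open>S\<close> all coincide with it, so its output can be compared with every
      \<open>S\<close> at once.\<close>
    obtain t s where e: "exec main_program (encode I) t s"
      using wp_exec[OF wp_main_program[of I "\<lambda>_. 0"]] by blast
    have good: "feasible I (decode I s) \<and> cost I (decode I s) \<le> 2.25 * cost I S" if "feasible I S" for S
    proof -
      obtain F \<sigma> where S: "S = (F, \<sigma>)" by (cases S)
      have "\<exists>t s. exec main_program (encode I) t s \<and> t \<le> time_bound (2 * input_size I + 1) main_program \<and>
          feasible I (decode I s) \<and> cost I (decode I s) \<le> 2.25 * cost I (F, \<sigma>)"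
        using I that S by (intro wp_exec approximation_ratio) auto
      then show ?thesis using exec_deterministic[OF e] S by blast
    qed
    have "cost I (decode I s) \<le> 2.294 * opt I" if ex: "\<exists>S. feasible I S"
    proof -
      have nonneg: "0 \<le> cost I S" if "feasible I S" for S
      proof -
        obtain F \<sigma> where S: "S = (F, \<sigma>)" by (cases S)
        have "0 \<le> distance I j (\<sigma> j)" if "j \<in> clients I" for j
        proof -
          have "\<sigma> j \<in> facilities I" using \<open>feasible I S\<close> that S by auto
          then show ?thesis using I that by (auto simp: two_valued_def)
        qed
        then show ?thesis unfolding S cost.simps by (rule sum_nonneg)
      qed
      \<comment> \<open>Dividing by the factor isolates the infimum, so that a comparison with each
        feasible \<open>S\<close> is enough. Costs are nonnegative, which allows the step from 2.25
        to 2.294.\<close>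
      have "cost I (decode I s) / 2.294 \<le> opt I"
        unfolding opt_def
      proof (rule cINF_greatest)
        show "{S. feasible I S} \<noteq> {}" using ex by auto
        fix S
        assume "S \<in> {S. feasible I S}"
        then show "cost I (decode I s) / 2.294 \<le> cost I S"
          using good[of S] nonneg[of S] by (simp add: field_simps)
      qed
      then show ?thesis by (simp add: field_simps)
    qed
    then show "\<exists>t s. exec main_program (encode I) t s \<and> ((\<exists>S. feasible I S) \<longrightarrow>
        feasible I (decode I s) \<and> cost I (decode I s) \<le> 2.294 * opt I)"
      using e good by blast
  qed
next
  define T where "T x = com_size main_program * (2 * x + 1) ^ 4" for x
  show "runs_in_time main_program two_valued T"
    unfolding runs_in_time_def
  proof (intro allI impI)
    fix I :: "(nat, nat) ckm"
    obtain t s where "exec main_program (encode I) t s" "t \<le> time_bound (2 * input_size I + 1) main_program"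
      using wp_exec[OF wp_main_program[of I "\<lambda>_. 0"]] by blast
    moreover have "time_bound (2 * input_size I + 1) main_program \<le> T (input_size I)"
      using time_bound_le[of "2 * input_size I + 1" main_program]
      by (simp add: T_def loop_depth_main_program)
    ultimately show "\<exists>t s. exec main_program (encode I) t s \<and> t \<le> T (input_size I)"
      using order_trans by blast
  qed
  show "(\<lambda>n. real (T n)) \<in> O(\<lambda>n. real n ^ 4)"
  \<comment> \<open>The constant 81 is \<open>3 ^ 4\<close>, as \<open>2 * x + 1 \<le> 3 * x\<close>
    for \<open>x \<ge> 1\<close>.\<close>
  proof (rule bigoI[of _ "real (com_size main_program) * 81"])
    show "\<forall>\<^sub>F x in at_top. norm (real (T x)) \<le> real (com_size main_program) * 81 * norm (real x ^ 4)"
      using eventually_ge_at_top[of 1]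
    proof eventually_elim
      case (elim x)
      have "(2 * real x + 1) ^ 4 \<le> (3 * real x) ^ 4" using elim by (intro power_mono) auto
      then have "real (com_size main_program) * (2 * real x + 1) ^ 4 \<le>
          real (com_size main_program) * (81 * real x ^ 4)"
        by (intro mult_left_mono) (simp_all add: power_mult_distrib)
      then show ?case by (simp add: T_def add.commute)
    qed
  qed
qed

end
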